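(* Every planar oriented graph $G$ with $n$ vertices and $m$ arcs satisfies $\mathrm{fv}(G) \le \frac{2n + m}{9}$ and thus $\mathrm{fv}(G) \le \frac{5n-6}{9}$.
   Context: An oriented graph is a directed graph with no loops, no parallel arcs and no digons (no pair of opposite arcs between the same two vertices). It is planar if its underlying undirected graph is planar. $\mathrm{fv}(G)$ denotes the minimum number of vertices whose deletion from $G$ leaves a graph with no directed cycle.
   Formalization: The second bound fv(G) ≤ (5n−6)/9 is stated only for n ≥ 2, since it fails for n = 0 and n = 1, where fv(G) = 0 but the right side is negative. *)

theory Defs
  imports "HOL-Analysis.Analysis" "Graph_Theory.Graph_Theory"
begin

locale oriented_graph = digraph +
  assumes no_digons:
    "\<lbrakk>e \<in> arcs G; f \<in> arcs G\<rbrakk> \<Longrightarrow> \<not> (tail G e = head G f \<and> head G e = tail G f)"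

definition underlying_edges :: "('a, 'b) pre_digraph \<Rightarrow> 'a set set" where
  "underlying_edges G = (\<lambda>e. {tail G e, head G e}) ` arcs G"

text \<open>
  A plane drawing of the simple undirected graph with vertex set \<open>V\<close> and edge set \<open>E\<close>
  (a set of two-element subsets of \<open>V\<close>): vertices are distinct points, each edge is a simple arc
  joining its two ends and containing no other vertex, and two different edges meet only in
  vertices. The constant \<open>arc\<close> is the one of \<open>HOL-Analysis\<close>: an injective continuous path.
\<close>

definition plane_drawing ::
  "'a set \<Rightarrow> 'a set set \<Rightarrow> ('a \<Rightarrow> complex) \<Rightarrow> ('a set \<Rightarrow> real \<Rightarrow> complex) \<Rightarrow> bool" where
  "plane_drawing V E p \<gamma> \<longleftrightarrow>
     inj_on p V \<and>
     (\<forall>e\<in>E. arc (\<gamma> e) \<and> {pathstart (\<gamma> e), pathfinish (\<gamma> e)} = p ` e \<and>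
             path_image (\<gamma> e) \<inter> p ` V = p ` e) \<and>
     (\<forall>e\<in>E. \<forall>f\<in>E. e \<noteq> f \<longrightarrow> path_image (\<gamma> e) \<inter> path_image (\<gamma> f) \<subseteq> p ` V)"

definition planar_graph :: "'a set \<Rightarrow> 'a set set \<Rightarrow> bool" where
  "planar_graph V E \<longleftrightarrow> (\<exists>p \<gamma>. plane_drawing V E p \<gamma>)"

definition planar :: "('a, 'b) pre_digraph \<Rightarrow> bool" where
  "planar G \<longleftrightarrow> planar_graph (verts G) (underlying_edges G)"

definition feedback_vertex_set :: "('a, 'b) pre_digraph \<Rightarrow> 'a set \<Rightarrow> bool" where
  "feedback_vertex_set G S \<longleftrightarrow>
     S \<subseteq> verts G \<and> (\<nexists>c. pre_digraph.cycle (G \<restriction> (verts G - S)) c)"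

definition fv :: "('a, 'b) pre_digraph \<Rightarrow> nat" where
  "fv G = (LEAST k. \<exists>S. finite S \<and> feedback_vertex_set G S \<and> card S = k)"

end

(*
  Delete a set P of vertices and then, one after another, vertices that have become sources or
  sinks, reaching a set Z. If 9 |P| <= 2 |Z| + (number of arcs incident to Z), induction on the
  remaining digraph gives the bound (2n + m)/9. In a digraph without such a gain, a finite case
  analysis shows that every vertex has in-degree and out-degree 3, so m = 3n. This is impossible
  for planar graphs, where m <= 3n - 6; the same inequality gives the second bound.

  The inequality m <= 3n - 6 is proved without faces: a minimal counterexample to it has a K(5) minor,
  and a K(5) minor is excluded by the Jordan curve theorem and Janiszewski's theorem.
*)

theory Submission
  imports Defs
begin

section \<open>Peeling sources and sinks\<close>

text \<open>The weights suit planar graphs: m <= 3n - 6 turns the budget 2n + m into 5n - 6. A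
  vertex of degree 7 pays for its own deletion, since 2 + 7 = 9; degree 6 misses by one, and exactly
  the types with in-degree and out-degree 3 survive, to be excluded by counting arcs. Planarity
  enters the digraph part only through this count, which every set of vertices inherits, so gains
  can be studied in arbitrary finite digraphs without loops and digons. There all degrees are at
  most 6, so the surroundings of a hypothetical vertex can be explored by a finite search tree. The
  trees are stored as certificates and replayed by the checker \<open>refutes\<close>, which is
  proved sound. For the edge bound, excluding K(5) is enough: a graph on n >= 3 vertices with more
  than 3n - 6 edges has a K(5) minor, whereas excluding K(3, 3) alone says nothing about the
  neighbourhoods that arise. Since the arcs of a drawing are merely continuous, K(3, 3) is treated
  only in the form of three arcs with common ends, and K(5) is reduced to it.\<close>

definition incident :: "'a rel \<Rightarrow> 'a set \<Rightarrow> 'a rel" where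
  "incident E Z = {(a, b) \<in> E. a \<in> Z \<or> b \<in> Z}"

text \<open>When \<open>x\<close> is added it is a source or a sink of the digraph outside
  \<open>Z\<close>, hence on no cycle that avoids \<open>Z\<close>. Only \<open>P\<close> has to be
  paid for, while all of \<open>Z\<close> leaves the digraph.\<close>

inductive peels :: "'a rel \<Rightarrow> 'a set \<Rightarrow> 'a set \<Rightarrow> bool" for E P where
  start: "peels E P P"
| peel: "peels E P Z \<Longrightarrow> E\<inverse> `` {x} \<subseteq> Z \<or> E `` {x} \<subseteq> Z \<Longrightarrow> peels E P (insert x Z)"

text \<open>A closed walk through \<open>x\<close> would have to enter \<open>x\<close>. Walks in
  \<open>A\<close> never end at \<open>x\<close>, so those that start elsewhere avoid it
  altogether.\<close>

lemma acyclic_insert_source: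
  assumes acyc: "acyclic (Restr E (A - {x}))" and no_in: "\<And>y. y \<in> A \<Longrightarrow> (y, x) \<notin> E"
  shows "acyclic (Restr E A)"
proof -
  have end_ne: "b \<noteq> x" if "(a, b) \<in> (Restr E A)\<^sup>+" for a b
    using that by (cases rule: trancl.cases) (use no_in in blast)+
  have restr: "a \<noteq> x \<longrightarrow> (a, b) \<in> (Restr E (A - {x}))\<^sup>+" if "(a, b) \<in> (Restr E A)\<^sup>+" for a b
    using that
  proof (induction rule: trancl.induct)
    case (r_into_trancl a b)
    then have "b \<noteq> x" using no_in by blast
    then show ?case using r_into_trancl by blast
  next
    case (trancl_into_trancl a b c)
    then have "b \<noteq> x" "c \<noteq> x" using end_ne no_in by blast+
    then have "(b, c) \<in> Restr E (A - {x})" using trancl_into_trancl.hyps(2) by blast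
    with trancl_into_trancl.IH show ?case by (meson trancl.trancl_into_trancl)
  qed
  show ?thesis
    unfolding acyclic_def
  proof (intro allI notI)
    fix y assume y: "(y, y) \<in> (Restr E A)\<^sup>+"
    with end_ne restr have "(y, y) \<in> (Restr E (A - {x}))\<^sup>+" by blast
    with acyc show False by (simp add: acyclic_def)
  qed
qed

lemma acyclic_insert_sink:
  assumes acyc: "acyclic (Restr E (A - {x}))" and no_out: "\<And>y. y \<in> A \<Longrightarrow> (x, y) \<notin> E"
  shows "acyclic (Restr E A)"
proof -
  have conv: "(Restr E B)\<inverse> = Restr (E\<inverse>) B" for B by blast
  have "acyclic (Restr (E\<inverse>) (A - {x}))"
    using acyc acyclic_converse[of "Restr E (A - {x})"] by (simp only: conv)
  then have "acyclic (Restr (E\<inverse>) A)"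
    by (rule acyclic_insert_source) (simp add: no_out)
  then show ?thesis using acyclic_converse[of "Restr E A"] by (simp only: conv)
qed

text \<open>The peeled vertices are put back in reverse order; each returns as a source or a sink
  and closes no cycle.\<close>

lemma peels_acyclic:
  assumes "peels E P Z" and "acyclic (Restr E (A - Z))"
  shows "acyclic (Restr E (A - P))"
  using assms
proof (induction rule: peels.induct)
  case (peel Z x)
  have "A - insert x Z = (A - Z) - {x}" by blast
  then have acyc: "acyclic (Restr E ((A - Z) - {x}))" using peel.prems by simp
  from peel.hyps(2) have "acyclic (Restr E (A - Z))"
  proof
    assume "E\<inverse> `` {x} \<subseteq> Z"
    then show ?thesis by (intro acyclic_insert_source[OF acyc]) blast
  next
    assume "E `` {x} \<subseteq> Z"
    then show ?thesis by (intro acyclic_insert_sink[OF acyc]) blast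
  qed
  then show ?case by (rule peel.IH)
qed

text \<open>The situation in which induction gets stuck. \<open>P\<close> may be empty, in which
  case \<open>no_gain\<close> forbids sources and sinks.\<close>

locale irreducible_digraph =
  fixes V :: "'a set" and E :: "'a rel"
  assumes finite_V: "finite V"
    and arcs_V: "E \<subseteq> V \<times> V"
    and asym_arcs: "asym E"
    and no_gain: "\<lbrakk>peels E P Z; P \<subseteq> Z; Z \<subseteq> V; Z \<noteq> {}\<rbrakk> \<Longrightarrow>
      2 * card Z + card (incident E Z) < 9 * card P"

lemma peels_converse: "peels (E\<inverse>) P Z \<Longrightarrow> peels E P Z"
  by (induction rule: peels.induct) (auto intro: peels.intros)

lemma card_incident_converse: "card (incident (E\<inverse>) Z) = card (incident E Z)"
proof -
  have "incident (E\<inverse>) Z = (incident E Z)\<inverse>" by (auto simp: incident_def)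
  then show ?thesis by simp
qed

text \<open>Reversal symmetry halves the case analysis: whatever is excluded is excluded together
  with its reversal.\<close>

lemma irreducible_converse:
  assumes "irreducible_digraph V E"
  shows "irreducible_digraph V (E\<inverse>)"
proof -
  interpret irreducible_digraph V E by fact
  show ?thesis
  proof
    show "2 * card Z + card (incident (E\<inverse>) Z) < 9 * card P"
      if "peels (E\<inverse>) P Z" "P \<subseteq> Z" "Z \<subseteq> V" "Z \<noteq> {}" for P Z
      using that no_gain[OF peels_converse] by (simp add: card_incident_converse)
    show "asym (E\<inverse>)" using asym_arcs by (blast intro: asymI dest: asymD)
  qed (use finite_V arcs_V in auto)
qed

section \<open>Vertex types and configurations\<close>

definition vtype :: "'a rel \<Rightarrow> 'a \<Rightarrow> nat \<times> nat" where
  "vtype E v = (card (E\<inverse> `` {v}), card (E `` {v}))"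

lemma vtype_converse: "vtype (E\<inverse>) v = prod.swap (vtype E v)"
  by (simp add: vtype_def)

text \<open>
  A configuration \<open>(ts, as, ns)\<close> is a partially known digraph on the vertices \<open>0, \<dots>, length ts - 1\<close>:
  \<open>ts\<close> lists their types, that is, (in-degree, out-degree) in the host digraph, \<open>as\<close> the arcs found so
  far, and \<open>ns\<close> pairs already known not to be arcs.
\<close>

type_synonym config = "(nat \<times> nat) list \<times> (nat \<times> nat) list \<times> (nat \<times> nat) list"

text \<open>The image need not be an induced subdigraph: a pair in neither list is undecided. With
  \<open>distinct as\<close>, lengths of lists of known arcs are true counts.\<close>

definition realizes :: "'a set \<Rightarrow> 'a rel \<Rightarrow> (nat \<Rightarrow> 'a) \<Rightarrow> config \<Rightarrow> bool" where
  "realizes V E f c = (case c of (ts, as, ns) \<Rightarrow>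
     inj_on f {..<length ts} \<and> (\<forall>i<length ts. f i \<in> V \<and> vtype E (f i) = ts ! i) \<and> distinct as \<and>
     (\<forall>(i, j)\<in>set as. i < length ts \<and> j < length ts \<and> (f i, f j) \<in> E) \<and>
     (\<forall>(i, j)\<in>set ns. i < length ts \<and> j < length ts \<and> (f i, f j) \<notin> E))"

lemma realizesD:
  assumes "realizes V E f (ts, as, ns)"
  shows "inj_on f {..<length ts}" "i < length ts \<Longrightarrow> f i \<in> V"
    "i < length ts \<Longrightarrow> card (E\<inverse> `` {f i}) = fst (ts ! i)"
    "i < length ts \<Longrightarrow> card (E `` {f i}) = snd (ts ! i)" "distinct as"
    "(i, j) \<in> set as \<Longrightarrow> i < length ts" "(i, j) \<in> set as \<Longrightarrow> j < length ts"
    "(i, j) \<in> set as \<Longrightarrow> (f i, f j) \<in> E"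
    "(i, j) \<in> set ns \<Longrightarrow> (f i, f j) \<notin> E"
proof -
  have "f i \<in> V \<and> vtype E (f i) = ts ! i" if "i < length ts"
    using assms that by (simp add: realizes_def)
  then show "i < length ts \<Longrightarrow> f i \<in> V"
    "i < length ts \<Longrightarrow> card (E\<inverse> `` {f i}) = fst (ts ! i)"
    "i < length ts \<Longrightarrow> card (E `` {f i}) = snd (ts ! i)"
    by (metis vtype_def fst_conv snd_conv)+
qed (use assms in \<open>auto simp: realizes_def\<close>)

definition avoids :: "'a set \<Rightarrow> 'a rel \<Rightarrow> config \<Rightarrow> bool" where
  "avoids V E c \<longleftrightarrow> (\<nexists>f. realizes V E f c)"

fun flip :: "config \<Rightarrow> config" where
  "flip (ts, as, ns) = (map prod.swap ts, map prod.swap as, map prod.swap ns)"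

lemma realizes_flip: "realizes V E f c \<Longrightarrow> realizes V (E\<inverse>) f (flip c)"
  by (cases c) (auto simp: realizes_def vtype_converse distinct_map)

lemma avoids_converse: "avoids V (E\<inverse>) c \<Longrightarrow> avoids V E (flip c)"
proof -
  have "flip (flip c) = c" by (cases c) (simp add: comp_def)
  then show "avoids V (E\<inverse>) c \<Longrightarrow> avoids V E (flip c)"
    using realizes_flip[of V E _ "flip c"] by (auto simp: avoids_def)
qed

section \<open>Checking reducibility certificates\<close>

fun known_in :: "(nat \<times> nat) list \<Rightarrow> nat \<Rightarrow> nat list" where
  "known_in [] v = []"
| "known_in ((a, b) # as) v = (if b = v then a # known_in as v else known_in as v)"

fun known_out :: "(nat \<times> nat) list \<Rightarrow> nat \<Rightarrow> nat list" where
  "known_out [] v = []"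
| "known_out ((a, b) # as) v = (if a = v then b # known_out as v else known_out as v)"

definition stub_in :: "(nat \<times> nat) list \<Rightarrow> (nat \<times> nat) list \<Rightarrow> nat \<Rightarrow> bool" where
  "stub_in ts as v \<longleftrightarrow> length (known_in as v) < fst (ts ! v)"

definition stub_out :: "(nat \<times> nat) list \<Rightarrow> (nat \<times> nat) list \<Rightarrow> nat \<Rightarrow> bool" where
  "stub_out ts as v \<longleftrightarrow> length (known_out as v) < snd (ts ! v)"

text \<open>A necessary condition for an arc not yet recorded: it uses a free stub at both ends and
  creates no loop and no digon.\<close>

definition may_arc where
  "may_arc ts as ns u v \<longleftrightarrow> stub_out ts as u \<and> stub_in ts as v \<and> u \<noteq> v \<and>
     (u, v) \<notin> set as \<and> (v, u) \<notin> set as \<and> (u, v) \<notin> set ns"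

definition may_adj where
  "may_adj ts as ns u v \<longleftrightarrow>
     (u, v) \<in> set as \<or> (v, u) \<in> set as \<or> may_arc ts as ns u v \<or> may_arc ts as ns v u"

text \<open>Without digons a pair of vertices carries at most one arc, so counting possibly adjacent
  pairs bounds the arcs inside the list from above.\<close>

fun pair_bound where
  "pair_bound ts as ns [] = (0::nat)"
| "pair_bound ts as ns (x # xs) = length (filter (may_adj ts as ns x) xs) + pair_bound ts as ns xs"

text \<open>A vertex counts as peelable only if the relevant neighbourhood is known completely; a
  remaining stub might lead outside \<open>zs\<close>.\<close>

fun frees where
  "frees ts as zs [] = True"
| "frees ts as zs (x # xs) =
     ((\<not> stub_in ts as x \<and> set (known_in as x) \<subseteq> set zs \<or>
       \<not> stub_out ts as x \<and> set (known_out as x) \<subseteq> set zs) \<and> frees ts as (x # zs) xs)"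

text \<open>
  Deleting \<open>ps\<close> and then peeling \<open>fs\<close> is a gain in every realization: the number of arcs incident
  to \<open>zs\<close> is the degree sum minus the number of arcs inside \<open>zs\<close>, which is bounded by \<open>pair_bound\<close>.
\<close>

definition pays :: "nat list \<Rightarrow> nat list \<Rightarrow> config \<Rightarrow> bool" where
  "pays ps fs c = (case c of (ts, as, ns) \<Rightarrow> let zs = ps @ fs in
     zs \<noteq> [] \<and> distinct zs \<and> (\<forall>z\<in>set zs. z < length ts) \<and> frees ts as ps fs \<and>
     9 * length ps + pair_bound ts as ns zs
       \<le> 2 * length zs + sum_list (map (\<lambda>z. fst (ts ! z) + snd (ts ! z)) zs))"

definition embeds :: "config \<Rightarrow> nat list \<Rightarrow> config \<Rightarrow> bool" where
  "embeds g m c = (case (g, c) of ((ts', as', ns'), (ts, as, ns)) \<Rightarrow>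
     ns' = [] \<and> distinct as' \<and> distinct m \<and> (\<forall>i\<in>set m. i < length ts) \<and> map ((!) ts) m = ts' \<and>
     (\<forall>(i, j)\<in>set as'. i < length m \<and> j < length m \<and> (m ! i, m ! j) \<in> set as))"

definition dir_arc :: "bool \<Rightarrow> 'b \<Rightarrow> 'b \<Rightarrow> 'b \<times> 'b" where
  "dir_arc d u v = (if d then (u, v) else (v, u))"

text \<open>Each branch also records the candidates rejected before it, which lowers
  \<open>pair_bound\<close> and makes later gains easier. Once all old vertices are rejected, the
  stub ends in a new vertex.\<close>

fun extend :: "(nat \<times> nat) list \<Rightarrow> bool \<Rightarrow> nat \<Rightarrow> (nat \<times> nat) list \<Rightarrow> (nat \<times> nat) list \<Rightarrow>
    (nat \<times> nat) list \<Rightarrow> nat list \<Rightarrow> config list" where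
  "extend T d v ts as ns [] = map (\<lambda>t. (ts @ [t], dir_arc d (length ts) v # as, ns)) T"
| "extend T d v ts as ns (u # us) =
     (if (if d then may_arc ts as ns u v else may_arc ts as ns v u)
      then (ts, dir_arc d u v # as, ns) # extend T d v ts as (dir_arc d u v # ns) us
      else extend T d v ts as ns us)"

text \<open>
  A certificate is the preorder traversal of a search tree; the last argument of \<open>refutes\<close> is the
  stack of open configurations. \<open>Pay ps fs\<close> closes the top one by a gain (and all following ones that
  the same gain closes), \<open>Emb g m\<close> closes it because it contains the excluded configuration \<open>NG ! g\<close>,
  and \<open>Ask d v\<close> branches over the other end of an unknown in-arc (\<open>d = True\<close>) or out-arc of \<open>v\<close>: an
  old vertex, or a new one whose type is in \<open>T\<close>.
\<close>

datatype token = Pay "nat list" "nat list" | Emb nat "nat list" | Ask bool nat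

fun refutes :: "(nat \<times> nat) list \<Rightarrow> config list \<Rightarrow> token list \<Rightarrow> config list \<Rightarrow> bool" where
  "refutes T NG [] cs = (cs = [])"
| "refutes T NG (tk # tks) [] = False"
| "refutes T NG (Pay ps fs # tks) (c # cs) =
     (if pays ps fs c then refutes T NG tks (dropWhile (pays ps fs) cs) else False)"
| "refutes T NG (Emb g m # tks) (c # cs) =
     (if g < length NG \<and> embeds (NG ! g) m c then refutes T NG tks cs else False)"
| "refutes T NG (Ask d v # tks) (c # cs) = (case c of (ts, as, ns) \<Rightarrow>
     if v < length ts \<and> (if d then stub_in ts as v else stub_out ts as v)
     then refutes T NG tks (extend T d v ts as ns [0..<length ts] @ cs) else False)"

section \<open>Soundness of the checker\<close>

lemma set_known [simp]:
  "set (known_in as v) = {a. (a, v) \<in> set as}" "set (known_out as v) = {b. (v, b) \<in> set as}"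
  by (induction as) (auto split: if_splits)

lemma distinct_known:
  assumes "distinct as"
  shows "distinct (known_in as v)" "distinct (known_out as v)"
  using assms by (induction as) auto

context irreducible_digraph
begin

lemma asym_E: "(a, b) \<in> E \<Longrightarrow> (b, a) \<notin> E"
  using asym_arcs by (rule asymD)

lemma finite_E: "finite E"
  using finite_V arcs_V finite_subset by blast

lemma finite_nbrs: "finite (E `` A)" "finite (E\<inverse> `` A)"
  by (rule finite_subset[OF _ finite_V], use arcs_V in auto)+

lemma irrefl_E: "(a, a) \<notin> E"
  using asym_E by blast

text \<open>The degree sum over \<open>Z\<close> counts an incident arc once for each of its ends in
  \<open>Z\<close>, hence arcs inside \<open>Z\<close> twice.\<close>

lemma card_incident:
  assumes "finite Z"
  shows "card (incident E Z) + card (Restr E Z) = (\<Sum>z\<in>Z. fst (vtype E z) + snd (vtype E z))"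
proof -
  have o: "card (E \<inter> Z \<times> UNIV) = (\<Sum>z\<in>Z. card (E `` {z}))"
  proof -
    have "E \<inter> Z \<times> UNIV = (SIGMA z:Z. E `` {z})" by auto
    then show ?thesis using assms by (simp add: card_SigmaI finite_nbrs)
  qed
  have i: "card (E \<inter> UNIV \<times> Z) = (\<Sum>z\<in>Z. card (E\<inverse> `` {z}))"
  proof -
    have "E \<inter> UNIV \<times> Z = (SIGMA z:Z. E\<inverse> `` {z})\<inverse>" by auto
    then show ?thesis using assms by (simp add: card_SigmaI finite_nbrs)
  qed
  have "incident E Z = (E \<inter> Z \<times> UNIV) \<union> (E \<inter> UNIV \<times> Z)" by (auto simp: incident_def)
  moreover have "Restr E Z = (E \<inter> Z \<times> UNIV) \<inter> (E \<inter> UNIV \<times> Z)" by auto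
  ultimately have "card (incident E Z) + card (Restr E Z)
      = card (E \<inter> Z \<times> UNIV) + card (E \<inter> UNIV \<times> Z)"
    using card_Un_Int[of "E \<inter> Z \<times> UNIV" "E \<inter> UNIV \<times> Z"] finite_E by simp
  then show ?thesis by (simp add: o i vtype_def sum.distrib)
qed

text \<open>The recorded in-neighbours are distinct and at least as many as the in-degree, so there
  are no others.\<close>

lemma saturated_in:
  assumes "realizes V E f (ts, as, ns)" "v < length ts" "\<not> stub_in ts as v"
  shows "E\<inverse> `` {f v} = f ` {a. (a, v) \<in> set as}"
proof -
  let ?K = "set (known_in as v)"
  have sub: "f ` ?K \<subseteq> E\<inverse> `` {f v}" using assms(1) by (auto simp: realizes_def)
  have "inj_on f ?K" using assms(1) by (auto simp: realizes_def intro: inj_on_subset)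
  then have "card (f ` ?K) = length (known_in as v)"
    using assms(1) distinct_known(1)[of as v]
    by (simp add: card_image realizes_def distinct_card del: set_known)
  moreover have "card (E\<inverse> `` {f v}) = fst (ts ! v)"
    using realizesD[OF assms(1)] assms(2) by blast
  ultimately have "card (E\<inverse> `` {f v}) \<le> card (f ` ?K)"
    using assms(3) by (simp add: stub_in_def)
  with sub have "f ` ?K = E\<inverse> `` {f v}" using finite_nbrs by (intro card_seteq) auto
  then show ?thesis by simp
qed

lemma saturated_out:
  assumes "realizes V E f (ts, as, ns)" "v < length ts" "\<not> stub_out ts as v"
  shows "E `` {f v} = f ` {b. (v, b) \<in> set as}"
proof -
  let ?K = "set (known_out as v)"
  have sub: "f ` ?K \<subseteq> E `` {f v}" using assms(1) by (auto simp: realizes_def)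
  have "inj_on f ?K" using assms(1) by (auto simp: realizes_def intro: inj_on_subset)
  then have "card (f ` ?K) = length (known_out as v)"
    using assms(1) distinct_known(2)[of as v]
    by (simp add: card_image realizes_def distinct_card del: set_known)
  moreover have "card (E `` {f v}) = snd (ts ! v)"
    using realizesD[OF assms(1)] assms(2) by blast
  ultimately have "card (E `` {f v}) \<le> card (f ` ?K)"
    using assms(3) by (simp add: stub_out_def)
  with sub have "f ` ?K = E `` {f v}" using finite_nbrs by (intro card_seteq) auto
  then show ?thesis by simp
qed

text \<open>If a stub were missing at one end, the neighbourhood there would be saturated, and by
  injectivity of \<open>f\<close> the arc would already be recorded.\<close>

lemma may_arc_complete:
  assumes r: "realizes V E f (ts, as, ns)" and uv: "u < length ts" "v < length ts"
    and e: "(f u, f v) \<in> E" and n: "(u, v) \<notin> set as"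
  shows "may_arc ts as ns u v"
proof -
  have inj: "inj_on f {..<length ts}" and lt: "\<And>i j. (i, j) \<in> set as \<Longrightarrow> i < length ts \<and> j < length ts"
    using r by (auto simp: realizes_def)
  have "stub_out ts as u"
  proof (rule ccontr)
    assume "\<not> stub_out ts as u"
    then have "f v \<in> f ` {b. (u, b) \<in> set as}" using saturated_out[OF r uv(1)] e by blast
    then show False using n inj lt uv by (auto simp: inj_on_def)
  qed
  moreover have "stub_in ts as v"
  proof (rule ccontr)
    assume "\<not> stub_in ts as v"
    then have "f u \<in> f ` {b. (b, v) \<in> set as}" using saturated_in[OF r uv(2)] e by blast
    then show False using n inj lt uv by (auto simp: inj_on_def)
  qed
  moreover have "u \<noteq> v" "(v, u) \<notin> set as" "(u, v) \<notin> set ns"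
    using r e asym_E by (auto simp: realizes_def)
  ultimately show ?thesis using n by (simp add: may_arc_def)
qed

lemma card_Restr_le_pair_bound:
  assumes r: "realizes V E f (ts, as, ns)" and zs: "distinct zs" "\<forall>z\<in>set zs. z < length ts"
  shows "card (Restr E (f ` set zs)) \<le> pair_bound ts as ns zs"
  using zs
proof (induction zs)
  case (Cons x xs)
  let ?X = "f ` set xs" and ?A = "set (filter (may_adj ts as ns x) xs)"
  \<comment> \<open>An arc that is new with \<open>x\<close> joins \<open>f x\<close> to some
    \<open>f y\<close>. Only one direction can occur, so \<open>y\<close> determines the
    arc.\<close>
  let ?g = "\<lambda>y. if (f x, f y) \<in> E then (f x, f y) else (f y, f x)"
  have "Restr E (f ` set (x # xs)) \<subseteq> Restr E ?X \<union> ?g ` ?A"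
  proof
    fix e assume e: "e \<in> Restr E (f ` set (x # xs))"
    show "e \<in> Restr E ?X \<union> ?g ` ?A"
    proof (cases "e \<in> Restr E ?X")
      case False
      then obtain y where y: "y \<in> set xs" "e = (f x, f y) \<and> (f x, f y) \<in> E \<or> e = (f y, f x) \<and> (f y, f x) \<in> E"
        using e irrefl_E by auto
      then have "may_adj ts as ns x y"
        using may_arc_complete[OF r, of x y] may_arc_complete[OF r, of y x] Cons.prems
        by (auto simp: may_adj_def)
      moreover have "e = ?g y" using y asym_E by auto
      ultimately show ?thesis using y(1) by auto
    qed simp
  qed
  then have "card (Restr E (f ` set (x # xs))) \<le> card (Restr E ?X \<union> ?g ` ?A)"
    using finite_E by (intro card_mono) auto
  also have "\<dots> \<le> card (Restr E ?X) + card (?g ` ?A)" by (rule card_Un_le)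
  also have "card (?g ` ?A) \<le> length (filter (may_adj ts as ns x) xs)"
    by (meson card_image_le card_length finite_set le_trans)
  finally show ?case using Cons by simp
qed simp

lemma frees_peels:
  assumes r: "realizes V E f (ts, as, ns)"
  shows "\<lbrakk>frees ts as zs xs; peels E Q (f ` set zs); \<forall>x\<in>set xs. x < length ts\<rbrakk>
    \<Longrightarrow> peels E Q (f ` (set zs \<union> set xs))"
proof (induction xs arbitrary: zs)
  case (Cons x xs)
  have "E\<inverse> `` {f x} \<subseteq> f ` set zs \<or> E `` {f x} \<subseteq> f ` set zs"
  proof -
    have "x < length ts" using Cons.prems(3) by simp
    moreover have "\<not> stub_in ts as x \<and> {a. (a, x) \<in> set as} \<subseteq> set zs \<or>
       \<not> stub_out ts as x \<and> {b. (x, b) \<in> set as} \<subseteq> set zs"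
      using Cons.prems(1) by simp
    ultimately show ?thesis
      using saturated_in[OF r, of x] saturated_out[OF r, of x] by (metis image_mono)
  qed
  then have "peels E Q (f ` set (x # zs))" using Cons.prems(2) by (auto intro: peels.peel)
  then have "peels E Q (f ` (set (x # zs) \<union> set xs))" using Cons.prems by (intro Cons.IH) auto
  then show ?case by simp
qed simp

lemma not_pays:
  assumes r: "realizes V E f c"
  shows "\<not> pays ps fs c"
proof
  assume p: "pays ps fs c"
  obtain ts as ns where c: "c = (ts, as, ns)" by (cases c)
  let ?zs = "ps @ fs"
  let ?Z = "f ` set ?zs"
  note r = r[unfolded c]
  have zs: "?zs \<noteq> []" "distinct ?zs" "\<forall>z\<in>set ?zs. z < length ts" "frees ts as ps fs"
    and le: "9 * length ps + pair_bound ts as ns ?zs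
      \<le> 2 * length ?zs + sum_list (map (\<lambda>z. fst (ts ! z) + snd (ts ! z)) ?zs)"
    using p by (simp_all add: pays_def c Let_def)
  have inj: "inj_on f (set ?zs)" "inj_on f (set ps)"
    using r zs(3) by (auto simp: realizes_def intro: inj_on_subset)
  have "peels E (f ` set ps) ?Z"
    using frees_peels[OF r zs(4) peels.start] zs(3) by simp
  moreover have "?Z \<subseteq> V" using r zs(3) by (auto simp: realizes_def)
  ultimately have "2 * card ?Z + card (incident E ?Z) < 9 * card (f ` set ps)"
    using zs(1) by (intro no_gain) auto
  moreover have "card ?Z = length ?zs" "card (f ` set ps) = length ps"
    using inj zs(2) distinct_card[of ?zs] distinct_card[of ps] by (simp_all add: card_image)
  moreover have "(\<Sum>z\<in>?Z. fst (vtype E z) + snd (vtype E z)) = sum_list (map (\<lambda>z. fst (ts ! z) + snd (ts ! z)) ?zs)"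
  proof -
    have "(\<Sum>z\<in>?Z. fst (vtype E z) + snd (vtype E z)) = (\<Sum>z\<in>set ?zs. fst (vtype E (f z)) + snd (vtype E (f z)))"
      using inj by (simp add: sum.reindex)
    also have "\<dots> = (\<Sum>z\<in>set ?zs. fst (ts ! z) + snd (ts ! z))"
      using r zs(3) by (intro sum.cong) (auto simp: realizes_def)
    also have "\<dots> = sum_list (map (\<lambda>z. fst (ts ! z) + snd (ts ! z)) ?zs)"
      using zs(2) by (simp only: sum_list_distinct_conv_sum_set)
    finally show ?thesis .
  qed
  ultimately show False
    using le card_incident[of ?Z] card_Restr_le_pair_bound[OF r zs(2,3)] by simp
qed

lemma embeds_avoids:
  assumes "realizes V E f c" "embeds g m c"
  shows "\<not> avoids V E g"
proof -
  obtain ts as ns ts' as' ns' where c: "c = (ts, as, ns)" and g: "g = (ts', as', ns')"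
    by (cases c, cases g)
  note r = assms(1)[unfolded c] and e = assms(2)[unfolded c g embeds_def prod.case]
  have m: "distinct m" "\<forall>i<length m. m ! i < length ts" "map ((!) ts) m = ts'"
    using e by auto
  have "inj_on f {..<length ts}" using r by (simp add: realizes_def)
  then have "inj_on (\<lambda>i. f (m ! i)) {..<length ts'}"
  proof (intro inj_onI)
    fix i j assume i: "i \<in> {..<length ts'}" and j: "j \<in> {..<length ts'}" and eq: "f (m ! i) = f (m ! j)"
    have len: "length ts' = length m" using m(3) by auto
    have "m ! i = m ! j"
      using \<open>inj_on f {..<length ts}\<close> eq m(2) i j by (simp add: len inj_on_eq_iff)
    then show "i = j" using m(1) i j by (simp add: len nth_eq_iff_index_eq)
  qed
  moreover have "f (m ! i) \<in> V \<and> vtype E (f (m ! i)) = ts' ! i" if "i < length ts'" for i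
  proof -
    have "m ! i < length ts" "ts' ! i = ts ! (m ! i)" using that m by auto
    then show ?thesis using r by (simp add: realizes_def)
  qed
  moreover have "i < length ts' \<and> j < length ts' \<and> (f (m ! i), f (m ! j)) \<in> E" if "(i, j) \<in> set as'" for i j
  proof -
    have "i < length m" "j < length m" "(m ! i, m ! j) \<in> set as" using e that by auto
    then show ?thesis using m(3) realizesD(8)[OF r] by auto
  qed
  ultimately have "realizes V E (\<lambda>i. f (m ! i)) g"
    using e unfolding g realizes_def by auto
  then show ?thesis by (auto simp: avoids_def)
qed

text \<open>\<open>dn\<close> is the invariant: an old vertex no longer in \<open>us\<close> is a
  recorded neighbour or not a neighbour in the asked direction. At the end of the list the free stub
  forces one more neighbour, which therefore is new.\<close>

lemma extend_sound:
  assumes r: "realizes V E f (ts, as, ns)" and v: "v < length ts"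
    and stub: "if d then stub_in ts as v else stub_out ts as v"
    and T: "\<forall>x\<in>V. vtype E x \<in> set T"
    and us: "\<forall>u\<in>set us. u < length ts"
    and dn: "\<forall>u<length ts. u \<in> set us \<or> dir_arc d u v \<in> set as \<or> dir_arc d (f u) (f v) \<notin> E"
  shows "\<exists>c\<in>set (extend T d v ts as ns us). \<not> avoids V E c"
  using r us dn
proof (induction us arbitrary: ns)
  case Nil
  note r = Nil.prems(1)
  let ?N = "if d then E\<inverse> `` {f v} else E `` {f v}"
  let ?K = "f ` {u. dir_arc d u v \<in> set as}"
  have K: "?K = f ` set (if d then known_in as v else known_out as v)" by (auto simp: dir_arc_def)
  have "card ?K < card ?N"
  proof -
    have "card ?K \<le> length (if d then known_in as v else known_out as v)"
      unfolding K by (meson card_image_le card_length finite_set le_trans)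
    also have "\<dots> < card ?N"
      using stub realizesD(3,4)[OF r v] by (auto simp: stub_in_def stub_out_def split: if_splits)
    finally show ?thesis .
  qed
  moreover have "finite ?K" unfolding K by simp
  ultimately have "\<not> ?N \<subseteq> ?K" by (meson card_mono not_le)
  then obtain w where w: "w \<in> ?N" "w \<notin> ?K" by blast
  have wE: "dir_arc d w (f v) \<in> E" using w(1) by (auto simp: dir_arc_def split: if_splits)
  then have wV: "w \<in> V" using arcs_V by (auto simp: dir_arc_def split: if_splits)
  have new: "w \<notin> f ` {..<length ts}" using Nil.prems(3) wE w(2) by auto
  let ?f = "f(length ts := w)"
  let ?c = "(ts @ [vtype E w], dir_arc d (length ts) v # as, ns)"
  have fresh: "dir_arc d (length ts) v \<notin> set as"
    using realizesD(6,7)[OF r] by (auto simp: dir_arc_def split: if_splits)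
  have "realizes V E ?f ?c"
    unfolding realizes_def prod.case
  proof (intro conjI)
    show "inj_on ?f {..<length (ts @ [vtype E w])}"
      using r new by (auto simp: realizes_def lessThan_Suc inj_on_def)
    show "\<forall>i<length (ts @ [vtype E w]). ?f i \<in> V \<and> vtype E (?f i) = (ts @ [vtype E w]) ! i"
      using r wV by (auto simp: realizes_def nth_append less_Suc_eq)
    show "distinct (dir_arc d (length ts) v # as)"
      using r fresh by (simp add: realizes_def)
    show "\<forall>(i, j)\<in>set (dir_arc d (length ts) v # as). i < length (ts @ [vtype E w]) \<and>
        j < length (ts @ [vtype E w]) \<and> (?f i, ?f j) \<in> E"
    proof (intro ballI, clarify)
      fix i j assume "(i, j) \<in> set (dir_arc d (length ts) v # as)"
      then consider "(i, j) = dir_arc d (length ts) v" | "(i, j) \<in> set as" by auto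
      then show "i < length (ts @ [vtype E w]) \<and> j < length (ts @ [vtype E w]) \<and> (?f i, ?f j) \<in> E"
      proof cases
        case 1
        then show ?thesis using v wE by (cases d) (auto simp: dir_arc_def)
      next
        case 2
        then show ?thesis using realizesD(6,7,8)[OF r 2] by simp
      qed
    qed
    show "\<forall>(i, j)\<in>set ns. i < length (ts @ [vtype E w]) \<and>
        j < length (ts @ [vtype E w]) \<and> (?f i, ?f j) \<notin> E"
    proof (intro ballI, clarify)
      fix i j assume "(i, j) \<in> set ns"
      then have "i < length ts \<and> j < length ts \<and> (f i, f j) \<notin> E" using r by (auto simp: realizes_def)
      then show "i < length (ts @ [vtype E w]) \<and> j < length (ts @ [vtype E w]) \<and> (?f i, ?f j) \<notin> E"
        by simp
    qed
  qed
  moreover have "?c \<in> set (extend T d v ts as ns [])" using T wV by auto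
  ultimately show ?case by (auto simp: avoids_def)
next
  case (Cons u us)
  note r = Cons.prems(1)
  have u: "u < length ts" using Cons.prems(2) by simp
  let ?m = "if d then may_arc ts as ns u v else may_arc ts as ns v u"
  have lt: "\<And>i j. (i, j) \<in> set as \<Longrightarrow> i < length ts \<and> j < length ts"
    using r by (auto simp: realizes_def)
  show ?case
  proof (cases "dir_arc d (f u) (f v) \<in> E")
    case True
    show ?thesis
    proof (cases ?m)
      case m: True
      have "realizes V E f (ts, dir_arc d u v # as, ns)"
        using r u v True m by (auto simp: realizes_def dir_arc_def may_arc_def)
      with m show ?thesis by (auto simp: avoids_def)
    next
      case False
      \<comment> \<open>A true arc that fails the test is a recorded one, so it does not use the
        stub and the search goes on.\<close>
      then have "dir_arc d u v \<in> set as"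
        using True may_arc_complete[OF r, of u v] may_arc_complete[OF r, of v u] u v
        by (auto simp: dir_arc_def split: if_splits)
      then have "\<exists>c\<in>set (extend T d v ts as ns us). \<not> avoids V E c"
        using Cons.prems by (intro Cons.IH) auto
      then show ?thesis using False by auto
    qed
  next
    case False
    have "realizes V E f (ts, as, dir_arc d u v # ns)"
      using r u v False by (auto simp: realizes_def dir_arc_def split: if_splits)
    then have "\<exists>c\<in>set (extend T d v ts as (dir_arc d u v # ns) us). \<not> avoids V E c"
      using Cons.prems False by (intro Cons.IH) auto
    moreover have "\<exists>c\<in>set (extend T d v ts as ns us). \<not> avoids V E c"
      using Cons.prems False r by (intro Cons.IH) auto
    ultimately show ?thesis by auto
  qed
qed

lemma refutes_sound:
  assumes "refutes T NG tks cs" and T: "\<forall>x\<in>V. vtype E x \<in> set T"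
    and NG: "\<forall>g\<in>set NG. avoids V E g"
  shows "\<forall>c\<in>set cs. avoids V E c"
  using assms
proof (induction T NG tks cs rule: refutes.induct)
  case (3 T NG ps fs tks c cs)
  then have p: "pays ps fs c" and IH: "\<forall>c\<in>set (dropWhile (pays ps fs) cs). avoids V E c"
    by (auto split: if_splits)
  have "avoids V E c'" if "pays ps fs c'" for c' using that not_pays unfolding avoids_def by blast
  moreover have "\<forall>c'\<in>set (takeWhile (pays ps fs) cs). pays ps fs c'" by (auto dest: set_takeWhileD)
  moreover have "set cs = set (takeWhile (pays ps fs) cs) \<union> set (dropWhile (pays ps fs) cs)"
    by (metis set_append takeWhile_dropWhile_id)
  ultimately show ?case using p IH by auto
next
  case (4 T NG g m tks c cs)
  then have "g < length NG" "embeds (NG ! g) m c" "\<forall>c\<in>set cs. avoids V E c"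
    by (auto split: if_splits)
  then show ?case using embeds_avoids 4(4) by (metis avoids_def nth_mem set_ConsD)
next
  case (5 T NG d v tks c cs)
  obtain ts as ns where c: "c = (ts, as, ns)" by (cases c)
  let ?ex = "extend T d v ts as ns [0..<length ts]"
  have v: "v < length ts" "if d then stub_in ts as v else stub_out ts as v"
    and "refutes T NG tks (?ex @ cs)"
    using 5(2) by (auto simp: c split: if_splits)
  then have all: "\<forall>c\<in>set (?ex @ cs). avoids V E c"
    using 5(1)[OF c[symmetric] refl] 5(3,4) by blast
  have "avoids V E c"
  proof (rule ccontr)
    assume "\<not> avoids V E c"
    then obtain f where "realizes V E f (ts, as, ns)" by (auto simp: avoids_def c)
    from extend_sound[OF this v 5(3)] have "\<exists>c\<in>set ?ex. \<not> avoids V E c" by simp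
    then show False using all by auto
  qed
  then show ?case using all by auto
qed auto

text \<open>A source or a sink would be a gain with \<open>P = {}\<close>. For
  \<open>P = Z = {v}\<close> the gain condition is 9 <= 2 + degree, whence the bound 6.\<close>

lemma vtype_low:
  assumes "v \<in> V"
  shows "1 \<le> fst (vtype E v)" "1 \<le> snd (vtype E v)" "fst (vtype E v) + snd (vtype E v) \<le> 6"
proof -
  have ge: "\<not> peels E {} {v}" using no_gain[of "{}" "{v}"] assms by auto
  have "E\<inverse> `` {v} \<noteq> {}" "E `` {v} \<noteq> {}"
    using ge peels.peel[OF peels.start, of E v "{}"] by auto
  then show "1 \<le> fst (vtype E v)" "1 \<le> snd (vtype E v)"
    using finite_nbrs by (simp_all add: vtype_def Suc_le_eq card_gt_0_iff)
  have "2 + card (incident E {v}) < 9"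
    using no_gain[OF peels.start, of "{v}"] assms by simp
  moreover have "Restr E {v} = {}" using irrefl_E by auto
  ultimately show "fst (vtype E v) + snd (vtype E v) \<le> 6"
    using card_incident[of "{v}"] by simp
qed

end

text \<open>The certificate is applied to the digraph and to its converse, so \<open>T\<close> and
  \<open>NG\<close> are assumed for all irreducible digraphs on the given vertex type.\<close>

lemma irreducible_types_subset:
  fixes V :: "'a set" and E :: "'a rel"
  assumes ref: "refutes T NG tks (map (\<lambda>t. ([t], [], [])) bad)"
    and irr: "irreducible_digraph V E" and x: "x \<in> V"
    and T: "\<And>V E x. irreducible_digraph V E \<Longrightarrow> x \<in> (V :: 'a set) \<Longrightarrow> vtype E x \<in> set T"
    and NG: "\<And>V E. irreducible_digraph V E \<Longrightarrow> \<forall>g\<in>set NG. avoids (V :: 'a set) E g"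
  shows "vtype E x \<in> set T - set bad - prod.swap ` set bad"
proof -
  have no: "vtype E x \<notin> set bad" if irr: "irreducible_digraph V E" and x: "x \<in> V" for V :: "'a set" and E x
  proof
    assume "vtype E x \<in> set bad"
    then have "avoids V E ([vtype E x], [], [])"
      using irreducible_digraph.refutes_sound[OF irr ref] T[OF irr] NG[OF irr] by auto
    moreover have "realizes V E (\<lambda>_. x) ([vtype E x], [], [])"
      using x by (auto simp: realizes_def inj_on_def)
    ultimately show False by (auto simp: avoids_def)
  qed
  have "prod.swap (vtype E x) \<notin> set bad"
    using no[OF irreducible_converse[OF irr] x] by (simp add: vtype_converse)
  then show ?thesis
    using no[OF irr x] T[OF irr x] by (auto simp: prod.swap_def)
qed

lemma irreducible_avoids:
  fixes V :: "'a set" and E :: "'a rel"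
  assumes ref: "refutes T NG tks [c]"
    and irr: "irreducible_digraph V E"
    and T: "\<And>V E x. irreducible_digraph V E \<Longrightarrow> x \<in> (V :: 'a set) \<Longrightarrow> vtype E x \<in> set T"
    and NG: "\<And>V E. irreducible_digraph V E \<Longrightarrow> \<forall>g\<in>set NG. avoids (V :: 'a set) E g"
  shows "avoids V E c \<and> avoids V E (flip c)"
proof -
  have no: "avoids V E c" if "irreducible_digraph V E" for V :: "'a set" and E
    using irreducible_digraph.refutes_sound[OF that ref] T[OF that] NG[OF that] by auto
  show ?thesis
    using no[OF irr] avoids_converse[OF no[OF irreducible_converse[OF irr]]] by simp
qed

section \<open>Vertex types in irreducible digraphs\<close>

text \<open>The certificates below and the list \<open>forbidden\<close> were found by computer search.\<close>

lemma types_le_6: "irreducible_digraph V E \<Longrightarrow> x \<in> V \<Longrightarrow> vtype E x \<in> set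
   [(1, 1), (1, 2), (1, 3), (1, 4), (1, 5), (2, 1), (2, 2), (2, 3), (2, 4), (3, 1), (3, 2), (3, 3), (4, 1), (4, 2), (5, 1)]"
proof -
  assume "irreducible_digraph V E" "x \<in> V"
  then have "1 \<le> fst (vtype E x)" "1 \<le> snd (vtype E x)" "fst (vtype E x) + snd (vtype E x) \<le> 6"
    by (rule irreducible_digraph.vtype_low)+
  moreover obtain i j where ij: "vtype E x = (i, j)" by (cases "vtype E x")
  ultimately have le: "1 \<le> i" "1 \<le> j" "i + j \<le> 6" by simp_all
  then have "i = 1 \<or> i = 2 \<or> i = 3 \<or> i = 4 \<or> i = 5" "j = 1 \<or> j = 2 \<or> j = 3 \<or> j = 4 \<or> j = 5"
    by arith+
  with le show ?thesis unfolding ij by (elim disjE) simp_all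
qed

text \<open>Deleting the only in-neighbour \<open>u\<close> of \<open>v\<close> makes
  \<open>v\<close> a source. With one arc inside \<open>Z\<close>, this pays when the degrees of
  \<open>u\<close> and \<open>v\<close> add up to at least 6, and here they are at least 2 and
  4.\<close>

lemma types_low5:
  assumes "irreducible_digraph V E" "x \<in> V"
  shows "vtype E x \<in> set [(1, 1), (1, 2), (2, 1), (2, 2), (2, 3), (2, 4), (3, 2), (3, 3), (4, 2)]"
proof -
  have "refutes [(1, 1), (1, 2), (1, 3), (1, 4), (1, 5), (2, 1), (2, 2), (2, 3), (2, 4), (3, 1), (3, 2), (3, 3), (4, 1), (4, 2), (5, 1)] [] [
     Ask True 0, Pay [0] [1], Pay [1] [0], Ask True 0, Pay [0] [1], Pay [1] [0], Ask True 0, Pay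
     [0] [1], Pay [1] [0]]
    (map (\<lambda>t. ([t], [], [])) [(1, 5), (1, 4), (1, 3)])"
    by code_simp
  then have "vtype E x \<in> set [(1, 1), (1, 2), (1, 3), (1, 4), (1, 5), (2, 1), (2, 2), (2, 3), (2, 4), (3, 1), (3, 2), (3, 3), (4, 1), (4, 2), (5, 1)] - set [(1, 5), (1, 4), (1, 3)] - prod.swap ` set [(1, 5), (1, 4), (1, 3)]"
    using assms by (rule irreducible_types_subset) (erule (1) types_le_6, simp)
  then show ?thesis by auto
qed

text \<open>Degree 3 pays with an in-neighbour of degree at least 3. Otherwise the in-neighbour has
  type (1, 1), and one further step back gives a path of three vertices for which one deletion
  suffices.\<close>

lemma types_low3:
  assumes "irreducible_digraph V E" "x \<in> V"
  shows "vtype E x \<in> set [(1, 1), (2, 2), (2, 3), (2, 4), (3, 2), (3, 3), (4, 2)]"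
proof -
  have "refutes [(1, 1), (1, 2), (2, 1), (2, 2), (2, 3), (2, 4), (3, 2), (3, 3), (4, 2)] [] [
     Ask True 0, Ask True 1, Pay [0] [1,2], Pay [2] [1,0], Pay [1] [0]]
    (map (\<lambda>t. ([t], [], [])) [(1, 2)])"
    by code_simp
  then have "vtype E x \<in> set [(1, 1), (1, 2), (2, 1), (2, 2), (2, 3), (2, 4), (3, 2), (3, 3), (4, 2)] - set [(1, 2)] - prod.swap ` set [(1, 2)]"
    using assms by (rule irreducible_types_subset) (erule (1) types_low5, simp)
  then show ?thesis by auto
qed

text \<open>A neighbour of degree at least 4 pays as before. Otherwise three vertices of type (1, 1)
  form a path, and deleting the middle one pays with equality even if they span a triangle: 9 + 3 =
  6 + 6.\<close>

lemma types_low2: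
  assumes "irreducible_digraph V E" "x \<in> V"
  shows "vtype E x \<in> set [(2, 2), (2, 3), (2, 4), (3, 2), (3, 3), (4, 2)]"
proof -
  have "refutes [(1, 1), (2, 2), (2, 3), (2, 4), (3, 2), (3, 3), (4, 2)] [] [
     Ask True 0, Ask False 0, Pay [0] [1,2], Pay [2] [0], Pay [1] [0]]
    (map (\<lambda>t. ([t], [], [])) [(1, 1)])"
    by code_simp
  then have "vtype E x \<in> set [(1, 1), (2, 2), (2, 3), (2, 4), (3, 2), (3, 3), (4, 2)] - set [(1, 1)] - prod.swap ` set [(1, 1)]"
    using assms by (rule irreducible_types_subset) (erule (1) types_low3, simp)
  then show ?thesis by auto
qed

text \<open>Deleting both in-neighbours of a vertex of type (2, 4) pays once their degrees add up to
  9: 18 + 3 <= 6 + 6 + 9. The longest branch has two in-neighbours of type (2, 2).\<close>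

lemma types_4_to_6:
  assumes "irreducible_digraph V E" "x \<in> V"
  shows "vtype E x \<in> set [(2, 2), (2, 3), (3, 2), (3, 3)]"
proof -
  have "refutes [(2, 2), (2, 3), (2, 4), (3, 2), (3, 3), (4, 2)] [] [
     Ask True 0, Ask True 0, Ask False 1, Ask True 2, Pay [1,3] [2,0], Ask False 0, Pay [1,2]
     [0,3], Pay [0,3] [1], Pay [1,2] [0], Ask True 0, Pay [1,2] [0], Ask True 0, Pay [1,2] [0],
     Ask True 0, Pay [1,2] [0], Ask True 0, Pay [1,2] [0], Ask True 0, Pay [1,2] [0]]
    (map (\<lambda>t. ([t], [], [])) [(2, 4)])"
    by code_simp
  then have "vtype E x \<in> set [(2, 2), (2, 3), (2, 4), (3, 2), (3, 3), (4, 2)] - set [(2, 4)] - prod.swap ` set [(2, 4)]"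
    using assms by (rule irreducible_types_subset) (erule (1) types_low2, simp)
  then show ?thesis by auto
qed

text \<open>Every entry has a vertex of degree 5; the list prepares the exclusion of these types. A
  certificate may embed only entries proved before it. Reversals stand side by side, except for
  entry 2, which is isomorphic to its own reversal, and the last entry.\<close>

definition forbidden :: "config list" where
  "forbidden = [
     ([(3, 3), (2, 3)], [(0, 1)], []),
     ([(3, 3), (3, 2)], [(1, 0)], []),
     ([(3, 2), (2, 3)], [(0, 1)], []),
     ([(2, 3), (2, 3)], [(0, 1)], []),
     ([(3, 2), (3, 2)], [(1, 0)], []),
     ([(2, 3), (2, 2), (2, 2)], [(1, 0), (2, 0), (1, 2)], []),
     ([(3, 2), (2, 2), (2, 2)], [(0, 1), (0, 2), (2, 1)], []),
     ([(2, 2), (2, 3), (3, 2)], [(0, 1), (0, 2), (1, 2)], []),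
     ([(2, 2), (3, 2), (2, 3)], [(1, 0), (2, 0), (2, 1)], []),
     ([(2, 3), (2, 2), (2, 2), (2, 2), (2, 2)], [(1, 0), (2, 0), (1, 3), (2, 4)], [])]"

text \<open>Deleting both in-neighbours of the vertex of type (2, 3) makes it a source. One of them
  has degree 6, the other at least 4, and 18 + 3 <= 6 + 5 + 6 + 4.\<close>

lemma forbidden_2:
  assumes "irreducible_digraph V E"
  shows "\<forall>g\<in>set (take 2 forbidden). avoids V E g"
proof -
  have "refutes [(2, 2), (2, 3), (3, 2), (3, 3)] [] [
     Ask True 1, Pay [0,2] [1]]
    [forbidden ! 0]"
    by code_simp
  then have "avoids V E (forbidden ! 0) \<and> avoids V E (flip (forbidden ! 0))"
    using assms by (rule irreducible_avoids) (erule (1) types_4_to_6, simp)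
  then show ?thesis by (simp add: forbidden_def)
qed

lemma forbidden_3:
  assumes "irreducible_digraph V E"
  shows "\<forall>g\<in>set (take 3 forbidden). avoids V E g"
proof -
  have "refutes [(2, 2), (2, 3), (3, 2), (3, 3)] (take 2 forbidden) [
     Ask False 0, Ask True 1, Ask True 2, Pay [0,3] [2,1], Ask True 0, Pay [1,2] [0,3], Pay [0,3]
     [1], Pay [1,2] [0]]
    [forbidden ! 2]"
    by code_simp
  then have "avoids V E (forbidden ! 2) \<and> avoids V E (flip (forbidden ! 2))"
    using assms by (rule irreducible_avoids) (erule (1) types_4_to_6, erule forbidden_2)
  then show ?thesis using forbidden_2[OF assms] by (simp add: forbidden_def)
qed

lemma forbidden_5:
  assumes "irreducible_digraph V E"
  shows "\<forall>g\<in>set (take 5 forbidden). avoids V E g"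
proof -
  have "refutes [(2, 2), (2, 3), (3, 2), (3, 3)] (take 3 forbidden) [
     Ask True 1, Ask True 0, Ask True 0, Pay [2,3] [0,1], Ask False 0, Ask True 2, Pay [0,2]
     [1,3], Pay [0,4] [2,1], Pay [0,2] [1], Ask False 0, Ask True 2, Pay [0,3] [2,1], Pay [0,4]
     [2,1], Pay [0,2] [1], Emb 2 [3,0], Emb 0 [3,0], Pay [0,2] [1]]
    [forbidden ! 3]"
    by code_simp
  then have "avoids V E (forbidden ! 3) \<and> avoids V E (flip (forbidden ! 3))"
    using assms by (rule irreducible_avoids) (erule (1) types_4_to_6, erule forbidden_3)
  then show ?thesis using forbidden_3[OF assms] by (simp add: forbidden_def)
qed

lemma forbidden_7:
  assumes "irreducible_digraph V E"
  shows "\<forall>g\<in>set (take 7 forbidden). avoids V E g"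
proof -
  have "refutes [(2, 2), (2, 3), (3, 2), (3, 3)] (take 5 forbidden) [
     Ask True 2, Pay [1,3] [2,0]]
    [forbidden ! 5]"
    by code_simp
  then have "avoids V E (forbidden ! 5) \<and> avoids V E (flip (forbidden ! 5))"
    using assms by (rule irreducible_avoids) (erule (1) types_4_to_6, erule forbidden_5)
  then show ?thesis using forbidden_5[OF assms] by (simp add: forbidden_def)
qed

lemma forbidden_9:
  assumes "irreducible_digraph V E"
  shows "\<forall>g\<in>set (take 9 forbidden). avoids V E g"
proof -
  have "refutes [(2, 2), (2, 3), (3, 2), (3, 3)] (take 7 forbidden) [
     Ask True 1, Ask False 3, Emb 5 [1,3,0], Pay [0,3] [1,2], Ask False 2, Ask False 2, Emb 6
     [2,4,3], Ask False 1, Pay [0,3] [1,4], Pay [1,2] [0,5], Ask True 3, Emb 6 [2,3,5], Pay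
     [1,4,5] [3,2,0], Emb 3 [1,6], Ask True 3, Emb 6 [2,3,5], Pay [1,4,5] [3,2,0], Ask True 3,
     Emb 6 [2,3,5], Pay [2,6] [3], Pay [1,4,5] [3,2,0], Emb 2 [2,5], Emb 4 [5,2], Emb 1 [5,2],
     Ask True 2, Ask True 3, Pay [2,3] [4,5], Pay [0,3,5] [1,2,4], Ask False 2, Ask False 1, Pay
     [0,3] [1,4], Pay [1,2] [0,5], Pay [1,2] [0,6], Ask False 4, Ask False 4, Pay [1,2] [0,4],
     Pay [1,2,4] [0,3,5], Pay [1,2,4] [0,3,6], Pay [1,4] [3,7], Pay [1,2,8] [0,4,3], Ask True 4,
     Pay [0,3,5] [1,4,2], Pay [0,3,6] [1,4,2], Pay [0,3,7] [1,4,2], Pay [0,3,8] [1,4,2], Pay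
     [1,2,4] [0,3], Emb 3 [1,7], Ask False 4, Ask False 4, Pay [1,2] [0,4], Pay [1,2,4] [0,3,5],
     Pay [1,2,4] [0,3,6], Pay [1,2,7] [0,4,3], Pay [1,2,8] [0,4,3], Ask True 4, Pay [0,3,5]
     [1,4,2], Pay [0,3,6] [1,4,2], Pay [0,3,7] [1,4,2], Pay [0,3,8] [1,4,2], Pay [1,2,4] [0,3],
     Ask False 4, Ask False 4, Pay [1,2] [0,4], Pay [1,2,4] [0,3,5], Pay [1,2,4] [0,3,6], Pay
     [1,2,7] [0,4,3], Pay [1,2,8] [0,4,3], Ask True 4, Pay [0,3,5] [1,4,2], Pay [0,3,6] [1,4,2],
     Pay [0,3,7] [1,4,2], Pay [0,3,8] [1,4,2], Pay [1,2,4] [0,3], Emb 2 [2,6], Emb 4 [6,2], Emb 1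
     [6,2], Emb 2 [2,5], Emb 4 [5,2], Emb 1 [5,2], Ask False 1, Emb 3 [1,4], Pay [1,4] [3], Ask
     False 2, Ask False 1, Ask False 2, Emb 4 [4,2], Ask False 4, Ask False 4, Emb 4 [2,4], Pay
     [2,4] [5], Ask True 0, Pay [1,2,6] [0,4,3], Emb 6 [4,0,6], Pay [1,2,6] [0,4,3], Emb 4 [2,4],
     Pay [2,4] [5], Pay [1,4,5] [3,2,0], Emb 2 [2,5], Emb 4 [5,2], Emb 1 [5,2], Pay [1,4] [3],
     Emb 4 [4,2], Ask False 1, Ask False 1, Pay [1,2] [0,5], Ask True 2, Emb 4 [2,4], Pay [2,4,6]
     [1,3,0], Pay [1,2] [0,5], Pay [1,4] [3], Emb 2 [2,5], Emb 4 [5,2], Emb 1 [5,2], Pay [1,4]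
     [3], Emb 3 [3,1], Emb 2 [3,1], Emb 0 [3,1]]
    [forbidden ! 7]"
    by code_simp
  then have "avoids V E (forbidden ! 7) \<and> avoids V E (flip (forbidden ! 7))"
    using assms by (rule irreducible_avoids) (erule (1) types_4_to_6, erule forbidden_7)
  then show ?thesis using forbidden_7[OF assms] by (simp add: forbidden_def)
qed

lemma forbidden_10:
  assumes "irreducible_digraph V E"
  shows "\<forall>g\<in>set (take 10 forbidden). avoids V E g"
proof -
  have "refutes [(2, 2), (2, 3), (3, 2), (3, 3)] (take 9 forbidden) [
     Ask True 3, Pay [1,2] [0,3], Ask True 4, Pay [1,2] [0,4], Ask True 1, Pay [0,3] [1,4], Pay
     [1,4] [3,5], Pay [1,2,5] [0,4,3], Ask False 0, Emb 3 [0,5], Pay [1,2,5] [0,4,3], Ask True 1,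
     Pay [0,3] [1,4], Pay [1,4] [3,5], Pay [1,2,5] [0,4,3], Ask True 4, Pay [1,2] [0,4], Ask True
     2, Pay [0,4] [2,3], Pay [2,3] [4,5], Pay [1,2,5] [0,3,4], Ask True 2, Ask False 3, Pay [2,6]
     [3,4], Ask True 7, Pay [0,3] [1,7], Pay [0,3,4] [1,2,7], Pay [1,5] [3,7], Pay [0,4,7]
     [2,3,6], Pay [0,4,7] [2,3,1], Pay [0,3,4] [1,2,5], Pay [0,4] [2,6], Ask True 1, Ask False 4,
     Pay [1,5] [3,4], Pay [0,3,7] [1,4,2], Pay [0,3,8] [1,4,2], Pay [0,3] [1,5], Pay [0,3,4]
     [1,2], Ask True 1, Ask False 4, Pay [1,5] [3,4], Pay [0,3,7] [1,4,2], Pay [0,3,8] [1,4,2],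
     Pay [0,3] [1,5], Pay [0,3,4] [1,2], Ask True 1, Ask False 4, Pay [1,5] [3,4], Pay [0,3,7]
     [1,4,2], Pay [0,3,8] [1,4,2], Pay [0,3] [1,5], Pay [0,3,4] [1,2], Ask True 1, Ask False 4,
     Pay [1,5] [3,4], Pay [0,3,7] [1,4,2], Pay [0,3,8] [1,4,2], Pay [0,3] [1,5], Pay [0,3,4]
     [1,2], Ask True 1, Ask True 1, Pay [0,3] [1,5], Pay [2,6] [4,1], Ask True 6, Emb 3 [0,6],
     Pay [2,6,7] [4,1,0], Pay [0,3] [1,5], Ask True 1, Ask True 6, Emb 3 [0,6], Pay [2,6,7]
     [1,4,0], Ask True 6, Emb 3 [0,6], Pay [1,2,6] [0,4], Ask True 6, Emb 3 [0,6], Pay [1,2,6]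
     [0,4], Ask True 6, Emb 3 [0,6], Pay [1,2,6] [0,4], Ask True 6, Emb 3 [0,6], Pay [1,2,6]
     [0,4], Ask False 6, Pay [0,3,4] [1,2,6], Ask False 0, Pay [1,2,6] [0,4,5], Ask True 1, Ask
     True 1, Pay [0,3] [1,5], Pay [2,6,7] [4,1,0], Pay [0,3] [1,5], Pay [1,2,6] [0,4], Ask True
     1, Ask True 1, Pay [0,3] [1,5], Pay [4,7] [1,6], Pay [2,6,8] [4,1,0], Pay [0,3] [1,5], Pay
     [1,2,6] [0,4], Emb 2 [6,7], Emb 4 [7,6], Emb 1 [7,6], Ask True 1, Ask True 1, Pay [0,3]
     [1,5], Pay [2,6] [4,1], Pay [2,6,7] [4,1,0], Pay [0,3] [1,5], Ask True 1, Pay [2,6,7]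
     [1,4,0], Pay [1,2,6] [0,4], Ask True 5, Emb 3 [0,5], Ask True 2, Ask True 2, Pay [1,5]
     [3,2], Pay [1,5,6] [3,2,0], Ask True 1, Pay [1,5] [3,4], Pay [0,3,4] [1,2,5], Pay [1,2,5]
     [0,3], Ask True 2, Ask True 2, Pay [1,5] [3,2], Pay [1,2,5] [0,3,6], Pay [1,5,7] [3,2,0],
     Ask True 2, Pay [1,2,5] [0,3,6], Pay [1,5,7] [2,3,0], Pay [1,2,5] [0,3], Emb 3 [6,5], Emb 2
     [6,5], Emb 0 [6,5], Ask False 5, Emb 6 [5,3,1], Ask False 0, Pay [1,2] [0,4], Pay [0,3,4]
     [1,2,5], Ask True 2, Ask True 2, Pay [3,6] [2,5], Pay [1,5,7] [3,2,0], Pay [1,2,5] [0,3],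
     Emb 2 [5,6], Emb 4 [6,5], Emb 1 [6,5], Ask False 5, Ask True 1, Pay [4,5] [1,3], Pay [5,6]
     [1,3], Pay [1,5] [3]]
    [forbidden ! 9]"
    by code_simp
  then have "avoids V E (forbidden ! 9) \<and> avoids V E (flip (forbidden ! 9))"
    using assms by (rule irreducible_avoids) (erule (1) types_4_to_6, erule forbidden_9)
  then show ?thesis using forbidden_9[OF assms] by (simp add: forbidden_def)
qed

text \<open>Entries 0, 2 and 3 leave only (2, 2) as the type of an in-neighbour of a vertex of type
  (2, 3). Its two in-neighbours are then followed backwards until a gain or another entry
  appears.\<close>

lemma types_even:
  assumes "irreducible_digraph V E" "x \<in> V"
  shows "vtype E x \<in> set [(2, 2), (3, 3)]"
proof -
  have "refutes [(2, 2), (2, 3), (3, 2), (3, 3)] (take 10 forbidden) [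
     Ask True 0, Ask True 0, Ask False 1, Emb 5 [0,1,2], Ask False 2, Emb 5 [0,2,1], Pay [0,3]
     [1,2], Emb 9 [0,1,2,3,4], Ask False 0, Pay [1,2] [0,3], Emb 3 [0,4], Pay [0,4] [2], Ask
     False 0, Pay [1,2] [0,3], Emb 7 [2,0,4], Pay [0,4] [2], Ask False 0, Emb 3 [0,3], Pay [0,3]
     [1], Ask False 0, Emb 7 [1,0,3], Pay [0,3] [1], Emb 3 [2,0], Emb 2 [2,0], Emb 0 [2,0], Emb 3
     [1,0], Emb 2 [1,0], Emb 0 [1,0]]
    (map (\<lambda>t. ([t], [], [])) [(2, 3)])"
    by code_simp
  then have "vtype E x \<in> set [(2, 2), (2, 3), (3, 2), (3, 3)] - set [(2, 3)] - prod.swap ` set [(2, 3)]"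
    using assms by (rule irreducible_types_subset) (erule (1) types_4_to_6, erule forbidden_10)
  then show ?thesis by auto
qed

text \<open>It separates the two remaining types: no arc joins them in either direction.\<close>

lemma no_22_33:
  assumes "irreducible_digraph V E"
  shows "\<forall>g\<in>set [([(2, 2), (3, 3)], [(0, 1)], []), ([(2, 2), (3, 3)], [(1, 0)], [])]. avoids V E g"
proof -
  have "refutes [(2, 2), (3, 3)] [] [
     Ask False 0, Ask True 1, Ask False 2, Pay [1,3] [2,0], Ask False 3, Pay [1,2] [0,3], Ask
     True 1, Ask False 4, Pay [0,1] [4,3], Pay [1,2] [4], Pay [1,5] [4,3], Ask False 1, Ask False
     1, Ask False 5, Pay [0,1] [2,5], Pay [1,3] [4,5], Pay [0,3,5] [1,2,4], Pay [1,4] [3], Pay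
     [1,2] [0], Ask False 1, Ask False 1, Pay [0,3,5] [1,2,4], Pay [1,4] [3], Pay [1,2] [0], Pay
     [1,4] [3], Ask False 1, Ask True 1, Ask False 4, Pay [0,1] [2,4], Pay [1,3] [4], Ask False
     1, Pay [0,3,4] [1,2,5], Pay [1,5] [4], Ask True 0, Ask True 0, Pay [3,4] [0], Pay [0,3,4]
     [1,2], Pay [1,2] [0]]
    [([(2, 2), (3, 3)], [(0, 1)], [])]"
    by code_simp
  then have "avoids V E ([(2, 2), (3, 3)], [(0, 1)], []) \<and> avoids V E (flip ([(2, 2), (3, 3)], [(0, 1)], []))"
    using assms by (rule irreducible_avoids) (erule (1) types_even, simp)
  then show ?thesis by simp
qed

text \<open>By \<open>no_22_33\<close> every vertex reached from one of type (2, 2) has that type;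
  the \<open>Emb\<close> tokens reject new vertices of type (3, 3). All degrees being 4, a gain
  means that 9 times the size of \<open>P\<close>, plus the number of arcs inside \<open>Z\<close>,
  is at most 6 times the size of \<open>Z\<close>.\<close>

lemma types_33:
  assumes "irreducible_digraph V E" "x \<in> V"
  shows "vtype E x \<in> set [(3, 3)]"
proof -
  have "refutes [(2, 2), (3, 3)] [([(2, 2), (3, 3)], [(0, 1)], []),
    ([(2, 2), (3, 3)], [(1, 0)], [])] [
     Ask True 0, Ask True 0, Ask True 2, Ask True 2, Pay [1,3] [2,0], Ask True 2, Ask True 1, Ask
     True 1, Pay [0,1] [2,3], Pay [0,1] [2,4], Pay [2,5] [1,0], Pay [1,2] [0,3], Pay [1,2] [0,4],
     Ask True 1, Ask False 1, Ask True 3, Pay [1,2] [0,3], Pay [1,4] [3,2], Pay [0,3] [1,5], Pay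
     [0,3] [1,6], Ask True 4, Ask False 3, Pay [0,3] [4,2], Ask False 0, Pay [0,3] [1,5], Pay
     [1,4,7] [3,2,0], Ask False 2, Pay [0,5] [2,3], Pay [0,5,6] [1,2,3], Pay [1,2] [0,7], Pay
     [0,5,8] [2,3,1], Pay [1,4,7] [3,2,0], Ask False 0, Pay [1,4,7] [3,2,0], Ask False 2, Pay
     [0,5,6] [1,2,3], Pay [1,2] [0,7], Pay [0,6,8] [2,3,1], Pay [1,4,7] [3,2,0], Ask False 0, Pay
     [1,4,7] [3,2,0], Ask False 2, Pay [0,5,8] [2,3,1], Pay [0,6,8] [2,3,1], Pay [1,2] [0,7], Pay
     [0,8] [2,3], Pay [0,8,9] [2,3,1], Pay [0,3] [1,8], Pay [1,4,7] [3,2,0], Emb 0 [3,8], Ask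
     True 4, Pay [3,5] [4,2], Pay [3,6] [4,2], Pay [1,7] [3,4], Pay [3,8] [4,2], Pay [1,4,7]
     [3,2,0], Ask True 4, Pay [1,2] [0,4], Pay [1,3] [4,2], Pay [0,4] [1,5], Pay [0,4] [1,6], Ask
     True 3, Ask True 3, Pay [0,4] [3,2], Ask False 0, Pay [1,3] [5,0], Pay [1,3,7] [4,2,0], Pay
     [1,3,7] [0,4,5,2], Pay [1,3,7] [4,2,0], Ask False 0, Pay [1,3,7] [4,2,0], Pay [1,3,7]
     [0,4,6,2], Pay [1,3,7] [4,2,0], Pay [3,4] [2,7], Ask False 0, Pay [0,4,8] [1,3,2], Pay
     [1,3,7] [4,2,0], Emb 1 [3,8], Ask True 3, Pay [4,5] [3,2], Pay [4,6] [3,2], Pay [1,7] [4,3],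
     Pay [4,8] [3,2], Pay [1,3,7] [4,2,0], Ask True 7, Pay [1,2] [0,7], Ask False 4, Pay [2,7]
     [3,4], Pay [1,3,4] [2,7,0], Ask False 3, Pay [2,7] [4,3], Pay [1,3,4] [2,7,0], Pay [0,7]
     [1,5], Pay [0,7] [1,6], Ask True 8, Ask True 8, Pay [1,2] [0,8], Pay [1,2,3] [0,8,7], Pay
     [1,2,4] [0,8,7], Pay [1,8] [5,7], Pay [1,8] [6,7], Pay [1,2,9] [0,8,7], Ask True 8, Pay
     [0,8] [2,3], Pay [0,8] [2,4], Pay [1,8] [5,7], Pay [1,8] [6,7], Pay [1,2,9] [0,8,7], Pay
     [1,2,8] [0,3,7], Pay [1,2,8] [0,4,7], Pay [1,8] [5,7], Pay [1,8] [6,7], Ask True 8, Ask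
     False 2, Ask True 5, Pay [1,2] [0,5], Pay [0,5] [2,3], Pay [0,5] [2,4], Pay [2,6] [5,1], Pay
     [1,2,8] [0,7,5], Ask False 5, Pay [0,3,7] [1,5,2], Pay [0,4,7] [1,5,2], Pay [0,6,7] [1,5,2],
     Pay [0,7,10] [1,5,2], Pay [0,7,11] [1,5,2], Ask False 5, Pay [0,3,7] [1,5,2], Pay [0,4,7]
     [1,5,2], Pay [0,6,7] [1,5,2], Pay [0,7,9] [1,5,2], Pay [0,7,11] [1,5,2], Ask False 5, Pay
     [0,3,7] [1,5,2], Pay [0,4,7] [1,5,2], Pay [0,6,7] [1,5,2], Pay [0,7,9] [1,5,2], Pay [0,7,10]
     [1,5,2], Pay [0,7,12] [1,5,2], Emb 1 [5,11], Ask True 6, Pay [1,2] [0,6], Pay [0,6] [2,3],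
     Pay [0,6] [2,4], Pay [2,5] [6,1], Pay [1,2,8] [0,7,6], Ask False 6, Pay [0,3,7] [1,6,2], Pay
     [0,4,7] [1,6,2], Pay [0,5,7] [1,6,2], Pay [0,7,10] [1,6,2], Pay [0,7,11] [1,6,2], Ask False
     6, Pay [0,3,7] [1,6,2], Pay [0,4,7] [1,6,2], Pay [0,5,7] [1,6,2], Pay [0,7,9] [1,6,2], Pay
     [0,7,11] [1,6,2], Ask False 6, Pay [0,3,7] [1,6,2], Pay [0,4,7] [1,6,2], Pay [0,5,7]
     [1,6,2], Pay [0,7,9] [1,6,2], Pay [0,7,10] [1,6,2], Pay [0,7,12] [1,6,2], Emb 1 [6,11], Ask
     True 9, Pay [1,2] [0,9], Pay [0,9] [2,3], Pay [0,9] [2,4], Pay [0,7,9] [1,2,5], Pay [0,7,9]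
     [1,2,6], Pay [1,2,8] [0,7,9], Pay [2,10] [9,8], Ask True 11, Ask True 11, Pay [2,11] [3,9],
     Pay [2,11] [4,9], Pay [1,2,5] [0,11,9], Pay [1,2,6] [0,11,9], Pay [0,7] [1,11], Pay [1,2,8]
     [0,11,9], Pay [0,2,10] [11,9,8], Pay [1,2,12] [0,11,9], Pay [2,11] [3,9], Pay [2,11] [4,9],
     Pay [1,2,11] [0,5,9], Pay [1,2,11] [0,6,9], Ask True 11, Pay [1,8] [7,11], Pay [1,9,10]
     [8,7,11], Ask False 7, Pay [1,2,8,12] [0,7,11,9], Pay [1,2,10,11] [0,9,8,7], Emb 1 [11,12],
     Ask True 11, Pay [7,11] [8,10], Pay [1,2,8,12] [0,7,11,9], Pay [1,2,8,11] [0,7,9,10], Pay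
     [1,2,10,11] [0,9,8,7], Emb 1 [9,11], Ask True 10, Pay [1,2] [0,10], Pay [0,10] [2,3], Pay
     [0,10] [2,4], Pay [0,7,10] [1,2,5], Pay [0,7,10] [1,2,6], Pay [1,2,8] [0,7,10], Pay [2,9]
     [10,8], Ask True 11, Ask True 11, Pay [2,11] [3,10], Pay [2,11] [4,10], Pay [1,2,5]
     [0,11,10], Pay [1,2,6] [0,11,10], Pay [0,7] [1,11], Pay [1,2,8] [0,11,10], Pay [0,2,9]
     [11,10,8], Pay [1,2,12] [0,11,10], Pay [2,11] [3,10], Pay [2,11] [4,10], Pay [1,2,11]
     [0,5,10], Pay [1,2,11] [0,6,10], Ask True 11, Pay [1,8] [7,11], Pay [1,9,10] [8,7,11], Ask
     False 7, Pay [1,2,8,12] [0,7,11,10], Pay [1,2,9,11] [0,10,8,7], Emb 1 [11,12], Ask True 11,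
     Pay [7,11] [8,9], Pay [1,2,8,12] [0,7,11,10], Pay [1,2,8,11] [0,7,9,10], Pay [1,2,9,11]
     [0,10,8,7], Emb 1 [10,11], Ask True 11, Pay [1,2] [0,11], Pay [0,11] [2,3], Pay [0,11]
     [2,4], Pay [0,7,11] [1,2,5], Pay [0,7,11] [1,2,6], Pay [1,2,8] [0,7,11], Ask True 9, Ask
     True 9, Pay [2,9] [3,11], Pay [2,9] [4,11], Pay [1,2,5] [0,9,11], Pay [1,2,6] [0,9,11], Pay
     [0,7] [1,9], Pay [0,10] [9,8], Pay [1,2,12] [0,9,11], Pay [2,9] [3,11], Pay [2,9] [4,11],
     Pay [1,2,9] [0,5,11], Pay [1,2,9] [0,6,11], Ask False 7, Pay [3,4,9] [2,7,11], Pay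
     [1,2,9,10] [0,8,11,7], Pay [9,10] [7,8], Pay [1,2,9,10] [0,8,11,7], Ask True 10, Ask True
     10, Pay [2,10] [3,11], Pay [2,10] [4,11], Pay [1,2,5] [0,10,11], Pay [1,2,6] [0,10,11], Pay
     [0,7] [1,10], Pay [0,9] [10,8], Pay [1,2,12] [0,10,11], Pay [2,10] [3,11], Pay [2,10]
     [4,11], Pay [1,2,10] [0,5,11], Pay [1,2,10] [0,6,11], Ask False 7, Pay [3,4,10] [2,7,11],
     Pay [1,2,9,10] [0,8,11,7], Pay [9,10] [7,8], Pay [1,2,9,10] [0,8,11,7], Ask True 12, Ask
     True 12, Pay [2,12] [3,11], Pay [2,12] [4,11], Pay [1,2,5] [0,12,11], Pay [1,2,6] [0,12,11],
     Pay [0,7] [1,12], Pay [1,2,8] [0,12,11], Pay [1,2,9] [0,12,11], Pay [1,2,10] [0,12,11], Pay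
     [1,2,13] [0,12,11], Pay [2,12] [3,11], Pay [2,12] [4,11], Pay [1,2,12] [0,5,11], Pay
     [1,2,12] [0,6,11], Ask True 12, Pay [1,8] [7,12], Pay [1,2,8,9] [0,7,12,11], Pay [1,2,8,10]
     [0,7,12,11], Pay [1,2,8,13] [0,7,12,11], Ask True 12, Pay [7,12] [8,9], Pay [7,12] [8,10],
     Pay [1,2,8,13] [0,7,12,11], Pay [1,2,8,12] [0,7,11], Emb 1 [11,12], Emb 0 [2,11], Emb 1
     [8,10], Emb 1 [8,9], Emb 1 [7,8], Emb 0 [1,7], Emb 1 [1,6], Emb 1 [1,5], Emb 1 [2,4], Emb 1
     [2,3], Emb 1 [0,2], Emb 1 [0,1]]
    (map (\<lambda>t. ([t], [], [])) [(2, 2)])"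
    by code_simp
  then have "vtype E x \<in> set [(2, 2), (3, 3)] - set [(2, 2)] - prod.swap ` set [(2, 2)]"
    using assms by (rule irreducible_types_subset) (erule (1) types_even, erule no_22_33)
  then show ?thesis by auto
qed

section \<open>Gains in sparse digraphs\<close>

lemma gain_exists:
  fixes V :: "'a set"
  assumes V: "finite V" "V \<noteq> {}" and E: "E \<subseteq> V \<times> V" "asym E"
    and sparse: "card E < 3 * card V"
  obtains P Z where "peels E P Z" "P \<subseteq> Z" "Z \<subseteq> V" "Z \<noteq> {}"
    "9 * card P \<le> 2 * card Z + card (incident E Z)"
proof -
  have "\<not> irreducible_digraph V E"
  proof
    assume irr: "irreducible_digraph V E"
    have "vtype E v = (3, 3)" if "v \<in> V" for v
      using types_33[OF irr that] by simp
    \<comment> \<open>For \<open>Z = V\<close> both terms of \<open>card_incident\<close> are the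
      number of arcs, so there would be exactly 3 arcs per vertex.\<close>
    then have "(\<Sum>z\<in>V. fst (vtype E z) + snd (vtype E z)) = 6 * card V" by simp
    moreover have "incident E V = E" "Restr E V = E" using E(1) by (auto simp: incident_def)
    ultimately show False using irreducible_digraph.card_incident[OF irr V(1)] sparse by simp
  qed
  show thesis
  proof (rule ccontr)
    assume none: "\<not> thesis"
    have "irreducible_digraph V E"
    proof
      fix P Z assume "peels E P Z" "P \<subseteq> Z" "Z \<subseteq> V" "Z \<noteq> {}"
      with that none show "2 * card Z + card (incident E Z) < 9 * card P" by (meson not_le)
    qed (use V E in simp_all)
    with \<open>\<not> irreducible_digraph V E\<close> show False by simp
  qed
qed

text \<open>Sparsity is assumed for every nonempty subset because the induction continues in
  \<open>V - Z\<close>.\<close>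

theorem sparse_feedback:
  fixes V :: "'a set"
  assumes "finite V" and "E \<subseteq> V \<times> V" and "asym E"
    and "\<And>U. U \<subseteq> V \<Longrightarrow> U \<noteq> {} \<Longrightarrow> card (Restr E U) < 3 * card U"
  shows "\<exists>S\<subseteq>V. acyclic (Restr E (V - S)) \<and> 9 * card S \<le> 2 * card V + card E"
  using assms
proof (induction "card V" arbitrary: V E rule: less_induct)
  case less
  show ?case
  proof (cases "V = {}")
    case True
    then show ?thesis by (auto simp: acyclic_def)
  next
    case False
    have RV: "Restr E V = E" using less.prems(2) by auto
    have finE: "finite E" using less.prems(1,2) finite_subset by blast
    have "card E < 3 * card V" using less.prems(4)[of V] False by (simp add: RV)
    then obtain P Z where PZ: "peels E P Z" "P \<subseteq> Z" "Z \<subseteq> V" "Z \<noteq> {}"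
      and le: "9 * card P \<le> 2 * card Z + card (incident E Z)"
      by (rule gain_exists[OF less.prems(1) False less.prems(2,3)])
    let ?V = "V - Z" and ?E = "Restr E (V - Z)"
    have finZ: "finite Z" using PZ(3) less.prems(1) by (rule finite_subset)
    have cV: "card V = card ?V + card Z"
      using card_Diff_subset[OF finZ PZ(3)] card_mono[OF less.prems(1) PZ(3)] by simp
    \<comment> \<open>Arcs incident to \<open>Z\<close> and arcs of the rest share out
      \<open>E\<close>, so the budgets of the gain and of the induction hypothesis add up.\<close>
    have cE: "card E = card ?E + card (incident E Z)"
    proof -
      have "E = ?E \<union> incident E Z" using less.prems(2) by (auto simp: incident_def)
      moreover have "?E \<inter> incident E Z = {}" by (auto simp: incident_def)
      moreover have "finite ?E" "finite (incident E Z)"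
        using finE by (auto simp: incident_def intro: finite_subset[of _ E])
      ultimately show ?thesis by (metis card_Un_disjoint)
    qed
    have "card Z > 0" using finZ PZ(4) by (simp add: card_gt_0_iff)
    then have "\<exists>S\<subseteq>?V. acyclic (Restr ?E (?V - S)) \<and> 9 * card S \<le> 2 * card ?V + card ?E"
    proof (intro less.hyps)
      fix U assume U: "U \<subseteq> ?V" "U \<noteq> {}"
      then have "Restr ?E U = Restr E U" by blast
      then show "card (Restr ?E U) < 3 * card U" using less.prems(4)[of U] U by (simp add: subset_iff)
    next
      show "asym ?E" using less.prems(3) by (blast intro: asymI dest: asymD)
    next
      show "?E \<subseteq> ?V \<times> ?V" by blast
    qed (use cV less.prems(1) in simp_all)
    then obtain S where S: "S \<subseteq> ?V" "acyclic (Restr ?E (?V - S))" "9 * card S \<le> 2 * card ?V + card ?E"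
      by blast
    have "Restr ?E (?V - S) = Restr E ((V - S) - Z)" using S(1) by blast
    then have "acyclic (Restr E ((V - S) - P))" using S(2) by (intro peels_acyclic[OF PZ(1)]) simp
    moreover have "(V - S) - P = V - (P \<union> S)" by blast
    moreover have "card (P \<union> S) \<le> card P + card S" by (rule card_Un_le)
    ultimately show ?thesis
      using S(1,3) PZ(2,3) le cV cE by (intro exI[of _ "P \<union> S"] conjI) (blast, simp, linarith)
  qed
qed

section \<open>Sparsity of planar graphs\<close>

abbreviation connected_set :: "complex set \<Rightarrow> bool" where
  "connected_set \<equiv> topological_space_class.connected"

definition arc_between :: "complex set \<Rightarrow> complex \<Rightarrow> complex \<Rightarrow> bool" where
  "arc_between A p q \<longleftrightarrow> (\<exists>g. arc g \<and> path_image g = A \<and> pathstart g = p \<and> pathfinish g = q)"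

text \<open>The one-point case occurs when two arcs reach a vertex set at the same point, for
  instance when that set is a singleton.\<close>

definition weak_arc :: "complex set \<Rightarrow> complex \<Rightarrow> complex \<Rightarrow> bool" where
  "weak_arc A p q \<longleftrightarrow> arc_between A p q \<or> p = q \<and> A = {p}"

lemma arc_between_sym: "arc_between A p q \<Longrightarrow> arc_between A q p"
  unfolding arc_between_def
  by (metis arc_reversepath path_image_reversepath pathfinish_reversepath pathstart_reversepath)

lemma weak_arc_sym: "weak_arc A p q \<Longrightarrow> weak_arc A q p"
  by (auto simp: weak_arc_def dest: arc_between_sym)

lemma arc_between_ends: "arc_between A p q \<Longrightarrow> p \<in> A \<and> q \<in> A \<and> p \<noteq> q"
  unfolding arc_between_def by (metis arc_distinct_ends pathfinish_in_path_image pathstart_in_path_image)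

lemma weak_arc_ends: "weak_arc A p q \<Longrightarrow> p \<in> A \<and> q \<in> A"
  by (auto simp: weak_arc_def dest: arc_between_ends)

lemma arc_between_compact: "arc_between A p q \<Longrightarrow> compact A"
  by (auto simp: arc_between_def compact_arc_image)

lemma weak_arc_compact: "weak_arc A p q \<Longrightarrow> compact A"
  by (auto simp: weak_arc_def dest: arc_between_compact)

lemma weak_arc_path_connected: "weak_arc A p q \<Longrightarrow> path_connected A"
  by (auto simp: weak_arc_def arc_between_def intro: path_connected_path_image arc_imp_path)

lemma arc_between_connected_open:
  assumes "arc_between A p q"
  shows "connected_set (A - {p, q})" "A - {p, q} \<noteq> {}"
  using assms connected_simple_path_endless nonempty_simple_path_endless arc_imp_simple_path
  unfolding arc_between_def by metis+

lemma arc_between_join: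
  assumes "arc_between A p q" "arc_between B q r" "A \<inter> B \<subseteq> {q}"
  shows "arc_between (A \<union> B) p r"
proof -
  obtain f g where "arc f" "path_image f = A" "pathstart f = p" "pathfinish f = q"
    "arc g" "path_image g = B" "pathstart g = q" "pathfinish g = r"
    using assms(1,2) by (auto simp: arc_between_def)
  then show ?thesis
    using assms(3) unfolding arc_between_def
    by (intro exI[of _ "f +++ g"]) (auto simp: arc_join path_image_join)
qed

lemma arc_between_weak_join:
  assumes "arc_between A p q" "weak_arc B q r" "A \<inter> B \<subseteq> {q}"
  shows "arc_between (A \<union> B) p r"
proof (cases "arc_between B q r")
  case True
  then show ?thesis using assms arc_between_join by blast
next
  case False
  then have "q = r" "B = {q}" using assms(2) by (auto simp: weak_arc_def)
  then show ?thesis using assms(1) arc_between_ends[OF assms(1)] by (simp add: insert_absorb)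
qed

lemma weak_arc_join:
  assumes "weak_arc A p q" "arc_between B q r" "A \<inter> B \<subseteq> {q}"
  shows "arc_between (A \<union> B) p r"
  using arc_between_weak_join[OF arc_between_sym[OF assms(2)] weak_arc_sym[OF assms(1)]] assms(3)
  by (metis Int_commute Un_commute arc_between_sym)

lemma weak_arc_split:
  assumes "weak_arc A a b" "p \<in> A"
  obtains A1 A2 where "weak_arc A1 a p" "weak_arc A2 p b" "A1 \<union> A2 = A" "A1 \<inter> A2 = {p}"
proof (cases "p = a \<or> p = b")
  case True
  then show ?thesis
    using that[of "{a}" A] that[of A "{b}"] assms weak_arc_ends[OF assms(1)]
    by (auto simp: weak_arc_def)
next
  case False
  then obtain g where g: "arc g" "path_image g = A" "pathstart g = a" "pathfinish g = b"
    using assms by (auto simp: weak_arc_def arc_between_def)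
  then obtain t where t: "0 \<le> t" "t \<le> 1" "g t = p"
    using assms(2) by (auto simp: path_image_def)
  with False g have t01: "t \<noteq> 0" "t \<noteq> 1" by (auto simp: pathstart_def pathfinish_def)
  let ?A1 = "g ` {0..t}" and ?A2 = "g ` {t..1}"
  have arcs: "arc (subpath 0 t g)" "arc (subpath t 1 g)"
    using g(1) t t01 by (auto intro: arc_subpath_arc)
  show ?thesis
  proof (rule that[of ?A1 ?A2])
    show "weak_arc ?A1 a p"
      unfolding weak_arc_def arc_between_def
      using arcs t g by (intro disjI1 exI[of _ "subpath 0 t g"])
        (auto simp: path_image_subpath, simp add: pathstart_def subpath_def)
    show "weak_arc ?A2 p b"
      unfolding weak_arc_def arc_between_def
      using arcs t g by (intro disjI1 exI[of _ "subpath t 1 g"]) 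
        (auto simp: path_image_subpath, simp add: pathfinish_def subpath_def)
    have "{0..t} \<union> {t..1} = {0..1::real}" using t by auto
    then show "?A1 \<union> ?A2 = A" using g(2) by (metis image_Un path_image_def)
    have "inj_on g {0..1}" using g(1) by (simp add: arc_def)
    then have "?A1 \<inter> ?A2 = g ` ({0..t} \<inter> {t..1})"
      by (rule inj_on_image_Int[symmetric]) (use t in auto)
    moreover have "{0..t} \<inter> {t..1} = {t}" using t by auto
    ultimately show "?A1 \<inter> ?A2 = {p}" using t(3) by simp
  qed
qed

lemma weak_arc_within:
  assumes "path_connected K" "a \<in> K" "b \<in> K"
  obtains A where "A \<subseteq> K" "weak_arc A a b"
proof (cases "a = b")
  case True
  then show ?thesis using that[of "{a}"] assms by (auto simp: weak_arc_def)
next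
  case False
  then obtain g where "arc g" "path_image g \<subseteq> K" "pathstart g = a" "pathfinish g = b"
    using assms path_connected_arcwise[of K] by blast
  then show ?thesis using that[of "path_image g"] by (auto simp: weak_arc_def arc_between_def)
qed

text \<open>\<open>F\<close> is the initial part of a path up to its first point in
  \<open>J\<close>. Connectedness of \<open>F - {y}\<close> will keep that part on one side of a
  closed curve \<open>J\<close>.\<close>

lemma path_first_hit:
  fixes K :: "complex set"
  assumes "path_connected K" "s \<in> K" "closed J" "J \<inter> K \<noteq> {}"
  obtains F y where "path_connected F" "F \<subseteq> K" "s \<in> F" "F \<inter> J = {y}" "connected_set (F - {y})"
    "s \<in> J \<Longrightarrow> F = {s}"
proof (cases "s \<in> J")
  case True
  then show ?thesis using that[of "{s}" s] assms(2) by auto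
next
  case False
  obtain z where z: "z \<in> J" "z \<in> K" using assms(4) by blast
  obtain h where h: "path h" "path_image h \<subseteq> K" "pathstart h = s" "pathfinish h = z"
    using assms(1,2) z(2) unfolding path_connected_def by blast
  have int: "interior (- J) = - J" using assms(3) by (simp add: interior_open open_Compl)
  have "pathstart h \<in> closure (- J)" "pathfinish h \<notin> - J"
    using h z False closure_subset[of "- J"] by auto
  then obtain u where u: "0 \<le> u" "u \<le> 1" "\<And>x. 0 \<le> x \<and> x < u \<Longrightarrow> h x \<in> - J" "h u \<notin> - J"
    using subpath_to_frontier_explicit[OF h(1), of "- J"] unfolding int by metis
  have split: "{0..u} = insert u {0..<u}" using u(1) by auto
  have img: "path_image (subpath 0 u h) = h ` {0..u}" using u(1) by (simp add: path_image_subpath)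
  show ?thesis
  proof (rule that[of "h ` {0..u}" "h u"])
    show "path_connected (h ` {0..u})"
      using h(1) u path_connected_path_image[of "subpath 0 u h"] by (simp add: img path_subpath)
    show "h ` {0..u} \<subseteq> K" using h(2) u by (auto simp: path_image_def)
    show "s \<in> h ` {0..u}" using h(3) u by (auto simp: pathstart_def intro: image_eqI[of _ _ 0])
    show "h ` {0..u} \<inter> J = {h u}" using u by (auto simp: split)
    have "h x \<noteq> h u" if "x \<in> {0..<u}" for x using u(3)[of x] u(4) that by auto
    then have "h ` {0..u} - {h u} = h ` {0..<u}" unfolding split by auto
    moreover have "continuous_on {0..<u} h"
      using h(1) u(2) by (auto simp: path_def intro: continuous_on_subset)
    ultimately show "connected_set (h ` {0..u} - {h u})"
      by (simp add: connected_continuous_image)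
  qed (use False in simp)
qed

text \<open>Join \<open>s1\<close> to \<open>s2\<close> by an arc, approach it from
  \<open>s3\<close>, and split it at the first point that is hit.\<close>

lemma tripod:
  fixes K :: "complex set"
  assumes "path_connected K" "s1 \<in> K" "s2 \<in> K" "s3 \<in> K"
  obtains p A1 A2 A3 where "A1 \<union> A2 \<union> A3 \<subseteq> K" "weak_arc A1 p s1" "weak_arc A2 p s2" "weak_arc A3 p s3"
    "A1 \<inter> A2 = {p}" "A1 \<inter> A3 = {p}" "A2 \<inter> A3 = {p}"
proof -
  obtain A where A: "A \<subseteq> K" "weak_arc A s1 s2" using weak_arc_within assms by blast
  obtain F p where F: "path_connected F" "F \<subseteq> K" "s3 \<in> F" "F \<inter> A = {p}"
    using path_first_hit[OF assms(1,4), of A] A assms weak_arc_ends[OF A(2)]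
      compact_imp_closed[OF weak_arc_compact[OF A(2)]] by (metis IntI empty_iff)
  obtain B where B: "B \<subseteq> F" "weak_arc B p s3" using weak_arc_within[OF F(1)] F by (metis Int_iff insertI1)
  have "p \<in> A" using F(4) by blast
  then obtain A1 A2 where A12: "weak_arc A1 s1 p" "weak_arc A2 p s2" "A1 \<union> A2 = A" "A1 \<inter> A2 = {p}"
    using weak_arc_split[OF A(2)] by blast
  show ?thesis
  proof (rule that[of A1 A2 B p])
    show "A1 \<inter> B = {p}" "A2 \<inter> B = {p}"
      using A12 F(4) B weak_arc_ends by blast+
  qed (use A12 A B F in \<open>auto simp: weak_arc_sym\<close>)
qed

section \<open>Closed curves and the exclusion of K(3, 3)\<close>

lemma simple_closed_of_arcs:
  assumes "arc_between A p q" "arc_between B p q" "A \<inter> B = {p, q}"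
  obtains c where "simple_path c" "pathfinish c = pathstart c" "path_image c = A \<union> B"
proof -
  obtain f g where f: "arc f" "path_image f = A" "pathstart f = p" "pathfinish f = q"
    and g: "arc g" "path_image g = B" "pathstart g = q" "pathfinish g = p"
    using assms(1) arc_between_sym[OF assms(2)] by (auto simp: arc_between_def)
  show ?thesis
  proof (rule that[of "f +++ g"])
    show "simple_path (f +++ g)"
      using f g assms(3) by (intro simple_path_join_loop) auto
  qed (use f g in \<open>auto simp: path_image_join\<close>)
qed

text \<open>The sides are told apart by \<open>C\<close> and not by boundedness: \<open>O'\<close>
  is the side of \<open>C\<close>, and either side may be the bounded one.\<close>

lemma jordan_sides:
  assumes "arc_between A p q" "arc_between B p q" "A \<inter> B = {p, q}"
    and C: "connected_set C" "C \<noteq> {}" "C \<inter> (A \<union> B) = {}"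
  obtains I O' where "open I" "connected_set I" "I \<noteq> {}" "open O'" "connected_set O'" "C \<subseteq> O'"
    "I \<inter> O' = {}" "I \<union> O' = - (A \<union> B)" "frontier I = A \<union> B" "bounded I \<or> bounded O'"
proof -
  obtain c where c: "simple_path c" "pathfinish c = pathstart c" "path_image c = A \<union> B"
    using simple_closed_of_arcs[OF assms(1-3)] by blast
  obtain i o' where io: "i \<noteq> {}" "open i" "connected_set i" "o' \<noteq> {}" "open o'" "connected_set o'"
    "bounded i" "i \<inter> o' = {}" "i \<union> o' = - (A \<union> B)" "frontier i = A \<union> B" "frontier o' = A \<union> B"
    by (rule Jordan_curve[OF c(1,2), unfolded c(3)])
  have "C \<subseteq> i \<union> o'" using C(3) io by blast
  then have "C \<subseteq> i \<or> C \<subseteq> o'"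
    using connectedD[OF C(1) io(2,5)] io(8) by blast
  then show ?thesis
  proof
    assume "C \<subseteq> o'"
    then show ?thesis using that[of i o'] io by blast
  next
    assume "C \<subseteq> i"
    then show ?thesis using that[of o' i] io by (metis Int_commute Un_commute)
  qed
qed

lemma connected_subset_side:
  assumes "connected_set I" "I \<inter> J = {}" "open I'" "open O'" "I' \<inter> O' = {}" "I' \<union> O' = - J"
    and "I \<inter> I' \<noteq> {}"
  shows "I \<subseteq> I'"
proof -
  have "I \<subseteq> I' \<union> O'" using assms(2,6) by blast
  then show ?thesis using connectedD[OF assms(1,3,4)] assms(5,7) by blast
qed

text \<open>The complete bipartite graph \<open>K(3, 3)\<close> is not planar: its parts are \<open>p\<close>, \<open>q\<close>, \<open>b\<close> and the interiors
  of the three arcs. Each closed curve \<open>c j \<union> c k\<close> has a side \<open>I i\<close> that avoids the third arc;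
  Janiszewski's theorem shows that \<open>I 1 \<union> I 2\<close> together with the arcs does not separate \<open>b\<close> from \<open>I 3\<close>.\<close>

lemma theta_no_common_face:
  assumes c: "arc_between c1 p q" "arc_between c2 p q" "arc_between c3 p q"
    and int: "c1 \<inter> c2 = {p, q}" "c1 \<inter> c3 = {p, q}" "c2 \<inter> c3 = {p, q}"
    and b: "connected_component (- (c2 \<union> c3)) b x1" "x1 \<in> c1"
      "connected_component (- (c1 \<union> c3)) b x2" "x2 \<in> c2"
      "connected_component (- (c1 \<union> c2)) b x3" "x3 \<in> c3"
  shows False
proof -
  define d1 where "d1 = c1 - {p, q}"
  define d2 where "d2 = c2 - {p, q}"
  define d3 where "d3 = c3 - {p, q}"
  note d_def = d1_def d2_def d3_def
  have pq: "p \<in> c1" "q \<in> c1" "p \<in> c2" "q \<in> c2" "p \<in> c3" "q \<in> c3"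
    using c[THEN arc_between_ends] by auto
  have d: "connected_set d1" "d1 \<noteq> {}" "connected_set d2" "d2 \<noteq> {}" "connected_set d3" "d3 \<noteq> {}"
    using c[THEN arc_between_connected_open(1)] c[THEN arc_between_connected_open(2)] by (auto simp: d_def)
  have disj: "d1 \<inter> (c2 \<union> c3) = {}" "d2 \<inter> (c1 \<union> c3) = {}" "d3 \<inter> (c1 \<union> c2) = {}"
    using int by (auto simp: d_def)
  obtain I1 O1 where 1: "open I1" "connected_set I1" "I1 \<noteq> {}" "open O1" "connected_set O1" "d1 \<subseteq> O1"
    "I1 \<inter> O1 = {}" "I1 \<union> O1 = - (c2 \<union> c3)" "frontier I1 = c2 \<union> c3" "bounded I1 \<or> bounded O1"
    by (rule jordan_sides[OF c(2,3) int(3) d(1,2) disj(1)])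
  obtain I2 O2 where 2: "open I2" "connected_set I2" "I2 \<noteq> {}" "open O2" "connected_set O2" "d2 \<subseteq> O2"
    "I2 \<inter> O2 = {}" "I2 \<union> O2 = - (c1 \<union> c3)" "frontier I2 = c1 \<union> c3" "bounded I2 \<or> bounded O2"
    by (rule jordan_sides[OF c(1,3) int(2) d(3,4) disj(2)])
  obtain I3 O3 where 3: "open I3" "connected_set I3" "I3 \<noteq> {}" "open O3" "connected_set O3" "d3 \<subseteq> O3"
    "I3 \<inter> O3 = {}" "I3 \<union> O3 = - (c1 \<union> c2)" "frontier I3 = c1 \<union> c2" "bounded I3 \<or> bounded O3"
    by (rule jordan_sides[OF c(1,2) int(1) d(5,6) disj(3)])
  have cd: "c1 \<subseteq> d1 \<union> c2" "c1 \<subseteq> d1 \<union> c3" "c2 \<subseteq> d2 \<union> c1" "c2 \<subseteq> d2 \<union> c3" "c3 \<subseteq> d3 \<union> c1"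
    and sub: "d1 \<subseteq> c1" "d2 \<subseteq> c2" "d3 \<subseteq> c3"
    using pq by (auto simp: d_def)
  let ?T = "c1 \<union> c2 \<union> c3"
  have "I1 \<inter> (c2 \<union> c3) = {}" "I1 \<inter> d1 = {}" using 1(6-8) by blast+
  then have T1: "I1 \<inter> ?T = {}" using cd(1) by blast
  have "I2 \<inter> (c1 \<union> c3) = {}" "I2 \<inter> d2 = {}" using 2(6-8) by blast+
  then have T2: "I2 \<inter> ?T = {}" using cd(3) by blast
  have "I3 \<inter> (c1 \<union> c2) = {}" "I3 \<inter> d3 = {}" using 3(6-8) by blast+
  then have T3: "I3 \<inter> ?T = {}" using cd(5) by blast
  have off: "I1 \<inter> (c1 \<union> c3) = {}" "I2 \<inter> (c2 \<union> c3) = {}" "I1 \<inter> (c1 \<union> c2) = {}"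
    "I3 \<inter> (c2 \<union> c3) = {}" "I2 \<inter> (c1 \<union> c2) = {}" "I3 \<inter> (c1 \<union> c3) = {}"
    using T1 T2 T3 by blast+
  \<comment> \<open>Two of these sides that meet contain each other, and then their frontiers, which
    are different pairs of arcs, coincide.\<close>
  have I12: "I1 \<inter> I2 = {}"
  proof (rule ccontr)
    assume ne: "I1 \<inter> I2 \<noteq> {}"
    then have "I1 \<subseteq> I2" by (rule connected_subset_side[OF 1(2) off(1) 2(1,4,7,8)])
    moreover have "I2 \<subseteq> I1"
      using ne connected_subset_side[OF 2(2) off(2) 1(1,4,7,8)] by (simp add: Int_commute)
    ultimately have "c2 \<union> c3 = c1 \<union> c3" using 1(9) 2(9) by simp
    then show False using d(2) disj(1) sub(1) by blast
  qed
  have I13: "I1 \<inter> I3 = {}"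
  proof (rule ccontr)
    assume ne: "I1 \<inter> I3 \<noteq> {}"
    then have "I1 \<subseteq> I3" by (rule connected_subset_side[OF 1(2) off(3) 3(1,4,7,8)])
    moreover have "I3 \<subseteq> I1"
      using ne connected_subset_side[OF 3(2) off(4) 1(1,4,7,8)] by (simp add: Int_commute)
    ultimately have "c2 \<union> c3 = c1 \<union> c2" using 1(9) 3(9) by simp
    then show False using d(2) disj(1) sub(1) by blast
  qed
  have I23: "I2 \<inter> I3 = {}"
  proof (rule ccontr)
    assume ne: "I2 \<inter> I3 \<noteq> {}"
    then have "I2 \<subseteq> I3" by (rule connected_subset_side[OF 2(2) off(5) 3(1,4,7,8)])
    moreover have "I3 \<subseteq> I2"
      using ne connected_subset_side[OF 3(2) off(6) 2(1,4,7,8)] by (simp add: Int_commute)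
    ultimately have "c1 \<union> c3 = c1 \<union> c2" using 2(9) 3(9) by simp
    then show False using d(4) disj(2) sub(2) by blast
  qed
  \<comment> \<open>\<open>b\<close> is connected to a point of the third arc without meeting the
    curve, so it lies on the side of that arc.\<close>
  have side: "b \<in> O'"
    if cc: "connected_component (- J) b x" and x: "x \<in> C" "C - {p, q} \<subseteq> O'" "p \<in> J" "q \<in> J"
      and O': "open I" "open O'" "I \<inter> O' = {}" "I \<union> O' = - J" for J x C I O'
  proof -
    have "x \<notin> J" using connected_component_in[OF cc] by simp
    then have "x \<in> O'" using x by blast
    moreover obtain T where T: "connected_set T" "T \<subseteq> - J" "b \<in> T" "x \<in> T"
      using cc unfolding connected_component_def by blast
    ultimately show ?thesis using connectedD[OF T(1) O'(1,2)] O'(3,4) by blast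
  qed
  have "b \<in> O1"
    using side[OF b(1,2) _ _ _ 1(1,4,7,8)] 1(6) pq by (simp add: d1_def)
  have "b \<in> O2"
    using side[OF b(3,4) _ _ _ 2(1,4,7,8)] 2(6) pq by (simp add: d2_def)
  have "b \<in> O3"
    using side[OF b(5,6) _ _ _ 3(1,4,7,8)] 3(6) pq by (simp add: d3_def)
  obtain y where y: "y \<in> I3" using 3(3) by blast
  have "y \<in> O1" "y \<in> O2" using y I13 I23 off(4,6) 1(8) 2(8) by blast+
  let ?A = "I1 \<union> (c2 \<union> c3)" and ?B = "I2 \<union> (c1 \<union> c3)"
  have cA: "- ?A = O1" "- ?B = O2" using 1(7,8) 2(7,8) by blast+
  then have cl: "closed ?A" "closed ?B" using 1(4) 2(4) by (simp_all add: closed_def)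
  have "c1 \<inter> c2 \<subseteq> c3" using int(1) pq(5,6) by simp
  \<comment> \<open>The two closed sets meet exactly in the arc \<open>c3\<close>; Janiszewski's
    theorem asks for a connected intersection.\<close>
  then have AB: "?A \<inter> ?B = c3" using I12 off(1,2) by blast
  then have con: "connected_set (?A \<inter> ?B)"
    using weak_arc_path_connected[of c3 p q] c(3) by (simp add: weak_arc_def path_connected_imp_connected)
  have comp: "connected_component (- ?A) b y" "connected_component (- ?B) b y"
    unfolding cA connected_component_def
    using 1(5) 2(5) \<open>b \<in> O1\<close> \<open>b \<in> O2\<close> \<open>y \<in> O1\<close> \<open>y \<in> O2\<close> by blast+
  have bdd: "bounded (c1 \<union> c2 \<union> c3)"
    using c[THEN arc_between_compact] by (simp add: compact_imp_bounded)
  have "connected_component (- (?A \<union> ?B)) b y"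
  proof (cases "bounded I1")
    case True
    then have "compact ?A" using bdd cl by (auto simp: compact_eq_bounded_closed)
    then show ?thesis using Janiszewski[OF _ cl(2) con comp] by blast
  next
    \<comment> \<open>The theorem also wants one of the sets compact. If \<open>I1\<close> is
      unbounded, then \<open>O1\<close> is bounded and contains \<open>I2\<close>, so the sets
      exchange roles.\<close>
    case False
    then have "bounded O1" using 1(10) by blast
    moreover have "I2 \<subseteq> O1" using I12 off(2) 1(8) by blast
    ultimately have "compact ?B" using bdd cl bounded_subset by (auto simp: compact_eq_bounded_closed)
    then have "connected_component (- (?B \<union> ?A)) b y"
      using Janiszewski[OF _ cl(1) _ comp(2,1)] con by (simp add: Int_commute)
    then show ?thesis by (simp add: Un_commute)
  qed
  then obtain T where T: "connected_set T" "T \<subseteq> - (?A \<union> ?B)" "b \<in> T" "y \<in> T"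
    unfolding connected_component_def by blast
  have "T \<subseteq> I3 \<union> O3" using T(2) 3(8) by blast
  then show False
    using connectedD[OF T(1) 3(1,4)] 3(7) T(3,4) y \<open>b \<in> O3\<close> by blast
qed

section \<open>The exclusion of K(5) for connected sets joined by arcs\<close>

lemma Un3_Int_subset:
  assumes "A \<inter> D \<subseteq> S" "A \<inter> E \<subseteq> S" "A \<inter> F \<subseteq> S" "B \<inter> D \<subseteq> S" "B \<inter> E \<subseteq> S" "B \<inter> F \<subseteq> S"
    "C \<inter> D \<subseteq> S" "C \<inter> E \<subseteq> S" "C \<inter> F \<subseteq> S"
  shows "(A \<union> B \<union> C) \<inter> (D \<union> E \<union> F) \<subseteq> S"
  unfolding Int_Un_distrib Int_Un_distrib2 using assms by (intro Un_least)

text \<open>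
  A plane drawing of a complete graph whose vertices are drawn as disjoint path-connected sets \<open>K v\<close>;
  \<open>s u v\<close> is the end in \<open>K u\<close> of the arc that joins \<open>K u\<close> and \<open>K v\<close>.
\<close>

locale plane_model =
  fixes P :: "'v set" and K :: "'v \<Rightarrow> complex set"
    and g :: "'v \<Rightarrow> 'v \<Rightarrow> complex set" and s :: "'v \<Rightarrow> 'v \<Rightarrow> complex"
  assumes pc: "v \<in> P \<Longrightarrow> path_connected (K v)"
    and KK: "\<lbrakk>u \<in> P; v \<in> P; u \<noteq> v\<rbrakk> \<Longrightarrow> K u \<inter> K v = {}"
    and arc_g: "\<lbrakk>u \<in> P; v \<in> P; u \<noteq> v\<rbrakk> \<Longrightarrow> arc_between (g u v) (s u v) (s v u)"
    and g_sym: "g u v = g v u"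
    and gK: "\<lbrakk>u \<in> P; v \<in> P; u \<noteq> v\<rbrakk> \<Longrightarrow> g u v \<inter> K u = {s u v}"
    and gK0: "\<lbrakk>u \<in> P; v \<in> P; u \<noteq> v; w \<in> P; w \<noteq> u; w \<noteq> v\<rbrakk> \<Longrightarrow> g u v \<inter> K w = {}"
    and gg: "\<lbrakk>u \<in> P; v \<in> P; w \<in> P; u \<noteq> v; u \<noteq> w; v \<noteq> w\<rbrakk> \<Longrightarrow> g u v \<inter> g u w \<subseteq> K u"
    and gg0: "\<lbrakk>u \<in> P; v \<in> P; w \<in> P; z \<in> P; distinct [u, v, w, z]\<rbrakk> \<Longrightarrow> g u v \<inter> g w z = {}"
begin

lemma sK: "\<lbrakk>u \<in> P; v \<in> P; u \<noteq> v\<rbrakk> \<Longrightarrow> s u v \<in> K u"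
  using gK by blast

lemma sg: "\<lbrakk>u \<in> P; v \<in> P; u \<noteq> v\<rbrakk> \<Longrightarrow> s u v \<in> g u v"
  using gK by blast

lemma gK': "\<lbrakk>u \<in> P; v \<in> P; u \<noteq> v\<rbrakk> \<Longrightarrow> g u v \<inter> K v = {s v u}"
  using gK[of v u] g_sym[of u v] by simp

lemma ggs: "\<lbrakk>u \<in> P; v \<in> P; w \<in> P; u \<noteq> v; u \<noteq> w; v \<noteq> w\<rbrakk> \<Longrightarrow> g u v \<inter> g u w \<subseteq> {s u v} \<inter> {s u w}"
  using gg[of u v w] gK[of u v] gK[of u w] by blast

lemma closed_g: "\<lbrakk>u \<in> P; v \<in> P; u \<noteq> v\<rbrakk> \<Longrightarrow> closed (g u v)"
  using arc_g arc_between_compact compact_imp_closed by blast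

lemma path_connected_g: "\<lbrakk>u \<in> P; v \<in> P; u \<noteq> v\<rbrakk> \<Longrightarrow> path_connected (g u v)"
  using arc_g weak_arc_path_connected weak_arc_def by blast

text \<open>The curve runs around the triangle and crosses each vertex set along an arc, possibly a
  single point. It is cut at \<open>s a b\<close> and \<open>s c a\<close>: one half passes through
  \<open>K b\<close>, the other is \<open>g c a\<close> followed by the crossing of
  \<open>K a\<close>.\<close>

lemma closed_curve:
  assumes P: "a \<in> P" "b \<in> P" "c \<in> P" and ne: "a \<noteq> b" "a \<noteq> c" "b \<noteq> c"
  obtains A B Da Db Dc p q where
    "arc_between A p q" "arc_between B p q" "A \<inter> B = {p, q}"
    "A \<union> B = g a b \<union> g b c \<union> g c a \<union> Da \<union> Db \<union> Dc"
    "Da \<subseteq> K a" "Db \<subseteq> K b" "Dc \<subseteq> K c" "path_connected Da" "path_connected Db" "path_connected Dc"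
    "s a b \<in> Da" "s a c \<in> Da" "s b a \<in> Db" "s b c \<in> Db" "s c a \<in> Dc" "s c b \<in> Dc"
proof -
  obtain Da where Da: "Da \<subseteq> K a" "weak_arc Da (s a c) (s a b)"
    using weak_arc_within[of "K a" "s a c" "s a b"] pc[of a] sK[of a c] sK[of a b] P ne by blast
  obtain Db where Db: "Db \<subseteq> K b" "weak_arc Db (s b a) (s b c)"
    using weak_arc_within[of "K b" "s b a" "s b c"] pc[of b] sK[of b a] sK[of b c] P ne by blast
  obtain Dc where Dc: "Dc \<subseteq> K c" "weak_arc Dc (s c b) (s c a)"
    using weak_arc_within[of "K c" "s c b" "s c a"] pc[of c] sK[of c b] sK[of c a] P ne by blast
  note endD = Da(2)[THEN weak_arc_ends] Db(2)[THEN weak_arc_ends] Dc(2)[THEN weak_arc_ends]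
  have abD: "g a b \<inter> Da \<subseteq> {s a b}" "g a b \<inter> Db \<subseteq> {s b a}" "g a b \<inter> Dc = {}"
    using gK[of a b] gK'[of a b] gK0[of a b c] Da(1) Db(1) Dc(1) P ne by blast+
  have bcD: "g b c \<inter> Da = {}" "g b c \<inter> Db \<subseteq> {s b c}" "g b c \<inter> Dc \<subseteq> {s c b}"
    using gK[of b c] gK'[of b c] gK0[of b c a] Da(1) Db(1) Dc(1) P ne by blast+
  have caD: "g c a \<inter> Da \<subseteq> {s a c}" "g c a \<inter> Db = {}" "g c a \<inter> Dc \<subseteq> {s c a}"
    using gK[of c a] gK'[of c a] gK0[of c a b] Da(1) Db(1) Dc(1) P ne by blast+
  have DD: "Da \<inter> Db = {}" "Da \<inter> Dc = {}" "Db \<inter> Dc = {}"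
    using KK[of a b] KK[of a c] KK[of b c] Da(1) Db(1) Dc(1) P ne by blast+
  have GG: "g a b \<inter> g b c \<subseteq> {s b c}" "g a b \<inter> g c a \<subseteq> {s a b}" "g b c \<inter> g c a \<subseteq> {s c a}"
    using ggs[of b a c] ggs[of a b c] ggs[of c a b] g_sym[of a b] g_sym[of c a] g_sym[of b c] P ne by auto
  have 1: "arc_between (g a b \<union> Db) (s a b) (s b c)"
    using arc_between_weak_join[OF arc_g Db(2) abD(2)] P ne by simp
  have "(g a b \<union> Db) \<inter> g b c \<subseteq> {s b c}" using GG(1) bcD(2) by blast
  then have 2: "arc_between (g a b \<union> Db \<union> g b c) (s a b) (s c b)"
    using arc_between_join[OF 1 arc_g] P ne by simp
  have "(g a b \<union> Db \<union> g b c) \<inter> Dc \<subseteq> {s c b}" using abD(3) DD(3) bcD(3) by blast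
  then have A: "arc_between (g a b \<union> Db \<union> g b c \<union> Dc) (s a b) (s c a)"
    using arc_between_weak_join[OF 2 Dc(2)] by simp
  have "arc_between (g c a \<union> Da) (s c a) (s a b)"
    using arc_between_weak_join[OF arc_g Da(2) caD(1)] P ne by simp
  then have B: "arc_between (g c a \<union> Da) (s a b) (s c a)" by (rule arc_between_sym)
  show thesis
  proof (rule that[OF A B _ _ Da(1) Db(1) Dc(1)])
    have "(g a b \<union> Db \<union> g b c \<union> Dc) \<inter> (g c a \<union> Da) \<subseteq> {s a b, s c a}"
      unfolding Int_Un_distrib Int_Un_distrib2 using GG(2,3) abD(1) bcD(1) caD(2,3) DD by auto
    then show "(g a b \<union> Db \<union> g b c \<union> Dc) \<inter> (g c a \<union> Da) = {s a b, s c a}"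
      using arc_between_ends[OF A] arc_between_ends[OF B] by blast
    show "path_connected Da" "path_connected Db" "path_connected Dc"
      using Da(2) Db(2) Dc(2) weak_arc_path_connected by blast+
  qed (use endD in auto)
qed

text \<open>\<open>K k\<close> may reach both sides of the curve, so the connection from
  \<open>K d\<close> to \<open>K e\<close> must be kept out of \<open>I\<close>. From either end
  follow the arc and \<open>K k\<close> up to the first point of \<open>J\<close>, which lies in
  \<open>K k\<close>, and join the two points found inside \<open>J \<inter> K k\<close>.\<close>

lemma middle_arc:
  assumes P: "k \<in> P" "d \<in> P" "e \<in> P" and ne: "k \<noteq> d" "k \<noteq> e" "d \<noteq> e"
    and J: "closed J" "path_connected (J \<inter> K k)" "J \<inter> K k \<noteq> {}" "J \<inter> K d = {}" "J \<inter> K e = {}"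
      "J \<inter> g d k \<subseteq> K k" "J \<inter> g e k \<subseteq> K k"
    and O': "open I" "open O'" "I \<inter> O' = {}" "I \<union> O' = - J" "K d \<subseteq> O'" "K e \<subseteq> O'"
  obtains M where "arc_between M (s d k) (s e k)" "M \<subseteq> O' \<union> J" "M \<subseteq> g d k \<union> K k \<union> g e k" "M \<inter> K k \<noteq> {}"
proof -
  have reach: "\<exists>F y. path_connected F \<and> F \<subseteq> g z k \<union> K k \<and> s z k \<in> F \<and> y \<in> F \<and> y \<in> J \<inter> K k \<and> F \<subseteq> O' \<union> J"
    if z: "z \<in> P" "z \<noteq> k" "J \<inter> K z = {}" "J \<inter> g z k \<subseteq> K k" "K z \<subseteq> O'" for z
  proof -
    have pcz: "path_connected (g z k \<union> K k)"
      using path_connected_Un[OF path_connected_g[of z k] pc[of k]] sg[of k z] sK[of k z] g_sym[of z k] z P by blast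
    have s_in: "s z k \<in> g z k \<union> K k" "s z k \<in> K z" using sg[of z k] sK[of z k] z P by auto
    have "J \<inter> (g z k \<union> K k) \<noteq> {}" using J(3) by blast
    then obtain F y where F: "path_connected F" "F \<subseteq> g z k \<union> K k" "s z k \<in> F" "F \<inter> J = {y}" "connected_set (F - {y})"
      using path_first_hit[OF pcz s_in(1) J(1)] by metis
    have y: "y \<in> F" "y \<in> J" "y \<in> K k" using F(2,4) z(4) by blast+
    have "s z k \<noteq> y" using s_in(2) z(3) y(2) by blast
    have "F - {y} \<subseteq> O'"
    proof (rule connected_subset_side[OF F(5) _ O'(2,1)])
      show "(F - {y}) \<inter> J = {}" using F(4) by blast
      show "(F - {y}) \<inter> O' \<noteq> {}" using F(3) \<open>s z k \<noteq> y\<close> s_in(2) z(5) by blast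
    qed (use O'(3,4) in blast)+
    then have "F \<subseteq> O' \<union> J" using y(2) by blast
    then show ?thesis using F y by blast
  qed
  obtain F y where F: "path_connected F" "F \<subseteq> g d k \<union> K k" "s d k \<in> F" "y \<in> F" "y \<in> J \<inter> K k" "F \<subseteq> O' \<union> J"
    using reach[of d] P ne J O' by blast
  obtain H z where H: "path_connected H" "H \<subseteq> g e k \<union> K k" "s e k \<in> H" "z \<in> H" "z \<in> J \<inter> K k" "H \<subseteq> O' \<union> J"
    using reach[of e] P ne J O' by blast
  have "path_connected (F \<union> (J \<inter> K k))" using path_connected_Un[OF F(1) J(2)] F(4,5) by blast
  then have "path_connected (F \<union> (J \<inter> K k) \<union> H)" using path_connected_Un[OF _ H(1)] H(4,5) by blast
  then obtain M where M: "M \<subseteq> F \<union> (J \<inter> K k) \<union> H" "weak_arc M (s d k) (s e k)"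
    using weak_arc_within[of "F \<union> (J \<inter> K k) \<union> H" "s d k" "s e k"] F(3) H(3) by blast
  have "s d k \<noteq> s e k" using KK[of d e] sK[of d k] sK[of e k] P ne by auto
  then have arcM: "arc_between M (s d k) (s e k)" using M(2) by (simp add: weak_arc_def)
  have sub: "M \<subseteq> g d k \<union> K k \<union> g e k" using M(1) F(2) H(2) by blast
  show thesis
  proof (rule that[OF arcM _ sub])
    show "M \<subseteq> O' \<union> J" using M(1) F(6) H(6) by blast
    show "M \<inter> K k \<noteq> {}"
    proof
      \<comment> \<open>Otherwise the connected set \<open>M\<close> would be covered by two closed
        arcs that both meet it but have no common point in it.\<close>
      assume 0: "M \<inter> K k = {}"
      have con: "connected_set M" using M(2) weak_arc_path_connected path_connected_imp_connected by blast
      have "g d k \<inter> g e k \<subseteq> K k"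
        using gg[of k d e] g_sym[of d k] g_sym[of e k] P ne by simp
      then have "g d k \<inter> g e k \<inter> M = {}" using 0 by blast
      moreover have "M \<subseteq> g d k \<union> g e k" using sub 0 by blast
      moreover have "s d k \<in> g d k \<inter> M" "s e k \<in> g e k \<inter> M"
        using sg[of d k] sg[of e k] weak_arc_ends[OF M(2)] P ne by auto
      moreover have "closed (g d k)" "closed (g e k)" using closed_g P ne by auto
      ultimately show False
        using con unfolding connected_closed by blast
    qed
  qed
qed

lemma leg_Int:
  assumes "i \<in> P" "d \<in> P" "e \<in> P" "i \<noteq> d" "i \<noteq> e" "d \<noteq> e" and M: "M \<subseteq> g d i \<union> K i \<union> g e i"
  shows "M \<inter> K d \<subseteq> {s d i}" "M \<inter> K e \<subseteq> {s e i}"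
proof -
  have "g d i \<inter> K d = {s d i}" "g e i \<inter> K d = {}" "K i \<inter> K d = {}"
    using gK[of d i] gK0[of e i d] KK[of i d] assms(1-6) by auto
  then show "M \<inter> K d \<subseteq> {s d i}" using M by blast
  have "g e i \<inter> K e = {s e i}" "g d i \<inter> K e = {}" "K i \<inter> K e = {}"
    using gK[of e i] gK0[of d i e] KK[of i e] assms(1-6) by auto
  then show "M \<inter> K e \<subseteq> {s e i}" using M by blast
qed

lemma theta_arc:
  assumes P: "k \<in> P" "d \<in> P" "e \<in> P" and ne: "k \<noteq> d" "k \<noteq> e" "d \<noteq> e"
    and M: "arc_between M (s d k) (s e k)" "M \<subseteq> g d k \<union> K k \<union> g e k"
    and A: "weak_arc A p (s d k)" "A \<subseteq> K d" and B: "weak_arc B q (s e k)" "B \<subseteq> K e"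
  shows "arc_between (A \<union> M \<union> B) p q"
proof -
  note leg = leg_Int[OF P ne M(2)]
  have "A \<inter> M \<subseteq> {s d k}" using leg(1) A(2) by blast
  then have 1: "arc_between (A \<union> M) p (s e k)" by (rule weak_arc_join[OF A(1) M(1)])
  have "A \<inter> B = {}" using KK[of d e] A(2) B(2) P ne by blast
  then have "(A \<union> M) \<inter> B \<subseteq> {s e k}" using leg(2) B(2) by blast
  then show ?thesis by (rule arc_between_weak_join[OF 1 weak_arc_sym[OF B(1)]])
qed

text \<open>Pieces at different vertices can meet only at ends inside \<open>K d\<close> or
  \<open>K e\<close>. Such a common end lies on two legs of a tripod, so it is the centre
  \<open>p\<close> or \<open>q\<close>.\<close>

lemma theta_arcs_Int:
  assumes P: "i \<in> P" "j \<in> P" "d \<in> P" "e \<in> P" and ne: "distinct [i, j, d, e]"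
    and M: "M \<subseteq> g d i \<union> K i \<union> g e i" and N: "N \<subseteq> g d j \<union> K j \<union> g e j"
    and A: "A \<subseteq> K d" "A' \<subseteq> K d" "A \<inter> A' = {p}" "s d i \<in> A" "s d j \<in> A'"
    and B: "B \<subseteq> K e" "B' \<subseteq> K e" "B \<inter> B' = {q}" "s e i \<in> B" "s e j \<in> B'"
  shows "(A \<union> M \<union> B) \<inter> (A' \<union> N \<union> B') = {p, q}"
proof -
  have de: "K d \<inter> K e = {}" by (rule KK) (use P ne in auto)
  have ne': "i \<noteq> j" "i \<noteq> d" "i \<noteq> e" "j \<noteq> d" "j \<noteq> e" "d \<noteq> e" using ne by auto
  note Md = leg_Int[OF P(1,3,4) ne'(2,3,6) M] and Nd = leg_Int[OF P(2,3,4) ne'(4,5,6) N]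
  have sp: "{s d i} \<inter> {s d j} \<subseteq> {p, q}"
    using A(3-5) Int_mono[of "{s d i}" A "{s d j}" A'] by auto
  have sq: "{s e i} \<inter> {s e j} \<subseteq> {p, q}"
    using B(3-5) Int_mono[of "{s e i}" B "{s e j}" B'] by auto
  have "(g d i \<union> K i \<union> g e i) \<inter> (g d j \<union> K j \<union> g e j) \<subseteq> {p, q}"
  proof (rule Un3_Int_subset)
    have "g d i \<inter> g d j \<subseteq> {s d i} \<inter> {s d j}" by (rule ggs; use P ne' in auto)
    then show "g d i \<inter> g d j \<subseteq> {p, q}" using sp by (rule subset_trans)
    have "g e i \<inter> g e j \<subseteq> {s e i} \<inter> {s e j}" by (rule ggs; use P ne' in auto)
    then show "g e i \<inter> g e j \<subseteq> {p, q}" using sq by (rule subset_trans)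
    have "g d i \<inter> K j = {}" "g e i \<inter> K j = {}" "g d j \<inter> K i = {}" "g e j \<inter> K i = {}"
      by (rule gK0; use P ne' in auto)+
    then show "g d i \<inter> K j \<subseteq> {p, q}" "g e i \<inter> K j \<subseteq> {p, q}" "K i \<inter> g d j \<subseteq> {p, q}" "K i \<inter> g e j \<subseteq> {p, q}"
      by (simp_all add: Int_commute)
    have "g d i \<inter> g e j = {}" "g e i \<inter> g d j = {}" by (rule gg0; use P ne' in auto)+
    then show "g d i \<inter> g e j \<subseteq> {p, q}" "g e i \<inter> g d j \<subseteq> {p, q}" by simp_all
    have "K i \<inter> K j = {}" by (rule KK; use P ne' in auto)
    then show "K i \<inter> K j \<subseteq> {p, q}" by simp
  qed
  then have MN: "M \<inter> N \<subseteq> {p, q}" using M N by (meson Int_mono order_trans)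
  have "A \<inter> N \<subseteq> A \<inter> {s d j}" "M \<inter> A' \<subseteq> {s d i} \<inter> A'" using A(1,2) Md(1) Nd(1) by blast+
  then have AN: "A \<inter> N \<subseteq> {p, q}" "M \<inter> A' \<subseteq> {p, q}"
    using A(3-5) Int_mono[of A A "{s d j}" A'] Int_mono[of "{s d i}" A A' A'] by auto
  have "B \<inter> N \<subseteq> B \<inter> {s e j}" "M \<inter> B' \<subseteq> {s e i} \<inter> B'" using B(1,2) Md(2) Nd(2) by blast+
  then have BN: "B \<inter> N \<subseteq> {p, q}" "M \<inter> B' \<subseteq> {p, q}"
    using B(3-5) Int_mono[of B B "{s e j}" B'] Int_mono[of "{s e i}" B B' B'] by auto
  have "A \<inter> B' = {}" "B \<inter> A' = {}" using A(1,2) B(1,2) de by blast+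
  then have AB: "A \<inter> B' \<subseteq> {p, q}" "B \<inter> A' \<subseteq> {p, q}" by simp_all
  have "A \<inter> A' \<subseteq> {p, q}" "B \<inter> B' \<subseteq> {p, q}" using A(3) B(3) by simp_all
  then have "(A \<union> M \<union> B) \<inter> (A' \<union> N \<union> B') \<subseteq> {p, q}"
    using MN AN BN AB by (intro Un3_Int_subset)
  moreover have "p \<in> A \<inter> A'" "q \<in> B \<inter> B'" using A(3) B(3) by auto
  ultimately show ?thesis by blast
qed

text \<open>
  The sets \<open>K d\<close> and \<open>K e\<close> lie on the same side of a closed curve through \<open>K a\<close>, \<open>K b\<close>, \<open>K c\<close>. With the
  other side of the curve as a third vertex they form one part of a \<open>K(3, 3)\<close>; the other part is
  \<open>K a\<close>, \<open>K b\<close>, \<open>K c\<close>.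
\<close>

lemma no_K5:
  assumes P: "a \<in> P" "b \<in> P" "c \<in> P" "d \<in> P" "e \<in> P" and ne: "distinct [a, b, c, d, e]"
  shows False
proof -
  obtain A B Da Db Dc p q where J: "arc_between A p q" "arc_between B p q" "A \<inter> B = {p, q}"
    and JU: "A \<union> B = g a b \<union> g b c \<union> g c a \<union> Da \<union> Db \<union> Dc"
    and D: "Da \<subseteq> K a" "Db \<subseteq> K b" "Dc \<subseteq> K c" "path_connected Da" "path_connected Db" "path_connected Dc"
    and sD: "s a b \<in> Da" "s a c \<in> Da" "s b a \<in> Db" "s b c \<in> Db" "s c a \<in> Dc" "s c b \<in> Dc"
    by (rule closed_curve[of a b c]) (use P ne in simp_all)
  define J where "J = A \<union> B"
  have JK0: "J \<inter> K z = {}" if "z \<in> P" "z \<noteq> a" "z \<noteq> b" "z \<noteq> c" for z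
  proof -
    have "g a b \<inter> K z = {}" "g b c \<inter> K z = {}" "g c a \<inter> K z = {}" "Da \<inter> K z = {}" "Db \<inter> K z = {}" "Dc \<inter> K z = {}"
      using gK0[of a b z] gK0[of b c z] gK0[of c a z] KK[of a z] KK[of b z] KK[of c z] D that P ne by auto
    then show ?thesis unfolding J_def JU by (simp add: Int_Un_distrib2)
  qed
  have ne': "a \<noteq> b" "a \<noteq> c" "b \<noteq> c" using ne by auto
  have JK: "J \<inter> K a = Da" "J \<inter> K b = Db" "J \<inter> K c = Dc"
  proof -
    have kk: "K a \<inter> K b = {}" "K a \<inter> K c = {}" "K b \<inter> K c = {}" by (rule KK; use P ne' in simp)+
    then have DK: "Da \<inter> K b = {}" "Da \<inter> K c = {}" "Db \<inter> K a = {}" "Db \<inter> K c = {}" "Dc \<inter> K a = {}" "Dc \<inter> K b = {}"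
      using D(1-3) by blast+
    have gKs: "g a b \<inter> K a = {s a b}" "g b c \<inter> K a = {}" "g c a \<inter> K a = {s a c}"
      "g a b \<inter> K b = {s b a}" "g b c \<inter> K b = {s b c}" "g c a \<inter> K b = {}"
      "g a b \<inter> K c = {}" "g b c \<inter> K c = {s c b}" "g c a \<inter> K c = {s c a}"
      by (rule gK gK' gK0; use P ne in auto)+
    have abs: "Da \<inter> K a = Da" "Db \<inter> K b = Db" "Dc \<inter> K c = Dc" using D(1-3) by blast+
    show "J \<inter> K a = Da" "J \<inter> K b = Db" "J \<inter> K c = Dc"
      unfolding J_def JU Int_Un_distrib2 gKs DK abs using sD by auto
  qed
  have Jg: "J \<inter> g z k \<subseteq> K k" if "z \<in> {d, e}" "k \<in> {a, b, c}" for z k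
  proof -
    have z: "z \<in> P" "z \<noteq> a" "z \<noteq> b" "z \<noteq> c" and k: "k \<in> P" "z \<noteq> k" using that P ne by auto
    have gz: "g u v \<inter> g z k \<subseteq> K k" if "u \<in> {a, b, c}" "v \<in> {a, b, c}" "u \<noteq> v" for u v
    proof -
      have uv: "u \<in> P" "v \<in> P" "z \<noteq> u" "z \<noteq> v" using that z P by auto
      consider "k = u" | "k = v" | "k \<noteq> u" "k \<noteq> v" by blast
      then show ?thesis
      proof cases
        case 1
        then show ?thesis using gg[of u v z] uv z that(3) g_sym[of z k] by auto
      next
        case 2
        then show ?thesis using gg[of v u z] uv z that(3) g_sym[of z k] g_sym[of u v] by auto
      next
        case 3
        then show ?thesis using gg0[of u v z k] uv z that(3) k by auto
      qed
    qed
    have Dz: "D \<inter> g z k \<subseteq> K k" if "D \<subseteq> K w" "w \<in> P" "w \<noteq> z" for D w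
    proof (cases "w = k")
      case False
      then have "g z k \<inter> K w = {}" using gK0[of z k w] that z k by simp
      then show ?thesis using that(1) by blast
    qed (use that in blast)
    have "Da \<inter> g z k \<subseteq> K k" "Db \<inter> g z k \<subseteq> K k" "Dc \<inter> g z k \<subseteq> K k"
      using Dz[OF D(1) P(1)] Dz[OF D(2) P(2)] Dz[OF D(3) P(3)] z(2-4) by simp_all
    moreover have "g a b \<inter> g z k \<subseteq> K k" "g b c \<inter> g z k \<subseteq> K k" "g c a \<inter> g z k \<subseteq> K k"
      using gz[of a b] gz[of b c] gz[of c a] ne' by auto
    ultimately show ?thesis unfolding J_def JU by (simp add: Int_Un_distrib2)
  qed
  \<comment> \<open>This puts \<open>K d\<close> and \<open>K e\<close> on the same side of the
    curve: the arc between them does not meet it.\<close>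
  have "J \<inter> g d e = {}"
  proof -
    have "g d e \<inter> K a = {}" "g d e \<inter> K b = {}" "g d e \<inter> K c = {}"
      by (rule gK0; use P ne in auto)+
    then have "Da \<inter> g d e = {}" "Db \<inter> g d e = {}" "Dc \<inter> g d e = {}" using D(1-3) by blast+
    moreover have "g a b \<inter> g d e = {}" "g b c \<inter> g d e = {}" "g c a \<inter> g d e = {}"
      by (rule gg0; use P ne in auto)+
    ultimately show ?thesis unfolding J_def JU by (simp add: Int_Un_distrib2)
  qed
  moreover have JK0': "J \<inter> K d = {}" "J \<inter> K e = {}" using JK0 P ne by auto
  ultimately have JC: "(K d \<union> g d e \<union> K e) \<inter> J = {}" by blast
  have conC: "connected_set (K d \<union> g d e \<union> K e)"
  proof -
    have de: "d \<noteq> e" using ne by simp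
    have "connected_set (K d)" "connected_set (g d e)" "connected_set (K e)"
      using path_connected_imp_connected pc[OF P(4)] pc[OF P(5)] path_connected_g[OF P(4,5) de] by blast+
    moreover have "s d e \<in> K d \<inter> g d e" "s e d \<in> g d e \<inter> K e"
      using sK[OF P(4,5) de] sg[OF P(4,5) de] sK[OF P(5,4) de[symmetric]] sg[OF P(5,4) de[symmetric]] g_sym[of d e]
      by simp_all
    ultimately show ?thesis by (intro connected_Un) blast+
  qed
  have "K d \<union> g d e \<union> K e \<noteq> {}" using sK[of d e] P ne by auto
  then obtain I O' where IO: "open I" "connected_set I" "I \<noteq> {}" "open O'" "connected_set O'" "K d \<union> g d e \<union> K e \<subseteq> O'"
    "I \<inter> O' = {}" "I \<union> O' = - (A \<union> B)" "frontier I = A \<union> B" "bounded I \<or> bounded O'"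
    by (rule jordan_sides[OF J conC _ JC[unfolded J_def]])
  have O': "open I" "open O'" "I \<inter> O' = {}" "I \<union> O' = - J" "K d \<subseteq> O'" "K e \<subseteq> O'"
    using IO unfolding J_def by auto
  have closedJ: "closed J"
    using J(1,2) arc_between_compact compact_imp_closed unfolding J_def by (intro closed_Un) blast+
  have mid: "\<exists>M. arc_between M (s d k) (s e k) \<and> M \<subseteq> O' \<union> J \<and> M \<subseteq> g d k \<union> K k \<union> g e k \<and> M \<inter> K k \<noteq> {}"
    if k: "k \<in> {a, b, c}" for k
  proof -
    have JKk: "path_connected (J \<inter> K k)" "J \<inter> K k \<noteq> {}" using k JK D(4-6) sD by auto
    have kP: "k \<in> P" "k \<noteq> d" "k \<noteq> e" "d \<noteq> e" using k P ne by auto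
    have "J \<inter> g d k \<subseteq> K k" "J \<inter> g e k \<subseteq> K k" using Jg k by simp_all
    from middle_arc[OF kP(1) P(4,5) kP(2-4) closedJ JKk JK0' this O'] show ?thesis by metis
  qed
  obtain Ma where Ma: "arc_between Ma (s d a) (s e a)" "Ma \<subseteq> O' \<union> J" "Ma \<subseteq> g d a \<union> K a \<union> g e a" "Ma \<inter> K a \<noteq> {}"
    using mid[of a] by blast
  obtain Mb where Mb: "arc_between Mb (s d b) (s e b)" "Mb \<subseteq> O' \<union> J" "Mb \<subseteq> g d b \<union> K b \<union> g e b" "Mb \<inter> K b \<noteq> {}"
    using mid[of b] by blast
  obtain Mc where Mc: "arc_between Mc (s d c) (s e c)" "Mc \<subseteq> O' \<union> J" "Mc \<subseteq> g d c \<union> K c \<union> g e c" "Mc \<inter> K c \<noteq> {}"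
    using mid[of c] by blast
  obtain p' A1 A2 A3 where A': "A1 \<union> A2 \<union> A3 \<subseteq> K d" "weak_arc A1 p' (s d a)" "weak_arc A2 p' (s d b)" "weak_arc A3 p' (s d c)"
    "A1 \<inter> A2 = {p'}" "A1 \<inter> A3 = {p'}" "A2 \<inter> A3 = {p'}"
    by (rule tripod[OF pc[OF P(4)] sK[of d a] sK[of d b] sK[of d c]]) (use P ne in auto)
  obtain q' B1 B2 B3 where B': "B1 \<union> B2 \<union> B3 \<subseteq> K e" "weak_arc B1 q' (s e a)" "weak_arc B2 q' (s e b)" "weak_arc B3 q' (s e c)"
    "B1 \<inter> B2 = {q'}" "B1 \<inter> B3 = {q'}" "B2 \<inter> B3 = {q'}"
    by (rule tripod[OF pc[OF P(5)] sK[of e a] sK[of e b] sK[of e c]]) (use P ne in auto)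
  note ends = A'(2-4)[THEN weak_arc_ends] B'(2-4)[THEN weak_arc_ends]
  have sub: "A1 \<subseteq> K d" "A2 \<subseteq> K d" "A3 \<subseteq> K d" "B1 \<subseteq> K e" "B2 \<subseteq> K e" "B3 \<subseteq> K e" using A'(1) B'(1) by auto
  have c1: "arc_between (A1 \<union> Ma \<union> B1) p' q'"
    by (rule theta_arc[OF P(1,4,5) _ _ _ Ma(1,3) A'(2) sub(1) B'(2) sub(4)]) (use ne in auto)
  have c2: "arc_between (A2 \<union> Mb \<union> B2) p' q'"
    by (rule theta_arc[OF P(2,4,5) _ _ _ Mb(1,3) A'(3) sub(2) B'(3) sub(5)]) (use ne in auto)
  have c3: "arc_between (A3 \<union> Mc \<union> B3) p' q'"
    by (rule theta_arc[OF P(3,4,5) _ _ _ Mc(1,3) A'(4) sub(3) B'(4) sub(6)]) (use ne in auto)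
  have c12: "(A1 \<union> Ma \<union> B1) \<inter> (A2 \<union> Mb \<union> B2) = {p', q'}"
    by (rule theta_arcs_Int[OF P(1,2,4,5) _ Ma(3) Mb(3) sub(1,2) A'(5) _ _ sub(4,5) B'(5)]) (use ends ne in auto)
  have c13: "(A1 \<union> Ma \<union> B1) \<inter> (A3 \<union> Mc \<union> B3) = {p', q'}"
    by (rule theta_arcs_Int[OF P(1,3,4,5) _ Ma(3) Mc(3) sub(1,3) A'(6) _ _ sub(4,6) B'(6)]) (use ends ne in auto)
  have c23: "(A2 \<union> Mb \<union> B2) \<inter> (A3 \<union> Mc \<union> B3) = {p', q'}"
    by (rule theta_arcs_Int[OF P(2,3,4,5) _ Mb(3) Mc(3) sub(2,3) A'(7) _ _ sub(5,6) B'(7)]) (use ends ne in auto)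
  have offI: "I \<inter> (A1 \<union> Ma \<union> B1) = {}" "I \<inter> (A2 \<union> Mb \<union> B2) = {}" "I \<inter> (A3 \<union> Mc \<union> B3) = {}"
  proof -
    have "I \<inter> (O' \<union> J) = {}" using O'(3,4) by blast
    moreover have "A1 \<union> Ma \<union> B1 \<subseteq> O' \<union> J" "A2 \<union> Mb \<union> B2 \<subseteq> O' \<union> J" "A3 \<union> Mc \<union> B3 \<subseteq> O' \<union> J"
      using sub O'(5,6) Ma(2) Mb(2) Mc(2) by auto
    ultimately show "I \<inter> (A1 \<union> Ma \<union> B1) = {}" "I \<inter> (A2 \<union> Mb \<union> B2) = {}" "I \<inter> (A3 \<union> Mc \<union> B3) = {}"
      by blast+
  qed
  have offK: "K k \<inter> (A' \<union> M \<union> B') = {}"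
    if "k \<in> P" "i \<in> P" "distinct [k, i, d, e]" "A' \<subseteq> K d" "B' \<subseteq> K e" "M \<subseteq> g d i \<union> K i \<union> g e i" for k i A' M B'
  proof -
    have "K k \<inter> K d = {}" "K k \<inter> K e = {}" "K k \<inter> K i = {}" "g d i \<inter> K k = {}" "g e i \<inter> K k = {}"
      using KK[of k d] KK[of k e] KK[of k i] gK0[of d i k] gK0[of e i k] that(1-3) P by auto
    then show ?thesis using that(4-6) by blast
  qed
  obtain i0 where i0: "i0 \<in> I" using IO(3) by blast
  have conn: "\<exists>x\<in>M. connected_component (- (X \<union> Y)) i0 x"
    if k: "k \<in> {a, b, c}" and M: "M \<inter> K k \<noteq> {}" and "I \<inter> X = {}" "I \<inter> Y = {}" "K k \<inter> X = {}" "K k \<inter> Y = {}" for k M X Y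
  proof -
    have "J \<inter> K k \<noteq> {}" using k JK sD by auto
    then obtain y where y: "y \<in> J" "y \<in> K k" by blast
    \<comment> \<open>Every point of the curve is a frontier point of \<open>I\<close>. Adding one
      that lies in \<open>K k\<close> keeps \<open>I\<close> connected and leads through
      \<open>K k\<close> to the arc \<open>M\<close>.\<close>
    have "J \<subseteq> closure I" using IO(9) frontier_subset_eq unfolding J_def by (metis Diff_subset frontier_def)
    then have "connected_set (insert y I)"
      using connected_intermediate_closure[OF IO(2), of "insert y I"] closure_subset[of I] y(1) by blast
    moreover have "connected_set (K k)" using pc k P path_connected_imp_connected by blast
    ultimately have "connected_set (insert y I \<union> K k)" using y(2) by (intro connected_Un) blast+
    moreover have "insert y I \<union> K k \<subseteq> - (X \<union> Y)" using that(3-6) y(2) by blast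
    moreover obtain x where "x \<in> M" "x \<in> K k" using M by blast
    ultimately show ?thesis using i0 unfolding connected_component_def by blast
  qed
  have dd: "distinct [a, b, d, e]" "distinct [b, a, d, e]" "distinct [a, c, d, e]" "distinct [c, a, d, e]"
    "distinct [b, c, d, e]" "distinct [c, b, d, e]"
    using ne by auto
  note off = offK[OF P(1,2) dd(1) sub(2,5) Mb(3)] offK[OF P(1,3) dd(3) sub(3,6) Mc(3)] offK[OF P(2,1) dd(2) sub(1,4) Ma(3)] offK[OF P(2,3) dd(5) sub(3,6) Mc(3)] offK[OF P(3,1) dd(4) sub(1,4) Ma(3)] offK[OF P(3,2) dd(6) sub(2,5) Mb(3)]
  obtain x1 where x1: "x1 \<in> Ma" "connected_component (- ((A2 \<union> Mb \<union> B2) \<union> (A3 \<union> Mc \<union> B3))) i0 x1"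
    using conn[OF _ Ma(4) offI(2,3) off(1,2)] by blast
  obtain x2 where x2: "x2 \<in> Mb" "connected_component (- ((A1 \<union> Ma \<union> B1) \<union> (A3 \<union> Mc \<union> B3))) i0 x2"
    using conn[OF _ Mb(4) offI(1,3) off(3,4)] by blast
  obtain x3 where x3: "x3 \<in> Mc" "connected_component (- ((A1 \<union> Ma \<union> B1) \<union> (A2 \<union> Mb \<union> B2))) i0 x3"
    using conn[OF _ Mc(4) offI(1,2) off(5,6)] by blast
  show False
    by (rule theta_no_common_face[OF c1 c2 c3 c12 c13 c23 x1(2) _ x2(2) _ x3(2)]) (use x1(1) x2(1) x3(1) in simp_all)
qed

end

text \<open>
  Drawing vertices as path-connected sets makes the class closed under contraction without any
  redrawing: the two ends and the contracted arc are merged into one set.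
\<close>

definition model :: "'v set \<Rightarrow> 'v set set \<Rightarrow> ('v \<Rightarrow> complex set) \<Rightarrow> ('v set \<Rightarrow> complex set) \<Rightarrow> bool" where
  "model V E K G \<longleftrightarrow>
     (\<forall>v\<in>V. path_connected (K v)) \<and>
     (\<forall>u\<in>V. \<forall>v\<in>V. u \<noteq> v \<longrightarrow> K u \<inter> K v = {}) \<and>
     (\<forall>e\<in>E. \<exists>u\<in>V. \<exists>v\<in>V. \<exists>x\<in>K u. \<exists>y\<in>K v.
        u \<noteq> v \<and> e = {u, v} \<and> arc_between (G e) x y \<and> G e \<inter> \<Union>(K ` V) = {x, y}) \<and>
     (\<forall>e\<in>E. \<forall>f\<in>E. e \<noteq> f \<longrightarrow> G e \<inter> G f \<subseteq> \<Union>(K ` V))"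

section \<open>Models and their minors\<close>

lemma modelD:
  assumes "model V E K G"
  shows "v \<in> V \<Longrightarrow> path_connected (K v)"
    "\<lbrakk>u \<in> V; v \<in> V; u \<noteq> v\<rbrakk> \<Longrightarrow> K u \<inter> K v = {}"
    "\<lbrakk>e \<in> E; f \<in> E; e \<noteq> f\<rbrakk> \<Longrightarrow> G e \<inter> G f \<subseteq> \<Union>(K ` V)"
  using assms by (simp_all add: model_def)

lemma model_edge:
  assumes "model V E K G" "{u, v} \<in> E"
  obtains x y where "x \<in> K u" "y \<in> K v" "arc_between (G {u, v}) x y" "G {u, v} \<inter> \<Union>(K ` V) = {x, y}"
    "u \<in> V" "v \<in> V" "u \<noteq> v"
proof -
  have "\<exists>u'\<in>V. \<exists>v'\<in>V. \<exists>x\<in>K u'. \<exists>y\<in>K v'. u' \<noteq> v' \<and> {u, v} = {u', v'} \<and>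
      arc_between (G {u, v}) x y \<and> G {u, v} \<inter> \<Union>(K ` V) = {x, y}"
    using assms unfolding model_def by (elim conjE) (erule bspec)
  then obtain u' v' x y where e: "u' \<in> V" "v' \<in> V" "x \<in> K u'" "y \<in> K v'" "u' \<noteq> v'" "{u, v} = {u', v'}"
    "arc_between (G {u, v}) x y" "G {u, v} \<inter> \<Union>(K ` V) = {x, y}"
    by metis
  from e(6) consider "u = u'" "v = v'" | "u = v'" "v = u'" by (auto simp: doubleton_eq_iff)
  then show thesis
  proof cases
    case 1
    then show thesis using that[of x y] e by simp
  next
    case 2
    then show thesis using that[of y x] e arc_between_sym[OF e(7)] by (simp add: insert_commute)
  qed
qed

lemma model_edge_set:
  assumes "model V E K G" "e \<in> E"
  obtains u v where "e = {u, v}" "u \<in> V" "v \<in> V" "u \<noteq> v"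
proof -
  have "\<exists>u\<in>V. \<exists>v\<in>V. \<exists>x\<in>K u. \<exists>y\<in>K v. u \<noteq> v \<and> e = {u, v} \<and>
      arc_between (G e) x y \<and> G e \<inter> \<Union>(K ` V) = {x, y}"
    using assms unfolding model_def by (elim conjE) (erule bspec)
  then show thesis using that by blast
qed

lemma model_edge_Int:
  assumes m: "model V E K G" and e: "{u, v} \<in> E"
  obtains x y where "x \<in> K u" "y \<in> K v" "arc_between (G {u, v}) x y"
    "G {u, v} \<inter> K u = {x}" "G {u, v} \<inter> K v = {y}"
    "\<And>w. w \<in> V \<Longrightarrow> w \<noteq> u \<Longrightarrow> w \<noteq> v \<Longrightarrow> G {u, v} \<inter> K w = {}"
proof -
  obtain x y where xy: "x \<in> K u" "y \<in> K v" "arc_between (G {u, v}) x y" "G {u, v} \<inter> \<Union>(K ` V) = {x, y}"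
    and uv: "u \<in> V" "v \<in> V" "u \<noteq> v"
    by (rule model_edge[OF m e])
  have G: "G {u, v} \<inter> K w \<subseteq> {x, y}" if "w \<in> V" for w using xy(4) that by blast
  have xyG: "x \<in> G {u, v}" "y \<in> G {u, v}" using xy(4) by blast+
  have "K u \<inter> K v = {}" by (rule modelD(2)[OF m uv])
  then have 1: "G {u, v} \<inter> K u = {x}" "G {u, v} \<inter> K v = {y}"
    using G[OF uv(1)] G[OF uv(2)] xy(1,2) xyG by blast+
  have 2: "G {u, v} \<inter> K w = {}" if "w \<in> V" "w \<noteq> u" "w \<noteq> v" for w
  proof -
    have "K w \<inter> K u = {}" "K w \<inter> K v = {}" using modelD(2)[OF m] that uv by metis+
    then show ?thesis using G[OF that(1)] xy(1,2) by blast
  qed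
  show thesis by (rule that[OF xy(1-3) 1 2])
qed

lemma model_no_K5:
  assumes m: "model V E K G" and ne: "distinct [a, b, c, d, e]" and V: "{a, b, c, d, e} \<subseteq> V"
    and E: "\<And>u v. \<lbrakk>u \<in> {a, b, c, d, e}; v \<in> {a, b, c, d, e}; u \<noteq> v\<rbrakk> \<Longrightarrow> {u, v} \<in> E"
  shows False
proof -
  define P where "P = {a, b, c, d, e}"
  \<comment> \<open>Edges are unordered, but an arc meets each of its two vertex sets in one point,
    so the end in \<open>K u\<close> can be recovered.\<close>
  define s where "s u v = (THE x. G {u, v} \<inter> K u = {x})" for u v
  have E': "{u, v} \<in> E" if "u \<in> P" "v \<in> P" "u \<noteq> v" for u v using E that unfolding P_def by blast
  have PV: "u \<in> V" if "u \<in> P" for u using V that unfolding P_def by blast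
  have s: "G {u, v} \<inter> K u = {s u v}" "arc_between (G {u, v}) (s u v) (s v u)"
    "\<And>w. w \<in> P \<Longrightarrow> w \<noteq> u \<Longrightarrow> w \<noteq> v \<Longrightarrow> G {u, v} \<inter> K w = {}"
    if uv: "u \<in> P" "v \<in> P" "u \<noteq> v" for u v
  proof -
    obtain x y where xy: "arc_between (G {u, v}) x y"
      "G {u, v} \<inter> K u = {x}" "G {u, v} \<inter> K v = {y}"
      "\<And>w. w \<in> V \<Longrightarrow> w \<noteq> u \<Longrightarrow> w \<noteq> v \<Longrightarrow> G {u, v} \<inter> K w = {}"
      by (rule model_edge_Int[OF m E'[OF uv]]) blast
    have "s u v = x" "s v u = y"
      unfolding s_def insert_commute[of v u] xy(2,3) by auto
    then show "G {u, v} \<inter> K u = {s u v}" "arc_between (G {u, v}) (s u v) (s v u)" using xy by auto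
    show "G {u, v} \<inter> K w = {}" if "w \<in> P" "w \<noteq> u" "w \<noteq> v" for w using xy(4) that PV by blast
  qed
  have gg: "w \<in> {u, v} \<inter> {u', v'}"
    if "x \<in> G {u, v}" "x \<in> G {u', v'}" "{u, v} \<in> E" "{u', v'} \<in> E" "{u, v} \<noteq> {u', v'}" "w \<in> V" "x \<in> K w" for x u v u' v' w
  proof -
    have "w = u \<or> w = v" by (rule model_edge_Int[OF m that(3)]) (use that in blast)
    moreover have "w = u' \<or> w = v'" by (rule model_edge_Int[OF m that(4)]) (use that in blast)
    ultimately show ?thesis by blast
  qed
  have inK: "\<exists>w\<in>V. x \<in> K w" if "x \<in> G {u, v}" "x \<in> G {u', v'}" "{u, v} \<in> E" "{u', v'} \<in> E" "{u, v} \<noteq> {u', v'}" for x u v u' v'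
    using modelD(3)[OF m that(3-5)] that(1,2) by blast
  interpret plane_model P K "\<lambda>u v. G {u, v}" s
  proof
    show "path_connected (K v)" if "v \<in> P" for v using modelD(1)[OF m] PV that by blast
    show "K u \<inter> K v = {}" if "u \<in> P" "v \<in> P" "u \<noteq> v" for u v using modelD(2)[OF m] PV that by blast
    show "G {u, v} = G {v, u}" for u v by (simp add: insert_commute)
    show "G {u, v} \<inter> G {u, w} \<subseteq> K u" if "u \<in> P" "v \<in> P" "w \<in> P" "u \<noteq> v" "u \<noteq> w" "v \<noteq> w" for u v w
    proof
      fix x assume x: "x \<in> G {u, v} \<inter> G {u, w}"
      have ne: "{u, v} \<noteq> {u, w}" using that by (auto simp: doubleton_eq_iff)
      have uv: "{u, v} \<in> E" "{u, w} \<in> E" using E' that by auto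
      obtain z where z: "z \<in> V" "x \<in> K z" using inK[OF _ _ uv ne] x by blast
      then have "z \<in> {u, v} \<inter> {u, w}" using gg[OF _ _ uv ne z] x by blast
      then have "z = u" using that by blast
      then show "x \<in> K u" using z by simp
    qed
    show "G {u, v} \<inter> G {w, z} = {}" if "u \<in> P" "v \<in> P" "w \<in> P" "z \<in> P" "distinct [u, v, w, z]" for u v w z
    proof (rule ccontr)
      assume "G {u, v} \<inter> G {w, z} \<noteq> {}"
      then obtain x where x: "x \<in> G {u, v}" "x \<in> G {w, z}" by blast
      have ne: "{u, v} \<noteq> {w, z}" using that by (auto simp: doubleton_eq_iff)
      have uv: "{u, v} \<in> E" "{w, z} \<in> E" using E' that by auto
      obtain y where y: "y \<in> V" "x \<in> K y" using inK[OF x uv ne] by blast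
      then have "y \<in> {u, v} \<inter> {w, z}" using gg[OF x uv ne y] by blast
      then show False using that by auto
    qed
  qed (use s in auto)
  show False by (rule no_K5[of a b c d e]) (use ne in \<open>simp_all add: P_def\<close>)
qed

lemma model_subset:
  assumes m: "model V E K G" and FE: "F \<subseteq> E"
  shows "model V F K G"
proof -
  have ball: "Ball F Q" if "Ball E Q" for Q using that FE by blast
  show ?thesis
    using m unfolding model_def
  proof (elim conjE, intro conjI)
    assume GG: "\<forall>e\<in>E. \<forall>f\<in>E. e \<noteq> f \<longrightarrow> G e \<inter> G f \<subseteq> \<Union>(K ` V)"
    show "\<forall>e\<in>F. \<forall>f\<in>F. e \<noteq> f \<longrightarrow> G e \<inter> G f \<subseteq> \<Union>(K ` V)"
      by (rule ballI, rule ball, erule bspec[OF ball[OF GG]])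
  qed (assumption | erule ball)+
qed

text \<open>An arc whose edge avoids \<open>v\<close> does not meet \<open>K v\<close>, so dropping
  \<open>K v\<close> changes none of the intersections.\<close>

lemma model_delete:
  assumes m: "model V E K G"
  shows "model (V - {v}) {e \<in> E. v \<notin> e} K G"
proof -
  let ?W = "V - {v}"
  have G: "G e \<inter> \<Union>(K ` V) = G e \<inter> \<Union>(K ` ?W)" if e: "e \<in> E" "v \<notin> e" for e
  proof -
    obtain a b where ab: "e = {a, b}" by (rule model_edge_set[OF m e(1)])
    have "G e \<inter> K v = {}" if "v \<in> V"
      by (rule model_edge_Int[OF m, of a b]) (use ab e that in auto)
    then show ?thesis by blast
  qed
  show ?thesis
    unfolding model_def
  proof (intro conjI ballI impI)
    fix e assume e: "e \<in> {e \<in> E. v \<notin> e}"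
    obtain a b where ab: "e = {a, b}" by (rule model_edge_set[OF m, of e]) (use e in auto)
    have abE: "{a, b} \<in> E" using e ab by simp
    obtain x y where xy: "x \<in> K a" "y \<in> K b" "arc_between (G {a, b}) x y" "G {a, b} \<inter> \<Union>(K ` V) = {x, y}"
      "a \<in> V" "b \<in> V" "a \<noteq> b"
      by (rule model_edge[OF m abE])
    have "a \<in> ?W" "b \<in> ?W" using e ab xy(5,6) by auto
    moreover have "a \<noteq> b \<and> e = {a, b} \<and> arc_between (G e) x y \<and> G e \<inter> \<Union>(K ` ?W) = {x, y}"
      using G[of e] e xy(3,4,7) unfolding ab by simp
    ultimately show "\<exists>u\<in>?W. \<exists>w\<in>?W. \<exists>x\<in>K u. \<exists>y\<in>K w. u \<noteq> w \<and> e = {u, w} \<and> arc_between (G e) x y \<and> G e \<inter> \<Union>(K ` ?W) = {x, y}"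
      using xy(1,2) by blast
  next
    fix e f assume "e \<in> {e \<in> E. v \<notin> e}" "f \<in> {e \<in> E. v \<notin> e}" "e \<noteq> f"
    then have "G e \<inter> G f \<subseteq> G e \<inter> \<Union>(K ` V)" using modelD(3)[OF m, of e f] by simp
    also have "\<dots> = G e \<inter> \<Union>(K ` ?W)" using \<open>e \<in> {e \<in> E. v \<notin> e}\<close> by (intro G) auto
    finally show "G e \<inter> G f \<subseteq> \<Union>(K ` ?W)" by simp
  qed (use modelD(1,2)[OF m] in auto)
qed

lemma model_contract:
  assumes m: "model V E K G" and uv: "{u, v} \<in> E"
  obtains K' G' where
    "model (V - {v}) ({e \<in> E. v \<notin> e} \<union> (\<lambda>w. {u, w}) ` {w. {v, w} \<in> E \<and> w \<noteq> u}) K' G'"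
proof -
  let ?W = "V - {v}" and ?X = "(\<lambda>w. {u, w}) ` {w. {v, w} \<in> E \<and> w \<noteq> u}"
  let ?E = "{e \<in> E. v \<notin> e} \<union> ?X"
  define K' where "K' = K(u := K u \<union> G {u, v} \<union> K v)"
  \<comment> \<open>\<open>orig f\<close> is the old edge whose arc represents \<open>f\<close>. If
    \<open>w\<close> is adjacent to both \<open>u\<close> and \<open>v\<close>, the arc of
    \<open>{u, w}\<close> is kept and that of \<open>{v, w}\<close> is dropped.\<close>
  define orig where "orig f = (if f \<in> E then f else insert v (f - {u}))" for f
  obtain x y where xy: "x \<in> K u" "y \<in> K v" "arc_between (G {u, v}) x y"
    "G {u, v} \<inter> K u = {x}" "G {u, v} \<inter> K v = {y}"
    and off: "\<And>w. w \<in> V \<Longrightarrow> w \<noteq> u \<Longrightarrow> w \<noteq> v \<Longrightarrow> G {u, v} \<inter> K w = {}"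
    by (rule model_edge_Int[OF m uv]) blast
  obtain uV: "u \<in> V" "v \<in> V" "u \<noteq> v" by (rule model_edge[OF m uv])
  have sub: "K w \<subseteq> K' w" for w by (auto simp: K'_def)
  have UK: "\<Union>(K' ` ?W) = \<Union>(K ` V) \<union> G {u, v}" using uV by (auto simp: K'_def)
  have X: "\<exists>w. f = {u, w} \<and> {v, w} \<in> E \<and> orig f = {v, w} \<and> w \<noteq> u \<and> w \<noteq> v \<and> w \<in> V" if "f \<in> ?E" "f \<notin> E" for f
  proof -
    obtain w where w: "f = {u, w}" "{v, w} \<in> E" "w \<noteq> u" using \<open>f \<in> ?E\<close> \<open>f \<notin> E\<close> by blast
    obtain "w \<in> V" "v \<noteq> w" by (rule model_edge[OF m w(2)])
    moreover have "orig f = {v, w}" using w \<open>f \<notin> E\<close> by (auto simp: orig_def)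
    ultimately show ?thesis using w by blast
  qed
  have E0: "v \<notin> f" if "f \<in> ?E" "f \<in> E" for f
  proof -
    have "{v} \<notin> E"
    proof
      assume "{v} \<in> E"
      then obtain a b where "{v} = {a, b}" "a \<noteq> b" by (rule model_edge_set[OF m])
      then show False by auto
    qed
    then show ?thesis using that(1) uV by auto
  qed
  have orig: "orig f \<in> E" "orig f \<noteq> {u, v}" if f: "f \<in> ?E" for f
  proof -
    show "orig f \<in> E" using X[OF f] by (cases "f \<in> E") (auto simp: orig_def)
    show "orig f \<noteq> {u, v}"
    proof (cases "f \<in> E")
      case True
      then show ?thesis using E0[OF f] by (auto simp: orig_def)
    next
      case False
      then show ?thesis using X[OF f] by (auto simp: doubleton_eq_iff)
    qed
  qed
  have orig_inj: "orig f \<noteq> orig f'" if f: "f \<in> ?E" "f' \<in> ?E" "f \<noteq> f'" for f f'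
  proof (cases "f \<in> E"; cases "f' \<in> E")
    assume "f \<in> E" "f' \<in> E" then show ?thesis using f(3) by (simp add: orig_def)
  next
    assume "f \<in> E" "f' \<notin> E" then show ?thesis using X[OF f(2)] E0[OF f(1)] by (auto simp: orig_def)
  next
    assume "f \<notin> E" "f' \<in> E" then show ?thesis using X[OF f(1)] E0[OF f(2)] by (auto simp: orig_def)
  next
    assume "f \<notin> E" "f' \<notin> E"
    then show ?thesis using X[OF f(1)] X[OF f(2)] f(3) by (auto simp: doubleton_eq_iff)
  qed
  \<comment> \<open>The union of the vertex sets grows only by \<open>G {u, v}\<close>, which any
    other arc meets only inside old vertex sets.\<close>
  have GUK: "G (orig f) \<inter> \<Union>(K' ` ?W) = G (orig f) \<inter> \<Union>(K ` V)" if "f \<in> ?E" for f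
    using modelD(3)[OF m orig(1)[OF that] uv orig(2)[OF that]] unfolding UK by blast
  have "model ?W ?E K' (\<lambda>f. G (orig f))"
    unfolding model_def
  proof (intro conjI ballI impI)
    fix w assume w: "w \<in> ?W"
    have "path_connected (G {u, v})"
      using xy(3) weak_arc_path_connected weak_arc_def by blast
    moreover have "path_connected (K u)" "path_connected (K v)" using modelD(1)[OF m] uV(1,2) by auto
    moreover have "K u \<inter> G {u, v} \<noteq> {}" "(K u \<union> G {u, v}) \<inter> K v \<noteq> {}" using xy(4,5) by auto
    ultimately have "path_connected (K u \<union> G {u, v} \<union> K v)" by (simp add: path_connected_Un)
    then show "path_connected (K' w)" using modelD(1)[OF m, of w] w by (simp add: K'_def)
  next
    fix a b assume ab: "a \<in> ?W" "b \<in> ?W" "a \<noteq> b"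
    have star: "(K u \<union> G {u, v} \<union> K v) \<inter> K w = {}" if "w \<in> ?W" "w \<noteq> u" for w
    proof -
      have "K u \<inter> K w = {}" "K v \<inter> K w = {}"
        by (rule modelD(2)[OF m]; use that uV in auto)+
      moreover have "G {u, v} \<inter> K w = {}" using off[of w] that by auto
      ultimately show ?thesis by blast
    qed
    show "K' a \<inter> K' b = {}"
      using ab star[of a] star[of b] modelD(2)[OF m, of a b] by (auto simp: K'_def)
  next
    fix f assume f: "f \<in> ?E"
    show "\<exists>a\<in>?W. \<exists>b\<in>?W. \<exists>x\<in>K' a. \<exists>y\<in>K' b. a \<noteq> b \<and> f = {a, b} \<and> arc_between (G (orig f)) x y \<and>
        G (orig f) \<inter> \<Union>(K' ` ?W) = {x, y}"
    proof (cases "f \<in> E")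
      case True
      obtain a b where ab: "f = {a, b}" by (rule model_edge_set[OF m True])
      have abE: "{a, b} \<in> E" using True ab by simp
      obtain x y where xy: "x \<in> K a" "y \<in> K b" "arc_between (G {a, b}) x y" "G {a, b} \<inter> \<Union>(K ` V) = {x, y}"
        "a \<in> V" "b \<in> V" "a \<noteq> b"
        by (rule model_edge[OF m abE])
      have o: "orig f = {a, b}" using True ab by (simp add: orig_def)
      have "a \<in> ?W" "b \<in> ?W" using E0[OF f True] ab xy(5,6) by auto
      moreover have "x \<in> K' a" "y \<in> K' b" using sub[of a] sub[of b] xy(1,2) by auto
      moreover have "a \<noteq> b \<and> f = {a, b} \<and> arc_between (G (orig f)) x y \<and> G (orig f) \<inter> \<Union>(K' ` ?W) = {x, y}"
        using GUK[OF f] xy(3,4,7) ab unfolding o by simp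
      ultimately show ?thesis by blast
    next
      case False
      obtain w where w: "f = {u, w}" "{v, w} \<in> E" "orig f = {v, w}" "w \<noteq> u" "w \<noteq> v" "w \<in> V"
        using X[OF f False] by blast
      obtain x y where xy: "x \<in> K v" "y \<in> K w" "arc_between (G {v, w}) x y" "G {v, w} \<inter> \<Union>(K ` V) = {x, y}"
        by (rule model_edge[OF m w(2)])
      have "u \<in> ?W" "w \<in> ?W" using uV w(5,6) by auto
      moreover have "x \<in> K' u" "y \<in> K' w" using sub[of w] xy(1,2) by (auto simp: K'_def)
      moreover have "u \<noteq> w \<and> f = {u, w} \<and> arc_between (G (orig f)) x y \<and> G (orig f) \<inter> \<Union>(K' ` ?W) = {x, y}"
        using GUK[OF f] xy(3,4) w(1,4) unfolding w(3) by simp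
      ultimately show ?thesis by blast
    qed
  next
    fix f f' assume "f \<in> ?E" "f' \<in> ?E" "f \<noteq> f'"
    then have "G (orig f) \<inter> G (orig f') \<subseteq> \<Union>(K ` V)"
      by (intro modelD(3)[OF m] orig orig_inj)
    then show "G (orig f) \<inter> G (orig f') \<subseteq> \<Union>(K' ` ?W)" unfolding UK by blast
  qed
  then show thesis by (rule that)
qed

section \<open>Degrees and the edge bound\<close>

definition nbrs :: "'v set set \<Rightarrow> 'v \<Rightarrow> 'v set" where
  "nbrs E v = {w. {v, w} \<in> E}"

lemma nbrs_sym: "w \<in> nbrs E v \<longleftrightarrow> v \<in> nbrs E w"
  by (simp add: nbrs_def insert_commute)

lemma model_nbrs:
  assumes m: "model V E K G"
  shows "nbrs E v \<subseteq> V - {v}"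
proof
  fix w assume "w \<in> nbrs E v"
  then have "{v, w} \<in> E" by (simp add: nbrs_def)
  then show "w \<in> V - {v}" by (rule model_edge[OF m]) simp
qed

lemma model_finite_edges:
  assumes "finite V" "model V E K G"
  shows "finite E" "E \<subseteq> {e. e \<subseteq> V \<and> card e = 2}"
proof -
  show E: "E \<subseteq> {e. e \<subseteq> V \<and> card e = 2}"
  proof
    fix e assume "e \<in> E"
    then obtain u v where "e = {u, v}" "u \<in> V" "v \<in> V" "u \<noteq> v" by (rule model_edge_set[OF assms(2)])
    then show "e \<in> {e. e \<subseteq> V \<and> card e = 2}" by simp
  qed
  have "finite {e. e \<subseteq> V \<and> card e = 2}" using assms(1) by simp
  with E show "finite E" by (rule finite_subset)
qed

lemma edges_at:
  assumes m: "model V E K G"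
  shows "{e \<in> E. v \<in> e} = (\<lambda>w. {v, w}) ` nbrs E v"
proof
  show "{e \<in> E. v \<in> e} \<subseteq> (\<lambda>w. {v, w}) ` nbrs E v"
  proof
    fix e assume e: "e \<in> {e \<in> E. v \<in> e}"
    obtain a b where ab: "e = {a, b}" by (rule model_edge_set[OF m, of e]) (use e in auto)
    then have "e = {v, if v = a then b else a}" using e by auto
    then show "e \<in> (\<lambda>w. {v, w}) ` nbrs E v" using e by (auto simp: nbrs_def)
  qed
qed (auto simp: nbrs_def)

lemma card_edges_at:
  assumes m: "model V E K G"
  shows "card {e \<in> E. v \<in> e} = card (nbrs E v)"
proof -
  have "inj_on (\<lambda>w. {v, w}) (nbrs E v)" by (auto simp: inj_on_def doubleton_eq_iff)
  then show ?thesis unfolding edges_at[OF m] by (rule card_image)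
qed

lemma card_edges_split:
  assumes "finite V" and m: "model V E K G"
  shows "card E = card {e \<in> E. v \<notin> e} + card (nbrs E v)"
proof -
  have "E = {e \<in> E. v \<notin> e} \<union> {e \<in> E. v \<in> e}" "{e \<in> E. v \<notin> e} \<inter> {e \<in> E. v \<in> e} = {}" by blast+
  then have "card E = card {e \<in> E. v \<notin> e} + card {e \<in> E. v \<in> e}"
    using model_finite_edges(1)[OF assms] card_Un_disjoint[of "{e \<in> E. v \<notin> e}" "{e \<in> E. v \<in> e}"] by simp
  then show ?thesis by (simp only: card_edges_at[OF m])
qed

lemma handshake:
  assumes "finite V" and m: "model V E K G"
  shows "(\<Sum>v\<in>V. card (nbrs E v)) = 2 * card E"
proof -
  have "(\<Sum>v\<in>V. card {e \<in> E. v \<in> e}) = sum (\<lambda>_. 2) E"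
  proof (rule sum_multicount_gen)
    show "\<forall>e\<in>E. card {v \<in> V. v \<in> e} = 2"
    proof
      fix e assume "e \<in> E"
      then have "e \<subseteq> V" "card e = 2" using model_finite_edges(2)[OF assms] by auto
      moreover from this(1) have "{v \<in> V. v \<in> e} = e" by blast
      ultimately show "card {v \<in> V. v \<in> e} = 2" by simp
    qed
  qed (use assms model_finite_edges(1)[OF assms] in auto)
  then show ?thesis using card_edges_at[OF m] by simp
qed

text \<open>Contraction loses the edge itself and, for every common neighbour of its ends, one of
  two edges that become parallel.\<close>

lemma card_contract:
  assumes "finite V" and m: "model V E K G" and uv: "{u, v} \<in> E"
  shows "card E = card ({e \<in> E. v \<notin> e} \<union> (\<lambda>w. {u, w}) ` {w. {v, w} \<in> E \<and> w \<noteq> u})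
    + 1 + card (nbrs E u \<inter> nbrs E v)"
proof -
  let ?D = "{e \<in> E. v \<notin> e}" and ?R = "nbrs E v - {u} - nbrs E u"
  obtain u_v: "u \<noteq> v" by (rule model_edge[OF m uv])
  have fin: "finite (nbrs E v)" "finite ?D"
    using model_nbrs[OF m] model_finite_edges(1)[OF assms(1,2)] finite_subset[of _ "V - {v}"] assms(1) by auto
  have v_notin: "v \<notin> nbrs E v" and u_notin: "u \<notin> nbrs E u" using model_nbrs[OF m] by blast+
  have eq: "?D \<union> (\<lambda>w. {u, w}) ` {w. {v, w} \<in> E \<and> w \<noteq> u} = ?D \<union> (\<lambda>w. {u, w}) ` ?R"
    using u_v v_notin by (auto simp: nbrs_def)
  have "?D \<inter> (\<lambda>w. {u, w}) ` ?R = {}" by (auto simp: nbrs_def)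
  then have "card (?D \<union> (\<lambda>w. {u, w}) ` ?R) = card ?D + card ((\<lambda>w. {u, w}) ` ?R)"
    using fin by (intro card_Un_disjoint) auto
  also have "card ((\<lambda>w. {u, w}) ` ?R) = card ?R"
    by (rule card_image) (auto simp: inj_on_def doubleton_eq_iff)
  finally have c: "card (?D \<union> (\<lambda>w. {u, w}) ` ?R) = card ?D + card ?R" .
  have "nbrs E v = ?R \<union> insert u (nbrs E u \<inter> nbrs E v)"
    using uv by (auto simp: nbrs_def insert_commute)
  moreover have "?R \<inter> insert u (nbrs E u \<inter> nbrs E v) = {}" by blast
  ultimately have "card (nbrs E v) = card ?R + card (insert u (nbrs E u \<inter> nbrs E v))"
    using fin card_Un_disjoint[of ?R "insert u (nbrs E u \<inter> nbrs E v)"] by simp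
  moreover have "card (insert u (nbrs E u \<inter> nbrs E v)) = 1 + card (nbrs E u \<inter> nbrs E v)"
    using fin u_notin by simp
  ultimately show ?thesis
    using card_edges_split[OF assms(1,2), of v] c unfolding eq by simp
qed

text \<open>Each vertex misses at most one other, so the missing pairs form a matching on five
  points. Label them so that only \<open>a\<close>, \<open>b\<close> and \<open>c\<close>,
  \<open>d\<close> may be missing pairs; \<open>w\<close> is adjacent to all.\<close>

lemma near_complete_five:
  assumes card: "card N = 5" and min: "\<And>x. x \<in> N \<Longrightarrow> 3 \<le> card (nbrs E x \<inter> N)"
    and irr: "\<And>x. x \<notin> nbrs E x"
  obtains w a b c d where "N = {w, a, b, c, d}" "distinct [w, a, b, c, d]"
    "{a, b, c, d} \<subseteq> nbrs E w" "{c, d} \<subseteq> nbrs E a" "{c, d} \<subseteq> nbrs E b"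
proof -
  have fin: "finite N" using card card.infinite by fastforce
  have uniq: "y = z" if "x \<in> N" "y \<in> N" "z \<in> N" "y \<noteq> x" "z \<noteq> x" "y \<notin> nbrs E x" "z \<notin> nbrs E x" for x y z
  proof (rule ccontr)
    assume "y \<noteq> z"
    then have "card (N - {x, y, z}) = 2" using that card fin by (simp add: card_Diff_subset)
    moreover have "nbrs E x \<inter> N \<subseteq> N - {x, y, z}" using that irr by blast
    ultimately show False using min[OF that(1)] card_mono[of "N - {x, y, z}" "nbrs E x \<inter> N"] fin by simp
  qed
  have five: "\<exists>p q r. R = {p, q, r} \<and> distinct [p, q, r]" if "card R = 3" for R :: "'a set"
    using that by (auto simp: card_3_iff)
  show thesis
  proof (cases "\<exists>x\<in>N. \<exists>y\<in>N. y \<noteq> x \<and> y \<notin> nbrs E x")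
    case True
    then obtain x y where xy: "x \<in> N" "y \<in> N" "y \<noteq> x" "y \<notin> nbrs E x" by blast
    then have yx: "x \<notin> nbrs E y" using nbrs_sym by metis
    have "card (N - {x, y}) = 3" using xy card fin by (simp add: card_Diff_subset)
    then obtain p q r where R: "N - {x, y} = {p, q, r}" "distinct [p, q, r]" using five by blast
    have pqr: "p \<in> N" "q \<in> N" "r \<in> N" "p \<noteq> x" "q \<noteq> x" "r \<noteq> x" "p \<noteq> y" "q \<noteq> y" "r \<noteq> y"
      using R(1) by blast+
    have N: "N = {x, y, p, q, r}" using R(1) xy by blast
    have adj: "z \<in> nbrs E x" "z \<in> nbrs E y" if "z \<in> {p, q, r}" for z
      using uniq[of x y z] uniq[of y x z] xy yx that pqr by blast+
    have ppqr: "\<exists>w c d. {p, q, r} = {w, c, d} \<and> distinct [w, c, d] \<and> c \<in> nbrs E w \<and> d \<in> nbrs E w"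
    proof -
      consider "q \<notin> nbrs E p" | "r \<notin> nbrs E p" | "q \<in> nbrs E p" "r \<in> nbrs E p" by blast
      then show ?thesis
      proof cases
        case 1
        then have "p \<notin> nbrs E q" using nbrs_sym by metis
        with 1 have "r \<in> nbrs E p" "r \<in> nbrs E q"
          using uniq[of p q r] uniq[of q p r] pqr R(2) by auto
        then have "p \<in> nbrs E r" "q \<in> nbrs E r" using nbrs_sym by metis+
        then show ?thesis using R(2) by (intro exI[of _ r] exI[of _ p] exI[of _ q]) auto
      next
        case 2
        then have "p \<notin> nbrs E r" using nbrs_sym by metis
        with 2 have "q \<in> nbrs E p" "q \<in> nbrs E r"
          using uniq[of p r q] uniq[of r p q] pqr R(2) by auto
        then have "p \<in> nbrs E q" "r \<in> nbrs E q" using nbrs_sym by metis+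
        then show ?thesis using R(2) by (intro exI[of _ q] exI[of _ p] exI[of _ r]) auto
      next
        case 3
        then show ?thesis using R(2) by (intro exI[of _ p] exI[of _ q] exI[of _ r]) auto
      qed
    qed
    then obtain w c d where w: "{p, q, r} = {w, c, d}" "distinct [w, c, d]" "c \<in> nbrs E w" "d \<in> nbrs E w" by blast
    have in3: "w \<in> {p, q, r}" "c \<in> {p, q, r}" "d \<in> {p, q, r}" using w(1) by blast+
    show thesis
    proof (rule that[of w x y c d])
      show "N = {w, x, y, c, d}" using N w(1) by blast
      have "x \<notin> {p, q, r}" "y \<notin> {p, q, r}" using pqr by blast+
      then show "distinct [w, x, y, c, d]" using w(2) xy(3) unfolding w(1) by auto
      have "x \<in> nbrs E w" "y \<in> nbrs E w" using adj[OF in3(1)] nbrs_sym by metis+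
      then show "{x, y, c, d} \<subseteq> nbrs E w" using w(3,4) by simp
      show "{c, d} \<subseteq> nbrs E x" "{c, d} \<subseteq> nbrs E y" using adj in3 by blast+
    qed
  next
    case False
    obtain xs where xs: "set xs = N" "distinct xs" using finite_distinct_list[OF fin] by blast
    then have "length xs = 5" using card distinct_card by fastforce
    then obtain w a b c d where "xs = [w, a, b, c, d]" by (auto simp: length_Suc_conv eval_nat_numeral)
    then show thesis using that[of w a b c d] xs False by auto
  qed
qed

text \<open>
  In a minimal counterexample contraction shows that every edge lies in three triangles, and some vertex
  has degree 4 or 5; its neighbourhood then yields a \<open>K(5)\<close>, directly or after one contraction.
\<close>

theorem model_card_edges:
  assumes "finite V" "3 \<le> card V" "model V E K G"
  shows "card E \<le> 3 * card V - 6"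
  using assms
proof (induction "card V" arbitrary: V E K G rule: less_induct)
  case less
  note finV = less.prems(1)
  show ?case
  proof (cases "card V = 3")
    case True
    have "card E \<le> card {e. e \<subseteq> V \<and> card e = 2}"
      using model_finite_edges[OF finV less.prems(3)] finV by (intro card_mono) auto
    also have "\<dots> = 3" using n_subsets[OF finV, of 2] True by (simp add: choose_two)
    finally show ?thesis using True by simp
  next
    case False
    then have V4: "4 \<le> card V" using less.prems(2) by simp
    have smaller: "card E' \<le> 3 * card V - 9"
      if "model (V - {v}) E' K' G'" "v \<in> V" for v and E' :: "'a set set" and K' G'
    proof -
      have c: "card (V - {v}) = card V - 1" using that(2) finV by simp
      have "card E' \<le> 3 * card (V - {v}) - 6"
        by (rule less.hyps[OF _ _ _ that(1)]) (use c finV V4 in auto)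
      then show ?thesis unfolding c using V4 by linarith
    qed
    show ?thesis
    proof (rule ccontr)
      assume "\<not> card E \<le> 3 * card V - 6"
      then have "3 * card V - 5 \<le> card E" by simp
      \<comment> \<open>The count is made exact, one edge too many: then deletion and contraction
        give lower bounds, while the average degree stays below 6.\<close>
      then obtain F where F: "F \<subseteq> E" "card F = 3 * card V - 5" by (meson obtain_subset_with_card_n)
      have m: "model V F K G" by (rule model_subset[OF less.prems(3) F(1)])
      \<comment> \<open>Graphs with one vertex less have at most 3n - 9 edges, so deletion and
        contraction each destroy at least 4 of the 3n - 5 edges. For a contraction one of the four
        is the contracted edge.\<close>
      have deg: "4 \<le> card (nbrs F v)" if "v \<in> V" for v
        using smaller[OF model_delete[OF m] that] card_edges_split[OF finV m, of v] F(2) V4 by simp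
      have common: "3 \<le> card (nbrs F u \<inter> nbrs F v)" if uv: "{u, v} \<in> F" for u v
      proof -
        obtain K' G' where
          m': "model (V - {v}) ({e \<in> F. v \<notin> e} \<union> (\<lambda>w. {u, w}) ` {w. {v, w} \<in> F \<and> w \<noteq> u}) K' G'"
          by (rule model_contract[OF m uv])
        have "v \<in> V" by (rule model_edge[OF m uv])
        from smaller[OF m' this] show ?thesis using card_contract[OF finV m uv] F(2) V4 by simp
      qed
      have irr: "x \<notin> nbrs F x" for x using model_nbrs[OF m, of x] by blast
      obtain v where v: "v \<in> V" "card (nbrs F v) \<le> 5"
      proof (rule ccontr)
        assume "\<not> thesis"
        then have "6 \<le> card (nbrs F x)" if "x \<in> V" for x using that \<open>\<And>v. _ \<Longrightarrow> _ \<Longrightarrow> thesis\<close> by force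
        then have "(\<Sum>x\<in>V. 6) \<le> (\<Sum>x\<in>V. card (nbrs F x))" by (intro sum_mono)
        then show False using handshake[OF finV m] F(2) V4 by simp
      qed
      let ?N = "nbrs F v"
      have N: "?N \<subseteq> V" "v \<notin> ?N" using model_nbrs[OF m, of v] by auto
      have finN: "finite ?N" using finV N(1) finite_subset by blast
      have min: "3 \<le> card (nbrs F x \<inter> ?N)" if "x \<in> ?N" for x
        using common[of v x] that by (simp add: nbrs_def Int_commute)
      have edge: "{x, y} \<in> F \<longleftrightarrow> y \<in> nbrs F x" for x y by (simp add: nbrs_def)
      show False
      proof (cases "card ?N = 4")
        case True
        obtain xs where xs: "set xs = ?N" "distinct xs" using finite_distinct_list[OF finN] by blast
        then have "length xs = 4" using True distinct_card by fastforce
        then obtain a b c d where abcd: "xs = [a, b, c, d]" by (auto simp: length_Suc_conv eval_nat_numeral)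
        have full: "y \<in> nbrs F x" if "x \<in> ?N" "y \<in> ?N" "x \<noteq> y" for x y
        proof -
          have "nbrs F x \<inter> ?N \<subseteq> ?N - {x}" using irr by blast
          moreover have "card (?N - {x}) = 3" using True that(1) finN by simp
          ultimately have "nbrs F x \<inter> ?N = ?N - {x}"
            using min[OF that(1)] finN by (intro card_seteq) auto
          then show ?thesis using that by blast
        qed
        have full': "{x, y} \<in> F" if "x \<in> insert v ?N" "y \<in> insert v ?N" "x \<noteq> y" for x y
          using full[of x y] that nbrs_sym[of v F x] by (auto simp: edge)
        have ins: "{v, a, b, c, d} = insert v ?N" using xs abcd by auto
        show False
        proof (rule model_no_K5[OF m, of v a b c d])
          show "distinct [v, a, b, c, d]" using xs abcd N(2) by auto
        qed (use ins full' v N in auto)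
      next
        case False
        then have "card ?N = 5" using deg[OF v(1)] v(2) by simp
        from near_complete_five[OF this min irr] obtain w a b c d where
          abcd: "?N = {w, a, b, c, d}" "distinct [w, a, b, c, d]"
          "{a, b, c, d} \<subseteq> nbrs F w" "{c, d} \<subseteq> nbrs F a" "{c, d} \<subseteq> nbrs F b" by metis
        \<comment> \<open>Merging \<open>c\<close> into \<open>a\<close> repairs both possible
          defects: \<open>c\<close> is adjacent to \<open>b\<close> and supplies the edge
          \<open>{a, b}\<close>, and the pair \<open>c\<close>, \<open>d\<close> disappears.\<close>
        have ac: "{a, c} \<in> F" using abcd(4) by (simp add: edge)
        let ?F = "{e \<in> F. c \<notin> e} \<union> (\<lambda>w. {a, w}) ` {w. {c, w} \<in> F \<and> w \<noteq> a}"
        obtain K' G' where m': "model (V - {c}) ?F K' G'" by (rule model_contract[OF m ac])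
        have vN: "w \<noteq> v" "a \<noteq> v" "b \<noteq> v" "c \<noteq> v" "d \<noteq> v" using abcd(1) N(2) by auto
        have va: "{v, w} \<in> ?F" "{v, a} \<in> ?F" "{v, b} \<in> ?F" "{v, d} \<in> ?F"
          using abcd(1,2) vN by (auto simp: edge)
        have wa: "{w, a} \<in> ?F" "{w, b} \<in> ?F" "{w, d} \<in> ?F"
          using abcd(2,3) by (auto simp: edge)
        have ab: "{a, d} \<in> ?F" "{b, d} \<in> ?F"
          using abcd(2,4,5) by (auto simp: edge)
        have "{c, b} \<in> F" using abcd(5) by (simp add: edge nbrs_sym[of c F b])
        then have cb: "{a, b} \<in> ?F" using abcd(2) by auto
        define H where "H = ?F"
        note H = va wa ab cb
        have edges: "{x, y} \<in> H" if "x \<in> {v, w, a, b, d}" "y \<in> {v, w, a, b, d}" "x \<noteq> y" for x y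
          using that H[folded H_def] by (elim insertE emptyE) (simp_all add: insert_commute)
        show False
        proof (rule model_no_K5[OF m'[folded H_def], of v w a b d])
          show "distinct [v, w, a, b, d]" using abcd(2) vN by auto
          show "{v, w, a, b, d} \<subseteq> V - {c}" using abcd(1,2) N(1) v(1) vN by auto
        qed (use edges in blast)
      qed
    qed
  qed
qed

section \<open>Planar oriented graphs\<close>

lemma plane_drawing_subgraph:
  assumes d: "plane_drawing V E p \<gamma>" and WV: "W \<subseteq> V" and FE: "F \<subseteq> E" and FW: "\<And>e. e \<in> F \<Longrightarrow> e \<subseteq> W"
  shows "plane_drawing W F p \<gamma>"
proof -
  have edge: "arc (\<gamma> e)" "{pathstart (\<gamma> e), pathfinish (\<gamma> e)} = p ` e" "path_image (\<gamma> e) \<inter> p ` V = p ` e"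
    if "e \<in> F" for e
  proof -
    have "e \<in> E" using FE that by blast
    then show "arc (\<gamma> e)" "{pathstart (\<gamma> e), pathfinish (\<gamma> e)} = p ` e" "path_image (\<gamma> e) \<inter> p ` V = p ` e"
      using d by (simp_all only: plane_drawing_def)
  qed
  have pW: "p ` W \<subseteq> p ` V" using WV by blast
  have img: "path_image (\<gamma> e) \<inter> p ` W = p ` e" if "e \<in> F" for e
  proof -
    have "path_image (\<gamma> e) \<inter> p ` W = (path_image (\<gamma> e) \<inter> p ` V) \<inter> p ` W" using pW by blast
    also have "\<dots> = p ` e \<inter> p ` W" by (simp only: edge(3)[OF that])
    also have "\<dots> = p ` e" using image_mono[OF FW[OF that], of p] by (rule Int_absorb2)
    finally show ?thesis .
  qed
  \<comment> \<open>A common point is drawn as a vertex on the arc of \<open>e\<close>, hence as an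
    end of \<open>e\<close>, and the ends of \<open>e\<close> lie in \<open>W\<close>.\<close>
  have disj: "path_image (\<gamma> e) \<inter> path_image (\<gamma> f) \<subseteq> p ` W" if "e \<in> F" "f \<in> F" "e \<noteq> f" for e f
  proof -
    have "e \<in> E" "f \<in> E" using FE that by blast+
    then have "path_image (\<gamma> e) \<inter> path_image (\<gamma> f) \<subseteq> p ` V"
      using d that(3) by (simp add: plane_drawing_def)
    then have "path_image (\<gamma> e) \<inter> path_image (\<gamma> f) \<subseteq> p ` e" using edge(3)[OF that(1)] by blast
    then show ?thesis using image_mono[OF FW[OF that(1)], of p] by (rule subset_trans)
  qed
  have "inj_on p W" using d WV unfolding plane_drawing_def by (blast intro: inj_on_subset)
  then show ?thesis
    unfolding plane_drawing_def
    by (intro conjI ballI impI) (assumption | erule edge img | (rule disj; assumption))+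
qed

text \<open>Vertex sets are single points. That an edge has exactly two ends follows from the
  injectivity of \<open>p\<close> and the distinct ends of an arc.\<close>

lemma plane_drawing_model:
  assumes d: "plane_drawing V E p \<gamma>" and EV: "\<And>e. e \<in> E \<Longrightarrow> e \<subseteq> V"
  shows "model V E (\<lambda>v. {p v}) (\<lambda>e. path_image (\<gamma> e))"
proof -
  have inj: "inj_on p V" using d by (simp add: plane_drawing_def)
  have U: "\<Union>((\<lambda>v. {p v}) ` V) = p ` V" by blast
  show ?thesis
    unfolding model_def U
  proof (intro conjI ballI impI)
    fix e assume e: "e \<in> E"
    have edge: "arc (\<gamma> e)" "{pathstart (\<gamma> e), pathfinish (\<gamma> e)} = p ` e" "path_image (\<gamma> e) \<inter> p ` V = p ` e"
      using d e by (simp_all only: plane_drawing_def)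
    obtain u where u: "u \<in> e" "p u = pathstart (\<gamma> e)" using edge(2) by (metis imageE insertI1)
    obtain v where v: "v \<in> e" "p v = pathfinish (\<gamma> e)" using edge(2) by (metis imageE insertCI)
    have "w \<in> {u, v}" if "w \<in> e" for w
    proof -
      have "p w \<in> {p u, p v}" using edge(2) that u(2) v(2) by auto
      then show ?thesis using inj EV[OF e] that u(1) v(1) by (auto simp: inj_on_def)
    qed
    then have eq: "e = {u, v}" using u(1) v(1) by blast
    have a: "arc_between (path_image (\<gamma> e)) (p u) (p v)"
      using edge(1) u(2) v(2) by (auto simp: arc_between_def)
    have "u \<in> V" "v \<in> V" using EV[OF e] u(1) v(1) by auto
    moreover have "u \<noteq> v" using arc_between_ends[OF a] by auto
    moreover have "path_image (\<gamma> e) \<inter> p ` V = {p u, p v}" using edge(3) eq by simp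
    ultimately show "\<exists>u\<in>V. \<exists>v\<in>V. \<exists>x\<in>{p u}. \<exists>y\<in>{p v}. u \<noteq> v \<and> e = {u, v} \<and>
        arc_between (path_image (\<gamma> e)) x y \<and> path_image (\<gamma> e) \<inter> p ` V = {x, y}"
      using a eq by blast
  next
    fix u v assume "u \<in> V" "v \<in> V" "u \<noteq> v"
    then show "{p u} \<inter> {p v} = {}" using inj by (auto simp: inj_on_def)
  next
    fix e f assume "e \<in> E" "f \<in> E" "e \<noteq> f"
    then show "path_image (\<gamma> e) \<inter> path_image (\<gamma> f) \<subseteq> p ` V" using d by (simp add: plane_drawing_def)
  qed simp
qed

lemma plane_drawing_card_edges:
  assumes "finite V" and d: "plane_drawing V E p \<gamma>" and EV: "\<And>e. e \<in> E \<Longrightarrow> e \<subseteq> V"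
  shows "3 \<le> card V \<Longrightarrow> card E \<le> 3 * card V - 6" "V \<noteq> {} \<Longrightarrow> card E < 3 * card V"
    "card V = 2 \<Longrightarrow> card E \<le> 1"
proof -
  have m: "model V E (\<lambda>v. {p v}) (\<lambda>e. path_image (\<gamma> e))" by (rule plane_drawing_model[OF d EV])
  have "card E \<le> card {e. e \<subseteq> V \<and> card e = 2}"
    by (rule card_mono[OF _ model_finite_edges(2)[OF assms(1) m]]) (use assms(1) in simp)
  then have le: "card E \<le> card V choose 2" by (simp only: n_subsets[OF assms(1)])
  show 3: "3 \<le> card V \<Longrightarrow> card E \<le> 3 * card V - 6" by (rule model_card_edges[OF assms(1) _ m])
  show "card V = 2 \<Longrightarrow> card E \<le> 1" using le by simp
  assume "V \<noteq> {}"
  then have pos: "0 < card V" using assms(1) by (simp add: card_gt_0_iff)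
  show "card E < 3 * card V"
  proof (cases "3 \<le> card V")
    case True
    then show ?thesis using 3 pos by linarith
  next
    case False
    then have "card V = 1 \<or> card V = 2" using pos by linarith
    then show ?thesis using le by (auto simp: choose_two)
  qed
qed

section \<open>The arc relation of an oriented graph\<close>

context oriented_graph
begin

lemma asym_arcs_ends: "asym (arcs_ends G)"
proof (rule asymI)
  fix a b assume "(a, b) \<in> arcs_ends G"
  then show "(b, a) \<notin> arcs_ends G" using no_digons by (auto simp: arcs_ends_def arc_to_ends_def)
qed

lemma arcs_ends_verts: "arcs_ends G \<subseteq> verts G \<times> verts G"
  by (auto simp: arcs_ends_def arc_to_ends_def)

lemma card_arcs_ends: "card (arcs_ends G) = card (arcs G)"
  unfolding arcs_ends_def by (rule card_image[OF inj_on_arc_to_ends])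

text \<open>Without digons, forgetting directions identifies no two arcs.\<close>

lemma card_undirected:
  assumes "R \<subseteq> arcs_ends G"
  shows "card ((\<lambda>(a, b). {a, b}) ` R) = card R"
proof (rule card_image)
  have "(b, a) \<notin> R" if "(a, b) \<in> R" for a b
    using asymD[OF asym_arcs_ends, of a b] assms that by blast
  then show "inj_on (\<lambda>(a, b). {a, b}) R"
    unfolding inj_on_def by (fastforce simp: doubleton_eq_iff)
qed

lemma underlying_edges_eq: "underlying_edges G = (\<lambda>(a, b). {a, b}) ` arcs_ends G"
  by (simp add: underlying_edges_def arcs_ends_def arc_to_ends_def image_image)

lemma feedback_vertex_setI:
  assumes "S \<subseteq> verts G" "acyclic (Restr (arcs_ends G) (verts G - S))"
  shows "feedback_vertex_set G S"
  unfolding feedback_vertex_set_def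
proof (intro conjI notI)
  let ?H = "G \<restriction> (verts G - S)"
  assume "\<exists>c. pre_digraph.cycle ?H c"
  then obtain c u where c: "pre_digraph.awalk ?H u c u" "c \<noteq> []"
    by (auto simp: pre_digraph.cycle_def)
  interpret H: wf_digraph ?H by unfold_locales auto
  have "(u, u) \<in> (arcs_ends ?H)\<^sup>+" using c H.reachable1_awalk by blast
  moreover have "arcs_ends ?H \<subseteq> Restr (arcs_ends G) (verts G - S)"
    by (auto simp: arcs_ends_def arc_to_ends_def)
  ultimately have "(u, u) \<in> (Restr (arcs_ends G) (verts G - S))\<^sup>+" by (metis trancl_mono)
  then show False using assms(2) by (simp add: acyclic_def)
qed (rule assms(1))

end

theorem corollary9:
  fixes G :: "('a, 'b) pre_digraph"
  assumes "oriented_graph G" and "planar G"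
  shows "real (fv G) \<le> (2 * real (card (verts G)) + real (card (arcs G))) / 9 \<and>
    (card (verts G) \<ge> 2 \<longrightarrow> real (fv G) \<le> (5 * real (card (verts G)) - 6) / 9)"
proof -
  interpret oriented_graph G by fact
  let ?V = "verts G" and ?E = "arcs_ends G"
  obtain p \<gamma> where d: "plane_drawing ?V (underlying_edges G) p \<gamma>"
    using assms(2) by (auto simp: planar_def planar_graph_def)
  have sparse: "card (Restr ?E U) < 3 * card U" if U: "U \<subseteq> ?V" "U \<noteq> {}" for U
  proof -
    let ?F = "(\<lambda>(a, b). {a, b}) ` Restr ?E U"
    have "plane_drawing U ?F p \<gamma>"
      by (rule plane_drawing_subgraph[OF d U(1)]) (auto simp: underlying_edges_eq)
    then have "card ?F < 3 * card U"
      by (rule plane_drawing_card_edges(2)[rotated]) (use U finite_subset[OF U(1)] in auto)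
    then show ?thesis using card_undirected[of "Restr ?E U"] by simp
  qed
  obtain S where S: "S \<subseteq> ?V" "acyclic (Restr ?E (?V - S))" "9 * card S \<le> 2 * card ?V + card ?E"
    using sparse_feedback[OF finite_verts arcs_ends_verts asym_arcs_ends sparse] by blast
  have "finite S" using S(1) finite_verts by (rule finite_subset)
  then have "fv G \<le> card S"
    unfolding fv_def using feedback_vertex_setI[OF S(1,2)] by (intro Least_le) blast
  then have le: "9 * fv G \<le> 2 * card ?V + card (arcs G)" using S(3) card_arcs_ends by simp
  \<comment> \<open>For n = 1 the bound 5n - 6 is negative, which accounts for the
    restriction.\<close>
  have "9 * fv G + 6 \<le> 5 * card ?V" if n: "2 \<le> card ?V"
  proof -
    have EV: "e \<subseteq> ?V" if "e \<in> underlying_edges G" for e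
      using that by (auto simp: underlying_edges_def)
    have U: "card (underlying_edges G) = card (arcs G)"
      unfolding underlying_edges_eq by (simp add: card_undirected card_arcs_ends)
    show ?thesis
    proof (cases "card ?V = 2")
      case True
      \<comment> \<open>The bound 3n - 6 starts at n = 3. For n = 2 the first bound gives 9
        \<open>fv G\<close> <= 5, which forces 0.\<close>
      then have "card (arcs G) \<le> 1"
        using plane_drawing_card_edges(3)[OF finite_verts d EV] U by simp
      then have "fv G = 0" using le True by linarith
      then show ?thesis using True by simp
    next
      case False
      then show ?thesis
        using plane_drawing_card_edges(1)[OF finite_verts d EV] U n le by simp
    qed
  qed
  then have "2 \<le> card ?V \<longrightarrow> 9 * real (fv G) + 6 \<le> 5 * real (card ?V)" by auto
  moreover have "9 * real (fv G) \<le> 2 * real (card ?V) + real (card (arcs G))" using le by linarith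
  ultimately show ?thesis by (simp add: field_simps)
qed

end
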